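(* Let $q$ be a fixed prime power. The $n\to\infty$ limit of the probability that a uniformly random element of $GL(n,q)$ is regular is $$\frac{1-\frac{1}{q^5}}{1+\frac{1}{q^3}}.$$
   Context: $GL(n,q)$ is the group of invertible $n\times n$ matrices over the finite field $F_q$, and $\overline{F_q}$ is an algebraic closure of $F_q$. An element $\alpha\in GL(n,q)\subset GL(n,\overline{F_q})$ is regular if the dimension of its centralizer in the algebraic group $GL(n,\overline{F_q})$ is as small as possible (namely $n$, the rank of the group). *)

theory Defs
  imports
    "HOL-Algebra.Algebraic_Closure_Type"
    "HOL-Probability.Probability_Mass_Function"
    "HOL-Number_Theory.Prime_Powers"
    "Jordan_Normal_Form.Matrix"
begin

definition GL :: "nat \<Rightarrow> 'a::field mat set" where
  "GL n = {A \<in> carrier_mat n n. invertible_mat A}"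

lemma one_mat_in_GL: "1\<^sub>m n \<in> GL n"
  by (auto simp: GL_def invertible_mat_def inverts_mat_def square_mat.simps intro!: exI[of _ "1\<^sub>m n"])

lemma finite_GL: "finite (GL n :: 'a::{field,finite} mat set)"
proof (rule finite_subset)
  show "(GL n :: 'a mat set) \<subseteq>
      (\<lambda>f. mat n n f) ` (({0..<n} \<times> {0..<n}) \<rightarrow>\<^sub>E UNIV)"
  proof
    fix A :: "'a mat" assume "A \<in> GL n"
    then have "A = mat n n (restrict (\<lambda>ij. A $$ ij) ({0..<n} \<times> {0..<n}))"
      by (auto simp: GL_def intro!: eq_matI)
    moreover have "restrict (\<lambda>ij. A $$ ij) ({0..<n} \<times> {0..<n}) \<in>
        ({0..<n} \<times> {0..<n}) \<rightarrow>\<^sub>E UNIV"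
      by simp
    ultimately show "A \<in> (\<lambda>f. mat n n f) ` (({0..<n} \<times> {0..<n}) \<rightarrow>\<^sub>E UNIV)"
      by blast
  qed
qed (intro finite_imageI finite_PiE; simp)

definition centralizer_GL :: "nat \<Rightarrow> 'a::field mat \<Rightarrow> 'a mat set" where
  "centralizer_GL n A = {B \<in> GL n. A * B = B * A}"


text \<open>
  The Zariski topology on the affine space of \<open>n \<times> n\<close> matrices.  Polynomials in the \<open>n\<^sup>2\<close> matrix
  entries enter only through the functions they induce, which is all that their zero loci depend on.
\<close>

inductive_set poly_fun :: "nat \<Rightarrow> ('a::field mat \<Rightarrow> 'a) set" for n where
  const: "(\<lambda>_. c) \<in> poly_fun n"
| entry: "i < n \<Longrightarrow> j < n \<Longrightarrow> (\<lambda>A. A $$ (i, j)) \<in> poly_fun n"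
| add: "p \<in> poly_fun n \<Longrightarrow> q \<in> poly_fun n \<Longrightarrow> (\<lambda>A. p A + q A) \<in> poly_fun n"
| mult: "p \<in> poly_fun n \<Longrightarrow> q \<in> poly_fun n \<Longrightarrow> (\<lambda>A. p A * q A) \<in> poly_fun n"

definition zero_locus :: "nat \<Rightarrow> ('a::field mat \<Rightarrow> 'a) set \<Rightarrow> 'a mat set" where
  "zero_locus n S = {A \<in> carrier_mat n n. \<forall>p\<in>S. p A = 0}"

definition zariski :: "nat \<Rightarrow> 'a::field mat topology" where
  "zariski n = topology (\<lambda>U. \<exists>S \<subseteq> poly_fun n. U = carrier_mat n n - zero_locus n S)"

lemma istopology_zariski:
  "istopology (\<lambda>U :: 'a::field mat set. \<exists>S \<subseteq> poly_fun n. U = carrier_mat n n - zero_locus n S)"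
  (is "istopology ?P")
  unfolding istopology_def
proof (intro conjI allI impI)
  fix U V :: "'a mat set" assume "?P U" "?P V"
  then obtain S T where S: "S \<subseteq> poly_fun n" "U = carrier_mat n n - zero_locus n S"
    and T: "T \<subseteq> poly_fun n" "V = carrier_mat n n - zero_locus n T" by blast
  let ?ST = "{(\<lambda>A. p A * q A) | p q. p \<in> S \<and> q \<in> T}"
  have "?ST \<subseteq> poly_fun n" using S(1) T(1) by (auto intro: poly_fun.mult)
  moreover have "U \<inter> V = carrier_mat n n - zero_locus n ?ST"
    unfolding S T zero_locus_def by fastforce
  ultimately show "?P (U \<inter> V)" by blast
next
  fix \<U> :: "'a mat set set" assume "\<forall>U\<in>\<U>. ?P U"
  then have "\<forall>U\<in>\<U>. \<exists>S. S \<subseteq> poly_fun n \<and> U = carrier_mat n n - zero_locus n S"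
    by blast
  from bchoice[OF this] obtain S where
    S: "\<forall>U\<in>\<U>. S U \<subseteq> poly_fun n \<and> U = carrier_mat n n - zero_locus n (S U)" ..
  have mem: "A \<in> U \<longleftrightarrow> A \<in> carrier_mat n n \<and> (\<exists>p\<in>S U. p A \<noteq> 0)" if "U \<in> \<U>" for A U
  proof -
    have "U = carrier_mat n n - zero_locus n (S U)" using S that by blast
    then have "A \<in> U \<longleftrightarrow> A \<in> carrier_mat n n - zero_locus n (S U)" by (rule arg_cong)
    then show ?thesis unfolding zero_locus_def by blast
  qed
  show "?P (\<Union>\<U>)"
  proof (intro exI conjI)
    show "(\<Union>U\<in>\<U>. S U) \<subseteq> poly_fun n" using S by blast
    show "\<Union>\<U> = carrier_mat n n - zero_locus n (\<Union>U\<in>\<U>. S U)"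
    proof (rule Set.set_eqI)
      fix A
      have "A \<in> \<Union>\<U> \<longleftrightarrow> (\<exists>U\<in>\<U>. A \<in> carrier_mat n n \<and> (\<exists>p\<in>S U. p A \<noteq> 0))"
        unfolding Union_iff using mem by (intro bex_cong refl)
      also have "\<dots> \<longleftrightarrow> A \<in> carrier_mat n n - zero_locus n (\<Union>U\<in>\<U>. S U)"
        by (auto simp: zero_locus_def)
      finally show "A \<in> \<Union>\<U> \<longleftrightarrow> A \<in> carrier_mat n n - zero_locus n (\<Union>U\<in>\<U>. S U)" .
    qed
  qed
qed

lemma openin_zariski:
  "openin (zariski n) U \<longleftrightarrow> (\<exists>S \<subseteq> poly_fun n. U = carrier_mat n n - zero_locus n S)"
  unfolding zariski_def by (subst topology_inverse'[OF istopology_zariski]) (rule refl)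

lemma topspace_zariski: "topspace (zariski n) = (carrier_mat n n :: 'a::field mat set)"
proof
  show "topspace (zariski n) \<subseteq> (carrier_mat n n :: 'a mat set)"
    unfolding topspace_def openin_zariski by blast
  have "{\<lambda>_. 1} \<subseteq> (poly_fun n :: ('a mat \<Rightarrow> 'a) set)" by (auto intro: poly_fun.const)
  moreover have "carrier_mat n n = carrier_mat n n - zero_locus n {\<lambda>_::'a mat. 1}"
    by (auto simp: zero_locus_def)
  ultimately have "openin (zariski n) (carrier_mat n n :: 'a mat set)"
    unfolding openin_zariski by blast
  then show "(carrier_mat n n :: 'a mat set) \<subseteq> topspace (zariski n)" by (rule openin_subset)
qed

lemma closedin_zariski:
  "closedin (zariski n) (C :: 'a::field mat set) \<longleftrightarrow> (\<exists>S \<subseteq> poly_fun n. C = zero_locus n S)"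
proof -
  have *: "zero_locus n S \<subseteq> carrier_mat n n" for S :: "('a mat \<Rightarrow> 'a) set"
    by (auto simp: zero_locus_def)
  have "C \<subseteq> carrier_mat n n \<and> carrier_mat n n - C = carrier_mat n n - zero_locus n S
      \<longleftrightarrow> C = zero_locus n S" for S
    using *[of S] by blast
  then show ?thesis
    unfolding closedin_def topspace_zariski openin_zariski by blast
qed

definition irreducible_in :: "'b topology \<Rightarrow> 'b set \<Rightarrow> bool" where
  "irreducible_in T Z \<longleftrightarrow> Z \<subseteq> topspace T \<and> Z \<noteq> {} \<and>
     (\<forall>C D. closedin T C \<longrightarrow> closedin T D \<longrightarrow> Z \<subseteq> C \<union> D \<longrightarrow> Z \<subseteq> C \<or> Z \<subseteq> D)"

text \<open>
  Krull dimension: the supremum of the lengths \<open>k\<close> of strict chains \<open>Z 0 \<subset> \<dots> \<subset> Z k\<close> of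
  irreducible closed subsets.  The empty space gets dimension \<open>0\<close>; centralizers are never empty.
\<close>

definition krull_dim :: "'b topology \<Rightarrow> enat" where
  "krull_dim T = Sup {enat k | k. \<exists>Z :: nat \<Rightarrow> 'b set.
     (\<forall>i\<le>k. closedin T (Z i) \<and> irreducible_in T (Z i)) \<and> (\<forall>i<k. Z i \<subset> Z (Suc i))}"

definition centralizer_dim :: "nat \<Rightarrow> 'a::field mat \<Rightarrow> enat" where
  "centralizer_dim n A = krull_dim (subtopology (zariski n) (centralizer_GL n A))"

text \<open>
  Minimality is among all elements of \<open>GL n\<close> over the algebraic closure; the minimal value is the
  rank \<open>n\<close>.
\<close>

definition regular :: "nat \<Rightarrow> 'a::field mat \<Rightarrow> bool" where
  "regular n \<alpha> \<longleftrightarrow> \<alpha> \<in> GL n \<and>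
     (\<forall>\<beta> \<in> (GL n :: 'a alg_closure mat set).
        centralizer_dim n (map_mat to_ac \<alpha>) \<le> centralizer_dim n \<beta>)"

end

theory Submission
  imports
    Defs
    "HOL-Computational_Algebra.Polynomial_Factorial"
    "Jordan_Normal_Form.Char_Poly"
begin

text \<open>
  A matrix is regular iff it is cyclic, i.e. has a vector \<open>v\<close> whose iterates \<open>A\<^sup>j v\<close> span the space.
  If it is cyclic, the centralizer over the algebraic closure consists of the invertible polynomials
  in \<open>A\<close>, which have \<open>n\<close> coordinates. If not, some nonzero polynomial of degree less than \<open>n\<close>
  annihilates \<open>A\<close>, so over the closure some eigenspace is at least a plane, and then the commutant has
  dimension greater than \<open>n\<close>.

  A matrix with characteristic polynomial \<open>f\<close> together with a cyclic vector amounts to an invertible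
  matrix, and the cyclic vectors of a given cyclic matrix correspond to the units modulo \<open>f\<close>. Hence
  the proportion of cyclic matrices in \<open>GL n\<close> is \<open>\<Sum> 1 / \<Phi>(f)\<close> over monic \<open>f\<close> of degree \<open>n\<close> with
  \<open>f(0) \<noteq> 0\<close>, where \<open>\<Phi>\<close> is the polynomial totient. Writing \<open>|p| = q ^ degree p\<close>, expand \<open>|f| / \<Phi>(f)\<close>
  as the sum of \<open>\<Prod> 1 / (|p| - 1)\<close> over the sets of primes dividing \<open>f\<close> and interchange the sums: the
  limit is \<open>1 - 1/q\<close> times the product over the monic primes other than the variable of
  \<open>1 + 1 / (|p| (|p| - 1)) = (1 - |p|\<^sup>-\<^sup>6) / ((1 - |p|\<^sup>-\<^sup>2) (1 - |p|\<^sup>-\<^sup>3))\<close>. The Euler product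
  \<open>\<Prod> (1 - |p|\<^sup>-\<^sup>s) = 1 - q\<^sup>1\<^sup>-\<^sup>s\<close> comes from sieving the monic polynomials by the primes of
  bounded degree.
\<close>

section \<open>Monic polynomials over a finite field\<close>

text \<open>Regularity compares Krull dimensions over the algebraic closure, while cyclic matrices
  are counted over the finite field. The bridge is that both alternatives survive the extension: a
  matrix without a cyclic vector has a nonzero annihilating polynomial of degree below
  \<open>n\<close> over its own field, and a cyclic vector is detected by a nonzero determinant.
  Both dimension bounds are elementary. From below, prescribing fewer and fewer entries of an
  element of the centralizer gives a chain of affine sections; each is irreducible because a nonzero
  polynomial on a line has a non-root. From above, a chain of length \<open>k\<close> yields
  \<open>k\<close> algebraically independent functions of \<open>n\<close> coordinates, and counting
  monomials gives \<open>k \<le> n\<close>. In the limit, the prefactor \<open>1 - 1/q\<close> is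
  the density of nonzero constant terms. It cancels the value of the Euler product with exponent 2,
  while the omitted factor at the variable joins the value \<open>1 - 1/q^2\<close> of the one with
  exponent 3 to form the denominator \<open>1 + 1/q^3\<close>.\<close>

lemma field_poly_bezout:
  fixes a b :: "'a::field poly"
  shows "\<exists>u v. (u * a + v * b) dvd a \<and> (u * a + v * b) dvd b"
proof (cases "a = 0 \<and> b = 0")
  case True
  then show ?thesis by simp
next
  case False
  define I where "I = {u * a + v * b | u v. True}"
  have "1 * a + 0 * b \<in> I" "0 * a + 1 * b \<in> I" unfolding I_def by blast+
  then have ab: "a \<in> I" "b \<in> I" by simp_all
  then have "\<exists>c. c \<in> I \<and> c \<noteq> 0" using False by blast
  then obtain c where c: "c \<in> I" "c \<noteq> 0" and least: "\<And>d. d \<in> I \<Longrightarrow> d \<noteq> 0 \<Longrightarrow> degree c \<le> degree d"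
    using ex_has_least_nat[of "\<lambda>c. c \<in> I \<and> c \<noteq> 0" _ degree] by blast
  obtain u v where uv: "c = u * a + v * b" using c(1) unfolding I_def by blast
  have "c dvd d" if "d \<in> I" for d
  proof -
    from that obtain u' v' where d: "d = u' * a + v' * b" unfolding I_def by blast
    have "d mod c = (u' - d div c * u) * a + (v' - d div c * v) * b"
      unfolding minus_div_mult_eq_mod[symmetric] by (subst (1) d, subst (2) uv) (simp add: algebra_simps)
    then have "d mod c \<in> I" unfolding I_def by blast
    then have "d mod c = 0" using least[of "d mod c"] degree_mod_less[OF c(2), of d] by fastforce
    then show ?thesis by (simp add: dvd_eq_mod_eq_0)
  qed
  then show ?thesis using ab uv by blast
qed

lemma field_poly_coprime_bezout:
  fixes a b :: "'a::field poly"
  assumes "coprime a b"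
  obtains u v where "u * a + v * b = 1"
proof -
  obtain u v where "(u * a + v * b) dvd a" "(u * a + v * b) dvd b"
    using field_poly_bezout by blast
  then have "is_unit (u * a + v * b)" using assms by (meson coprime_common_divisor)
  then obtain w where "1 = (u * a + v * b) * w" by blast
  then have "(w * u) * a + (w * v) * b = 1" by (simp add: algebra_simps)
  then show ?thesis using that by blast
qed

definition monic_irred :: "'a::field poly \<Rightarrow> bool" where
  "monic_irred p \<longleftrightarrow> irreducible p \<and> lead_coeff p = 1"

lemma monic_irred_prime_elem: "monic_irred p \<Longrightarrow> prime_elem p"
  by (simp add: monic_irred_def field_poly_irreducible_imp_prime)

lemma monic_irred_not_unit: "monic_irred p \<Longrightarrow> \<not> is_unit p"
  unfolding monic_irred_def by (blast dest: irreducible_not_unit)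

lemma monic_irred_degree:
  assumes "monic_irred p"
  shows "degree p > 0"
proof -
  have "p \<noteq> 0" using assms by (auto simp: monic_irred_def)
  then show ?thesis using monic_irred_not_unit[OF assms] by (simp add: is_unit_iff_degree)
qed

lemma monic_irred_X: "monic_irred [:0, 1 :: 'a::field:]"
  unfolding monic_irred_def by (simp add: irreducible_linear_field_poly)

lemma exists_monic_irred_factor:
  fixes f :: "'a::field poly"
  assumes "\<not> is_unit f"
  shows "\<exists>p. monic_irred p \<and> p dvd f"
proof (cases "f = 0")
  case True
  then show ?thesis using monic_irred_X by auto
next
  case False
  then show ?thesis using assms
  proof (induction "degree f" arbitrary: f rule: less_induct)
    case less
    show ?case
    proof (cases "irreducible f")
      case True
      let ?c = "inverse (lead_coeff f)"
      have c: "?c \<noteq> 0" using less.prems by simp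
      have "monic_irred (smult ?c f)"
        unfolding monic_irred_def using True less.prems c
        by (simp add: irreducible_mult_unit_left[of "[:?c:]" f, simplified] is_unit_iff_degree)
      moreover have "smult ?c f dvd f" using c by (simp add: smult_dvd)
      ultimately show ?thesis by blast
    next
      case False
      then obtain a b where ab: "f = a * b" "\<not> is_unit a" "\<not> is_unit b"
        using less.prems by (auto simp: irreducible_def)
      then have "a \<noteq> 0" "b \<noteq> 0" using less.prems by auto
      moreover have "degree b > 0" using ab(3) \<open>b \<noteq> 0\<close> by (simp add: is_unit_iff_degree)
      ultimately have "degree a < degree f" by (simp add: ab(1) degree_mult_eq)
      then show ?thesis using less.hyps[of a] ab \<open>a \<noteq> 0\<close> by (metis dvd_mult2)
    qed
  qed
qed

text \<open>The cofactor is a constant by irreducibility, and comparing leading coefficients makes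
  it 1. Monic irreducibles thus represent the primes without associates.\<close>

lemma monic_irred_dvd_eq:
  assumes "monic_irred p" "monic_irred r" "p dvd r"
  shows "p = r"
proof -
  obtain s where s: "r = p * s" using assms(3) by blast
  have "\<not> is_unit p" by (rule monic_irred_not_unit[OF assms(1)])
  then have "is_unit s" using assms(2) s unfolding monic_irred_def by (blast dest: irreducibleD)
  then obtain c where "s = [:c:]" by (metis is_unit_polyE)
  moreover have "lead_coeff r = lead_coeff p * lead_coeff s" unfolding s by (rule lead_coeff_mult)
  ultimately have "s = 1" using assms(1,2) by (simp add: monic_irred_def)
  then show ?thesis using s by simp
qed

lemma prime_elem_dvd_prodE:
  assumes "prime_elem p" "finite S" "p dvd prod f S"
  obtains x where "x \<in> S" "p dvd f x"
proof -
  have "\<exists>x\<in>S. p dvd f x"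
    using assms(2,3)
  proof (induction S)
    case empty
    then show ?case using assms(1) by (auto simp: prime_elem_def)
  next
    case (insert x S)
    then show ?case using prime_elem_dvd_mult_iff[OF assms(1)] by auto
  qed
  then show ?thesis using that by blast
qed

text \<open>Distinct monic irreducibles do not divide each other, so a further prime
  \<open>p\<close> does not divide the product over \<open>S\<close> and must divide the
  cofactor.\<close>

lemma prod_monic_irred_dvd_iff:
  assumes "finite S" "\<And>p. p \<in> S \<Longrightarrow> monic_irred p"
  shows "\<Prod>S dvd f \<longleftrightarrow> (\<forall>p\<in>S. p dvd f)"
  using assms
proof (induction S arbitrary: f)
  case (insert p S)
  have pp: "prime_elem p" using insert.prems monic_irred_prime_elem by blast
  have np: "\<not> p dvd \<Prod>S"
  proof
    assume "p dvd \<Prod>S"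
    then obtain r where "r \<in> S" "p dvd r"
      using prime_elem_dvd_prodE[OF pp insert.hyps(1), of "\<lambda>x. x"] by blast
    then show False using insert monic_irred_dvd_eq by (metis insertCI)
  qed
  show ?case
  proof
    assume "\<Prod>(insert p S) dvd f"
    then show "\<forall>r\<in>insert p S. r dvd f"
      using insert.hyps(1) dvd_prodI[of "insert p S" _ "\<lambda>x. x"] by (meson dvd_trans finite.insertI)
  next
    assume *: "\<forall>r\<in>insert p S. r dvd f"
    then have "\<Prod>S dvd f" using insert by auto
    then obtain c where c: "f = \<Prod>S * c" by blast
    then have "p dvd c" using * np pp by (metis insertI1 prime_elem_dvd_mult_iff)
    then show "\<Prod>(insert p S) dvd f" using insert.hyps c by (auto simp: mult.commute intro: mult_dvd_mono)
  qed
qed simp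

lemma monic_prod_monic_irred:
  assumes "\<And>p. p \<in> S \<Longrightarrow> monic_irred p"
  shows "lead_coeff (\<Prod>S) = 1"
  using assms by (simp add: lead_coeff_prod monic_irred_def)

lemma degree_prod_monic_irred:
  assumes "\<And>p. p \<in> S \<Longrightarrow> monic_irred p"
  shows "degree (\<Prod>S) = sum degree S"
  using assms by (intro degree_prod_eq_sum_degree) (fastforce dest: monic_irred_degree)

section \<open>Counting polynomials of bounded degree and monic polynomials\<close>

definition polys_below :: "nat \<Rightarrow> 'a::zero poly set" where
  "polys_below m = {g. \<forall>i\<ge>m. coeff g i = 0}"

definition monics :: "nat \<Rightarrow> 'a::{zero,one} poly set" where
  "monics n = {f. degree f = n \<and> coeff f n = 1}"

text \<open>The zero polynomial has degree 0, so a bare degree bound would lose it for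
  \<open>m = 0\<close>; the definition through coefficients makes the set a space of dimension
  \<open>m\<close> in every case.\<close>

lemma polys_below_iff: "g \<in> polys_below m \<longleftrightarrow> g = 0 \<or> degree g < m"
  unfolding polys_below_def
  by (auto simp: coeff_eq_0) (metis leading_coeff_0_iff not_le)

lemma bij_betw_polys_below_Suc:
  "bij_betw (\<lambda>(a, p). pCons a p) (UNIV \<times> polys_below m) (polys_below (Suc m) :: 'a::zero poly set)"
  unfolding bij_betw_def
proof
  show "inj_on (\<lambda>(a, p). pCons a p) (UNIV \<times> (polys_below m :: 'a poly set))" by (auto simp: inj_on_def)
  show "(\<lambda>(a, p). pCons a p) ` (UNIV \<times> polys_below m) = (polys_below (Suc m) :: 'a poly set)"
  proof (intro equalityI subsetI)
    fix f :: "'a poly" assume "f \<in> (\<lambda>(a, p). pCons a p) ` (UNIV \<times> polys_below m)"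
    then obtain a p where "p \<in> polys_below m" "f = pCons a p" by auto
    then show "f \<in> polys_below (Suc m)"
      by (auto simp: polys_below_def coeff_pCons split: nat.splits)
  next
    fix g :: "'a poly" assume g: "g \<in> polys_below (Suc m)"
    obtain a p where ap: "g = pCons a p" by (cases g)
    have "coeff p i = 0" if "i \<ge> m" for i
    proof -
      have "coeff g (Suc i) = 0" using g that by (simp add: polys_below_def)
      then show ?thesis by (simp add: ap)
    qed
    then have "p \<in> polys_below m" by (auto simp: polys_below_def)
    then show "g \<in> (\<lambda>(a, p). pCons a p) ` (UNIV \<times> polys_below m)" using ap by force
  qed
qed

lemma card_polys_below: "card (polys_below m :: 'a::{zero,finite} poly set) = CARD('a) ^ m"
  and finite_polys_below: "finite (polys_below m :: 'a::{zero,finite} poly set)"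
proof (induction m)
  case 0
  have "polys_below 0 = {0 :: 'a poly}" by (auto simp: polys_below_def poly_eq_iff)
  then show "card (polys_below 0 :: 'a poly set) = CARD('a) ^ 0" "finite (polys_below 0 :: 'a poly set)"
    by simp_all
next
  case (Suc m)
  note b = bij_betw_polys_below_Suc[of m, where ?'a = 'a]
  show "card (polys_below (Suc m) :: 'a poly set) = CARD('a) ^ Suc m"
    using bij_betw_same_card[OF b] Suc by (simp add: card_cartesian_product)
  show "finite (polys_below (Suc m) :: 'a poly set)"
    using bij_betw_finite[OF b] Suc by simp
qed

lemma bij_betw_monics:
  "bij_betw (\<lambda>g. monom 1 n + g) (polys_below n) (monics n :: 'a::field poly set)"
  unfolding bij_betw_def
proof
  show "inj_on (\<lambda>g. monom 1 n + g) (polys_below n :: 'a poly set)" by (auto simp: inj_on_def)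
  show "(\<lambda>g. monom 1 n + g) ` polys_below n = (monics n :: 'a poly set)"
  proof safe
    fix g :: "'a poly" assume g: "g \<in> polys_below n"
    then have "coeff (monom 1 n + g) n = 1" by (simp add: polys_below_def)
    moreover have "degree (monom 1 n + g) \<le> n"
      using g by (intro degree_le) (auto simp: polys_below_def coeff_monom)
    ultimately show "monom 1 n + g \<in> monics n"
      unfolding monics_def by (metis (mono_tags, lifting) le_degree mem_Collect_eq antisym zero_neq_one)
  next
    fix f :: "'a poly" assume f: "f \<in> monics n"
    have "f - monom 1 n \<in> polys_below n"
      using f by (auto simp: polys_below_def monics_def coeff_eq_0)
    then show "f \<in> (\<lambda>g. monom 1 n + g) ` polys_below n" by (intro image_eqI[of _ _ "f - monom 1 n"]) auto
  qed
qed

lemma card_monics: "card (monics n :: 'a::{field,finite} poly set) = CARD('a) ^ n"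
  using bij_betw_same_card[OF bij_betw_monics[of n, where ?'a = 'a]] by (simp add: card_polys_below)

lemma finite_monics: "finite (monics n :: 'a::{field,finite} poly set)"
  using bij_betw_finite[OF bij_betw_monics[of n, where ?'a = 'a]] by (simp add: finite_polys_below)

lemma bij_betw_monic_multiples:
  fixes d :: "'a::field poly"
  assumes "lead_coeff d = 1" "degree d \<le> n"
  shows "bij_betw (\<lambda>g. d * g) (monics (n - degree d)) {f \<in> monics n. d dvd f}"
  unfolding bij_betw_def
proof
  have d0: "d \<noteq> 0" using assms(1) by auto
  show "inj_on (\<lambda>g. d * g) (monics (n - degree d))" using d0 by (auto simp: inj_on_def)
  have *: "d * g \<in> monics n \<longleftrightarrow> g \<in> monics (n - degree d)" for g
  proof (cases "g = 0")
    case False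
    then have "degree (d * g) = degree d + degree g" using d0 by (simp add: degree_mult_eq)
    moreover have "lead_coeff (d * g) = lead_coeff g" by (simp add: lead_coeff_mult assms(1))
    ultimately show ?thesis using assms(2) by (auto simp: monics_def)
  qed (simp add: monics_def)
  show "(\<lambda>g. d * g) ` monics (n - degree d) = {f \<in> monics n. d dvd f}"
    using * by (auto elim!: dvdE)
qed

lemma no_monic_multiples:
  assumes "f \<in> monics n" "n < degree d"
  shows "\<not> d dvd (f :: 'a::field poly)"
  using assms dvd_imp_degree_le[of d f] unfolding monics_def by force

lemma bij_betw_below_multiples:
  fixes d :: "'a::field poly"
  assumes "d \<noteq> 0" "degree d \<le> n"
  shows "bij_betw (\<lambda>g. d * g) (polys_below (n - degree d)) {f \<in> polys_below n. d dvd f}"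
  unfolding bij_betw_def
proof
  show "inj_on (\<lambda>g. d * g) (polys_below (n - degree d))" using assms by (auto simp: inj_on_def)
  have *: "d * g \<in> polys_below n \<longleftrightarrow> g \<in> polys_below (n - degree d)" for g
    using assms by (cases "g = 0") (auto simp: polys_below_iff degree_mult_eq)
  show "(\<lambda>g. d * g) ` polys_below (n - degree d) = {f \<in> polys_below n. d dvd f}"
    using * by (auto elim!: dvdE)
qed

lemma bij_betw_multiples_restrict:
  fixes d :: "'a::field poly"
  assumes b: "bij_betw (\<lambda>g. d * g) B {f \<in> A. d dvd f}" and Q: "\<And>g. Q g \<longleftrightarrow> Q (d * g)"
  shows "bij_betw (\<lambda>g. d * g) {g \<in> B. Q g} {f \<in> {f \<in> A. d dvd f}. Q f}"
  unfolding bij_betw_def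
proof
  show "inj_on (\<lambda>g. d * g) {g \<in> B. Q g}"
    using b unfolding bij_betw_def by (auto intro: inj_on_subset)
  have B: "(\<lambda>g. d * g) ` B = {f \<in> A. d dvd f}" using b by (simp add: bij_betw_def)
  show "(\<lambda>g. d * g) ` {g \<in> B. Q g} = {f \<in> {f \<in> A. d dvd f}. Q f}"
    unfolding B[symmetric] by (subst Q) (rule Compr_image_eq[symmetric])
qed

text \<open>Sieving: among the polynomials prime to \<open>S\<close>, those divisible by \<open>p\<close> are the \<open>p\<close>-multiples
  of such polynomials.\<close>

lemma card_sieve_step:
  fixes p :: "'a::field poly"
  assumes p: "monic_irred p" "p \<notin> S" and S: "\<And>r. r \<in> S \<Longrightarrow> monic_irred r"
    and fin: "finite A"
    and bij: "bij_betw (\<lambda>g. p * g) B {f \<in> A. p dvd f}"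
  shows "card {f \<in> A. \<forall>r\<in>insert p S. \<not> r dvd f}
       = card {f \<in> A. \<forall>r\<in>S. \<not> r dvd f} - card {g \<in> B. \<forall>r\<in>S. \<not> r dvd g}"
    and "card {g \<in> B. \<forall>r\<in>S. \<not> r dvd g} \<le> card {f \<in> A. \<forall>r\<in>S. \<not> r dvd f}"
proof -
  have eq: "r dvd p * g \<longleftrightarrow> r dvd g" if "r \<in> S" for r g
    using S[OF that] that p monic_irred_dvd_eq[of r p] monic_irred_prime_elem[of r]
    by (auto simp: prime_elem_dvd_mult_iff)
  have b: "bij_betw (\<lambda>g. p * g) {g \<in> B. \<forall>r\<in>S. \<not> r dvd g} {f \<in> {f \<in> A. p dvd f}. \<forall>r\<in>S. \<not> r dvd f}"
    by (rule bij_betw_multiples_restrict[OF bij]) (simp add: eq)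
  let ?C = "{f \<in> {f \<in> A. p dvd f}. \<forall>r\<in>S. \<not> r dvd f}"
  have c: "card {g \<in> B. \<forall>r\<in>S. \<not> r dvd g} = card ?C" using bij_betw_same_card[OF b] .
  have *: "{f \<in> A. \<forall>r\<in>insert p S. \<not> r dvd f} = {f \<in> A. \<forall>r\<in>S. \<not> r dvd f} - ?C" by auto
  show "card {f \<in> A. \<forall>r\<in>insert p S. \<not> r dvd f}
       = card {f \<in> A. \<forall>r\<in>S. \<not> r dvd f} - card {g \<in> B. \<forall>r\<in>S. \<not> r dvd g}"
    unfolding * c using fin by (intro card_Diff_subset) auto
  show "card {g \<in> B. \<forall>r\<in>S. \<not> r dvd g} \<le> card {f \<in> A. \<forall>r\<in>S. \<not> r dvd f}"
    unfolding c using fin by (intro card_mono) auto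
qed

text \<open>As long as the total degree of \<open>S\<close> is at most \<open>m\<close>, the
  multiples of a prime \<open>p\<close> are counted exactly by the polynomials below
  \<open>m - degree p\<close>. By induction these have the same density of survivors, so each
  sieving step multiplies the count by exactly \<open>1 - 1/|p|\<close>.\<close>

lemma card_below_coprime:
  fixes S :: "'a::{field,finite} poly set"
  assumes "finite S" "\<And>p. p \<in> S \<Longrightarrow> monic_irred p" "sum degree S \<le> m"
  shows "real (card {g \<in> polys_below m. \<forall>p\<in>S. \<not> p dvd g})
       = real CARD('a) ^ m * (\<Prod>p\<in>S. 1 - 1 / real CARD('a) ^ degree p)"
  using assms
proof (induction S arbitrary: m)
  case empty
  then show ?case by (simp add: card_polys_below)
next
  case (insert p S)
  have pm: "degree p \<le> m" "sum degree S \<le> m - degree p" "sum degree S \<le> m"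
    using insert.prems(2) insert.hyps by simp_all
  have p: "monic_irred p" and S: "\<And>r. r \<in> S \<Longrightarrow> monic_irred r" using insert by auto
  have p0: "p \<noteq> 0" using monic_irred_degree[OF p] by auto
  note step = card_sieve_step[OF p insert.hyps(2) S finite_polys_below[of m] bij_betw_below_multiples[OF p0 pm(1)]]
  have "real (card {g \<in> polys_below m. \<forall>r\<in>insert p S. \<not> r dvd g})
      = real (card {g \<in> polys_below m. \<forall>r\<in>S. \<not> r dvd g})
        - real (card {g \<in> polys_below (m - degree p). \<forall>r\<in>S. \<not> r dvd g})"
    using step S by (simp add: of_nat_diff)
  also have "\<dots> = real CARD('a) ^ m * (\<Prod>p\<in>S. 1 - 1 / real CARD('a) ^ degree p)
        * (1 - 1 / real CARD('a) ^ degree p)"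
    using insert.IH[of m] insert.IH[of "m - degree p"] S pm
    by (simp add: power_diff right_diff_distrib)
  finally show ?case
    using insert.hyps by (simp add: mult_ac)
qed

section \<open>Sieved monic polynomials and the Euler product\<close>

definition sieved :: "'a::field poly set \<Rightarrow> nat \<Rightarrow> 'a poly set" where
  "sieved S k = {f \<in> monics k. \<forall>p\<in>S. \<not> p dvd f}"

lemma card_sieved_le: "card (sieved S k :: 'a::{field,finite} poly set) \<le> CARD('a) ^ k"
  unfolding sieved_def card_monics[symmetric] by (intro card_mono finite_monics) auto

lemma card_sieved_insert:
  fixes p :: "'a::{field,finite} poly"
  assumes p: "monic_irred p" "p \<notin> S" and S: "\<And>r. r \<in> S \<Longrightarrow> monic_irred r"
  shows "real (card (sieved (insert p S) k))
     = real (card (sieved S k)) - (if degree p \<le> k then real (card (sieved S (k - degree p))) else 0)"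
proof (cases "degree p \<le> k")
  case True
  have lc: "lead_coeff p = 1" using p by (simp add: monic_irred_def)
  note step = card_sieve_step[OF p S finite_monics[of k] bij_betw_monic_multiples[OF lc True]]
  show ?thesis using True step S unfolding sieved_def by (simp add: of_nat_diff)
next
  case False
  then have "sieved (insert p S) k = sieved S k"
    unfolding sieved_def using no_monic_multiples[of _ k p] by auto
  then show ?thesis using False by simp
qed

text \<open>With no prime removed this is the geometric series counting all monic polynomials.
  Removing the multiples of \<open>p\<close> subtracts the same series shifted by
  \<open>degree p\<close>, that is, multiplies it by \<open>1 - u ^ degree p\<close>.\<close>

lemma sieved_sums:
  fixes S :: "'a::{field,finite} poly set" and u :: real
  assumes "finite S" "\<And>p. p \<in> S \<Longrightarrow> monic_irred p" "0 \<le> u" "real CARD('a) * u < 1"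
  shows "(\<lambda>k. real (card (sieved S k)) * u ^ k) sums
           ((\<Prod>p\<in>S. 1 - u ^ degree p) / (1 - real CARD('a) * u))"
  using assms
proof (induction S)
  case empty
  have "(\<lambda>k. (real CARD('a) * u) ^ k) sums (1 / (1 - real CARD('a) * u))"
    using empty by (intro geometric_sums) simp
  then show ?case by (simp add: sieved_def card_monics power_mult_distrib)
next
  case (insert p S)
  let ?F = "\<lambda>k. real (card (sieved S k)) * u ^ k" and ?q = "real CARD('a)"
  let ?d = "degree p"
  let ?s = "(\<Prod>p\<in>S. 1 - u ^ degree p) / (1 - ?q * u)"
  have F: "?F sums ?s" using insert by simp
  let ?G = "\<lambda>k. if ?d \<le> k then real (card (sieved S (k - ?d))) * u ^ k else 0"
  have "(\<lambda>k. ?G (k + ?d)) sums (u ^ ?d * ?s)"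
    using sums_mult[OF F, of "u ^ ?d"] by (simp add: power_add mult_ac)
  then have G: "?G sums (u ^ ?d * ?s)"
    by (subst (asm) sums_zero_iff_shift) auto
  have "(\<lambda>k. ?F k - ?G k) = (\<lambda>k. real (card (sieved (insert p S) k)) * u ^ k)"
    using insert by (intro ext, subst card_sieved_insert) (auto simp: left_diff_distrib)
  moreover have "?s - u ^ ?d * ?s = (\<Prod>p\<in>insert p S. 1 - u ^ degree p) / (1 - ?q * u)"
    using insert.hyps by (simp add: algebra_simps diff_divide_distrib)
  ultimately show ?case using sums_diff[OF F G] by simp
qed

definition primes_upto :: "nat \<Rightarrow> 'a::field poly set" where
  "primes_upto D = {p. monic_irred p \<and> degree p \<le> D}"

lemma finite_primes_upto: "finite (primes_upto D :: 'a::{field,finite} poly set)"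
proof (rule finite_subset)
  show "(primes_upto D :: 'a poly set) \<subseteq> polys_below (Suc D)"
    by (auto simp: primes_upto_def polys_below_iff)
qed (rule finite_polys_below)

text \<open>After sieving by all primes of degree at most \<open>D\<close>, the polynomial 1 is the
  only survivor of degree at most \<open>D\<close>. The series of \<open>sieved_sums\<close> is
  therefore 1 plus a tail starting at degree \<open>D + 1\<close>, and the tail is dominated by that
  of the geometric series with ratio \<open>q u < 1\<close>.\<close>

lemma euler_product:
  fixes u :: real
  assumes u: "0 \<le> u" "real CARD('a::{field,finite}) * u < 1"
  shows "(\<lambda>D. \<Prod>p\<in>(primes_upto D :: 'a poly set). 1 - u ^ degree p) \<longlonglongrightarrow> 1 - real CARD('a) * u"
proof -
  let ?q = "real CARD('a)"
  let ?P = "\<lambda>D. \<Prod>p\<in>(primes_upto D :: 'a poly set). 1 - u ^ degree p"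
  have s: "(\<lambda>k. real (card (sieved (primes_upto D :: 'a poly set) k)) * u ^ k) sums (?P D / (1 - ?q * u))" for D
    using u by (intro sieved_sums finite_primes_upto) (auto simp: primes_upto_def)
  have c0: "card (sieved (primes_upto D :: 'a poly set) 0) = 1" for D
  proof -
    have "sieved (primes_upto D :: 'a poly set) 0 = {1}"
      by (auto simp: sieved_def monics_def primes_upto_def dest: monic_irred_not_unit elim!: degree_eq_zeroE)
    then show ?thesis by simp
  qed
  have ck: "card (sieved (primes_upto D :: 'a poly set) k) = 0" if k: "0 < k" "k \<le> D" for D k
  proof -
    have "f \<notin> sieved (primes_upto D) k" for f :: "'a poly"
    proof
      assume f: "f \<in> sieved (primes_upto D) k"
      then have df: "degree f = k" by (simp add: sieved_def monics_def)
      then have "f \<noteq> 0" "degree f \<noteq> 0" using k by auto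
      then have "\<not> is_unit f" by (simp add: is_unit_iff_degree)
      then obtain p where p: "monic_irred p" "p dvd f" using exists_monic_irred_factor by blast
      moreover have "degree p \<le> D" using p(2) df k by (metis dvd_imp_degree_le degree_0 le_trans neq0_conv)
      ultimately show False using f by (auto simp: sieved_def primes_upto_def)
    qed
    then have "sieved (primes_upto D :: 'a poly set) k = {}" by blast
    then show ?thesis by simp
  qed
  have qu0: "0 \<le> ?q * u" using u by simp
  have bound: "\<bar>?P D / (1 - ?q * u) - 1\<bar> \<le> (?q * u) ^ Suc D / (1 - ?q * u)" for D
  proof -
    let ?f = "\<lambda>k. real (card (sieved (primes_upto D :: 'a poly set) k)) * u ^ k"
    have f1: "sum ?f {..<Suc D} = 1"
    proof -
      have "sum ?f {..<Suc D} = sum ?f {0}"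
        by (rule sum.mono_neutral_right) (use ck in \<open>auto simp: less_Suc_eq_le\<close>)
      then show ?thesis using c0 by simp
    qed
    have s': "(\<lambda>k. ?f (k + Suc D)) sums (?P D / (1 - ?q * u) - 1)"
      using sums_split_initial_segment[OF s[of D], of "Suc D"] unfolding f1 .
    have g: "(\<lambda>k. (?q * u) ^ Suc D * (?q * u) ^ k) sums ((?q * u) ^ Suc D * (1 / (1 - ?q * u)))"
      using u by (intro sums_mult geometric_sums) simp
    have le: "?f (k + Suc D) \<le> (?q * u) ^ Suc D * (?q * u) ^ k" for k
    proof -
      have "?f (k + Suc D) \<le> ?q ^ (k + Suc D) * u ^ (k + Suc D)"
        using card_sieved_le[of "primes_upto D :: 'a poly set" "k + Suc D"] u(1)
        by (intro mult_right_mono) (auto simp flip: of_nat_power simp del: power_Suc)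
      also have "\<dots> = (?q * u) ^ Suc D * (?q * u) ^ k"
        by (simp add: power_mult_distrib power_add mult_ac)
      finally show ?thesis .
    qed
    have "?P D / (1 - ?q * u) - 1 \<le> (?q * u) ^ Suc D * (1 / (1 - ?q * u))"
      by (rule sums_le[OF le s' g])
    moreover have "0 \<le> ?P D / (1 - ?q * u) - 1"
      by (rule sums_le[OF _ sums_zero s']) (use u in auto)
    ultimately show ?thesis by simp
  qed
  have nz: "1 - ?q * u > 0" using u by simp
  have "(\<lambda>D. ?P D - (1 - ?q * u)) \<longlonglongrightarrow> 0"
  proof (rule Lim_null_comparison[OF always_eventually LIMSEQ_Suc[OF LIMSEQ_realpow_zero[OF qu0 u(2)]]], rule allI)
    fix D
    have "?P D - (1 - ?q * u) = (?P D / (1 - ?q * u) - 1) * (1 - ?q * u)" using nz by (simp add: left_diff_distrib)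
    then have "norm (?P D - (1 - ?q * u)) = \<bar>?P D / (1 - ?q * u) - 1\<bar> * (1 - ?q * u)"
      using nz by (simp add: abs_mult)
    also have "\<dots> \<le> (?q * u) ^ Suc D / (1 - ?q * u) * (1 - ?q * u)"
      using bound nz by (intro mult_right_mono) simp_all
    finally show "norm (?P D - (1 - ?q * u)) \<le> (?q * u) ^ Suc D" using nz by simp
  qed
  then show ?thesis by (rule LIM_zero_cancel)
qed

section \<open>The mean of the reciprocal totient\<close>

definition prime_divisors :: "'a::field poly \<Rightarrow> 'a poly set" where
  "prime_divisors f = {p. monic_irred p \<and> p dvd f}"

lemma coprime_iff_prime_divisors:
  fixes f g :: "'a::field poly"
  shows "coprime g f \<longleftrightarrow> (\<forall>p\<in>prime_divisors f. \<not> p dvd g)"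
proof
  assume "coprime g f"
  then show "\<forall>p\<in>prime_divisors f. \<not> p dvd g"
    using coprime_common_divisor monic_irred_not_unit unfolding prime_divisors_def by blast
next
  assume *: "\<forall>p\<in>prime_divisors f. \<not> p dvd g"
  show "coprime g f"
  proof (rule coprimeI)
    fix c assume c: "c dvd g" "c dvd f"
    show "is_unit c"
    proof (rule ccontr)
      assume "\<not> is_unit c"
      then obtain p where p: "monic_irred p" "p dvd c" using exists_monic_irred_factor by blast
      then have "p \<in> prime_divisors f" "p dvd g"
        using dvd_trans[OF p(2) c(1)] dvd_trans[OF p(2) c(2)] by (auto simp: prime_divisors_def)
      then show False using * by blast
    qed
  qed
qed

lemma prime_divisors_subset_primes_upto:
  assumes "f \<noteq> 0" "degree f \<le> n"
  shows "prime_divisors f \<subseteq> primes_upto n"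
  using assms dvd_imp_degree_le[of _ f] by (fastforce simp: prime_divisors_def primes_upto_def)

lemma finite_prime_divisors: "f \<noteq> 0 \<Longrightarrow> finite (prime_divisors f :: 'a::{field,finite} poly set)"
  by (rule finite_subset[OF prime_divisors_subset_primes_upto[OF _ order_refl] finite_primes_upto])

text \<open>This is the side condition under which \<open>card_below_coprime\<close> evaluates the
  totient exactly.\<close>

lemma sum_degree_prime_divisors:
  assumes "(f :: 'a::{field,finite} poly) \<noteq> 0"
  shows "sum degree (prime_divisors f) \<le> degree f"
proof -
  have mi: "\<And>p. p \<in> prime_divisors f \<Longrightarrow> monic_irred p" by (simp add: prime_divisors_def)
  have "\<Prod>(prime_divisors f) dvd f"
    using prod_monic_irred_dvd_iff[OF finite_prime_divisors[OF assms] mi, of f]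
    by (simp add: prime_divisors_def)
  then show ?thesis
    using dvd_imp_degree_le[OF _ assms] degree_prod_monic_irred[OF mi] by metis
qed

definition totient_poly :: "'a::field poly \<Rightarrow> nat" where
  "totient_poly f = card {g \<in> polys_below (degree f). coprime g f}"

lemma totient_poly_eq:
  fixes f :: "'a::{field,finite} poly"
  assumes "f \<noteq> 0"
  shows "real (totient_poly f) = real CARD('a) ^ degree f *
     (\<Prod>p\<in>prime_divisors f. 1 - 1 / real CARD('a) ^ degree p)"
  unfolding totient_poly_def coprime_iff_prime_divisors
  using finite_prime_divisors[OF assms] sum_degree_prime_divisors[OF assms]
  by (intro card_below_coprime) (auto simp: prime_divisors_def)

lemma CARD_field_ge_2: "2 \<le> CARD('a::{field,finite})"
proof -
  have "card {0, 1 :: 'a} \<le> CARD('a)" by (rule card_mono) auto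
  then show ?thesis by simp
qed

lemma one_less_CARD_power_degree:
  "monic_irred (p :: 'a::{field,finite} poly) \<Longrightarrow> 1 < real CARD('a) ^ degree p"
  using CARD_field_ge_2[where ?'a = 'a] monic_irred_degree[of p] by (intro one_less_power) auto

text \<open>Only these primes can divide a polynomial of degree at most \<open>n\<close> with
  nonzero constant term.\<close>

definition nonzero_primes :: "nat \<Rightarrow> 'a::field poly set" where
  "nonzero_primes n = primes_upto n - {[:0, 1:]}"

lemma finite_nonzero_primes: "finite (nonzero_primes n :: 'a::{field,finite} poly set)"
  by (simp add: nonzero_primes_def finite_primes_upto)

lemma inverse_totient_poly:
  fixes f :: "'a::{field,finite} poly"
  assumes f: "f \<in> monics n" "\<not> [:0, 1:] dvd f"
  shows "1 / real (totient_poly f) = (1 / real CARD('a) ^ n) *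
    (\<Sum>S\<in>{S \<in> Pow (nonzero_primes n). \<forall>p\<in>S. p dvd f}. \<Prod>p\<in>S. 1 / (real CARD('a) ^ degree p - 1))"
proof -
  let ?N = "\<lambda>p :: 'a poly. real CARD('a) ^ degree p"
  have f0: "f \<noteq> 0" and df: "degree f = n" using f by (auto simp: monics_def)
  have "1 / real (totient_poly f) = (1 / real CARD('a) ^ n) * (\<Prod>p\<in>prime_divisors f. 1 / (1 - 1 / ?N p))"
    by (simp add: totient_poly_eq[OF f0] df prod_dividef)
  also have "(\<Prod>p\<in>prime_divisors f. 1 / (1 - 1 / ?N p)) = (\<Prod>p\<in>prime_divisors f. 1 + 1 / (?N p - 1))"
  proof (rule prod.cong)
    fix p assume "p \<in> prime_divisors f"
    then have "1 < ?N p" by (simp add: prime_divisors_def one_less_CARD_power_degree)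
    then show "1 / (1 - 1 / ?N p) = 1 + 1 / (?N p - 1)" by (simp add: field_simps)
  qed simp
  also have "\<dots> = (\<Sum>S\<in>Pow (prime_divisors f). \<Prod>p\<in>S. 1 / (?N p - 1))"
    using prod_add[OF finite_prime_divisors[OF f0], of "\<lambda>p. 1 / (?N p - 1)" "\<lambda>_. 1"] by (simp add: add.commute)
  \<comment> \<open>The index set becomes a power set independent of \<open>f\<close>, restricted by
    a divisibility condition; in this form the sum over \<open>f\<close> can be moved
    inside.\<close>
  also have "Pow (prime_divisors f) = {S \<in> Pow (nonzero_primes n). \<forall>p\<in>S. p dvd f}"
    using prime_divisors_subset_primes_upto[OF f0, of n] df f(2)
    by (auto simp: prime_divisors_def nonzero_primes_def primes_upto_def)
  finally show ?thesis .
qed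

text \<open>In degree 0 the only monic polynomial is 1, which is not a multiple of the variable.
  Hence the density is 1 there instead of \<open>1 - 1/q\<close>, and this is the source of the
  boundary case in the sums below.\<close>

lemma card_sieved_X:
  "real (card (sieved {[:0, 1:]} k :: 'a::{field,finite} poly set))
     = real CARD('a) ^ k * (if k = 0 then 1 else 1 - 1 / real CARD('a))"
  using card_sieved_insert[OF monic_irred_X[where ?'a = 'a], of "{}" k]
  by (cases k) (auto simp: sieved_def card_monics field_simps)

text \<open>Dividing by the product of \<open>S\<close> leaves a monic polynomial of the
  complementary degree. As the variable is not in \<open>S\<close>, divisibility by it passes to the
  cofactor.\<close>

lemma card_sieved_X_multiples:
  fixes S :: "'a::{field,finite} poly set"
  assumes S: "S \<subseteq> nonzero_primes n"
  shows "card {f \<in> sieved {[:0, 1:]} n. \<forall>p\<in>S. p dvd f}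
    = (if sum degree S \<le> n then card (sieved {[:0, 1:]} (n - sum degree S) :: 'a poly set) else 0)"
proof -
  let ?X = "[:0, 1 :: 'a:]"
  have fin: "finite S" using S finite_nonzero_primes finite_subset by blast
  have mi: "\<And>p. p \<in> S \<Longrightarrow> monic_irred p" using S by (auto simp: nonzero_primes_def primes_upto_def)
  note d = prod_monic_irred_dvd_iff[OF fin mi]
  have lc: "lead_coeff (\<Prod>S) = 1" and deg: "degree (\<Prod>S) = sum degree S"
    using monic_prod_monic_irred[of S] degree_prod_monic_irred[of S] mi by auto
  have X: "prime_elem ?X" by (rule monic_irred_prime_elem[OF monic_irred_X])
  have nX: "\<not> ?X dvd \<Prod>S"
  proof
    assume "?X dvd \<Prod>S"
    then obtain r where "r \<in> S" "?X dvd r" using prime_elem_dvd_prodE[OF X fin, of "\<lambda>x. x"] by blast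
    then show False using monic_irred_dvd_eq[OF monic_irred_X mi] S
      by (auto simp: nonzero_primes_def)
  qed
  show ?thesis
  proof (cases "sum degree S \<le> n")
    case True
    have b: "bij_betw (\<lambda>g. \<Prod>S * g) (monics (n - degree (\<Prod>S))) {f \<in> monics n. \<Prod>S dvd f}"
      using True deg lc by (intro bij_betw_monic_multiples) auto
    have "bij_betw (\<lambda>g. \<Prod>S * g) {g \<in> monics (n - degree (\<Prod>S)). \<not> ?X dvd g}
        {f \<in> {f \<in> monics n. \<Prod>S dvd f}. \<not> ?X dvd f}"
      by (rule bij_betw_multiples_restrict[OF b]) (use nX X in \<open>simp add: prime_elem_dvd_mult_iff\<close>)
    then have "card {f \<in> {f \<in> monics n. \<Prod>S dvd f}. \<not> ?X dvd f}
      = card {g \<in> monics (n - sum degree S). \<not> ?X dvd g}"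
      unfolding deg by (rule bij_betw_same_card[symmetric])
    moreover have "{f \<in> {f \<in> monics n. \<Prod>S dvd f}. \<not> ?X dvd f} = {f \<in> sieved {?X} n. \<forall>p\<in>S. p dvd f}"
      using d by (auto simp: sieved_def)
    ultimately show ?thesis using True by (simp add: sieved_def)
  next
    case False
    then have none: "{f \<in> sieved {?X} n. \<forall>p\<in>S. p dvd f} = {}"
      using no_monic_multiples[of _ n "\<Prod>S"] deg d by (auto simp: sieved_def)
    show ?thesis unfolding none using False by simp
  qed
qed

definition prime_sets :: "nat \<Rightarrow> 'a::field poly set set" where
  "prime_sets n = {S \<in> Pow (nonzero_primes n). sum degree S \<le> n}"

text \<open>Each prime contributes \<open>1/(|p| - 1)\<close> from the expansion of the reciprocal
  totient and \<open>1/|p|\<close> from the density of the multiples of \<open>p\<close>.\<close>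

definition set_weight :: "'a::{field,finite} poly set \<Rightarrow> real" where
  "set_weight S = (\<Prod>p\<in>S. 1 / (real CARD('a) ^ degree p * (real CARD('a) ^ degree p - 1)))"

lemma finite_prime_sets: "finite (prime_sets n :: 'a::{field,finite} poly set set)"
  by (simp add: prime_sets_def finite_nonzero_primes)

lemma sum_inverse_totient_poly:
  "(\<Sum>f\<in>sieved {[:0, 1:]} n. 1 / real (totient_poly (f :: 'a poly))) =
   (\<Sum>S\<in>(prime_sets n :: 'a::{field,finite} poly set set).
      set_weight S * (if sum degree S = n then 1 else 1 - 1 / real CARD('a)))"
proof -
  let ?q = "real CARD('a)"
  let ?X = "[:0, 1 :: 'a:]"
  let ?g = "\<lambda>S :: 'a poly set. \<Prod>p\<in>S. 1 / (?q ^ degree p - 1)"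
  let ?P = "Pow (nonzero_primes n) :: 'a poly set set"
  have finP: "finite ?P" by (simp add: finite_nonzero_primes)
  have fins: "finite (sieved {?X} n)" by (simp add: sieved_def finite_monics)
  have q0: "?q > 0" by simp
  have "(\<Sum>f\<in>sieved {?X} n. 1 / real (totient_poly f))
      = (\<Sum>f\<in>sieved {?X} n. \<Sum>S\<in>{S \<in> ?P. \<forall>p\<in>S. p dvd f}. ?g S / ?q ^ n)"
    by (intro sum.cong refl, subst inverse_totient_poly) (auto simp: sieved_def sum_distrib_left sum_divide_distrib)
  also have "\<dots> = (\<Sum>S\<in>?P. \<Sum>f\<in>{f \<in> sieved {?X} n. \<forall>p\<in>S. p dvd f}. ?g S / ?q ^ n)"
    by (rule sum.swap_restrict[OF fins finP])
  also have "\<dots> = (\<Sum>S\<in>?P. if sum degree S \<le> n then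
       set_weight S * (if sum degree S = n then 1 else 1 - 1 / ?q) else 0)"
  proof (rule sum.cong)
    fix S assume S: "S \<in> ?P"
    have w: "set_weight S = ?g S / ?q ^ sum degree S"
      unfolding set_weight_def by (simp add: power_sum prod_dividef prod.distrib)
    have "(\<Sum>f\<in>{f \<in> sieved {?X} n. \<forall>p\<in>S. p dvd f}. ?g S / ?q ^ n)
       = real (card {f \<in> sieved {?X} n. \<forall>p\<in>S. p dvd f}) * (?g S / ?q ^ n)" by simp
    also have "\<dots> = (if sum degree S \<le> n then
       set_weight S * (if sum degree S = n then 1 else 1 - 1 / ?q) else 0)"
    proof (cases "sum degree S \<le> n")
      case True
      have "?q ^ n = ?q ^ (n - sum degree S) * ?q ^ sum degree S"
        using True by (simp add: power_add[symmetric])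
      then have "?q ^ (n - sum degree S) * x * (?g S / ?q ^ n) = set_weight S * x" for x
        unfolding w using q0 by (simp del: power_sum)
      then show ?thesis
        using True S by (subst card_sieved_X_multiples) (auto simp: card_sieved_X)
    next
      case False
      then show ?thesis using S by (subst card_sieved_X_multiples) auto
    qed
    finally show "(\<Sum>f\<in>{f \<in> sieved {?X} n. \<forall>p\<in>S. p dvd f}. ?g S / ?q ^ n) = (if sum degree S \<le> n then
       set_weight S * (if sum degree S = n then 1 else 1 - 1 / ?q) else 0)" .
  qed simp
  also have "\<dots> = (\<Sum>S\<in>(prime_sets n :: 'a poly set set).
      set_weight S * (if sum degree S = n then 1 else 1 - 1 / ?q))"
    unfolding prime_sets_def by (rule sum.inter_filter[OF finP, symmetric])
  finally show ?thesis by simp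
qed

text \<open>A set of total degree at most \<open>n\<close> contains no prime of degree
  \<open>n + 1\<close>. So raising both bounds adds exactly the sets of total degree
  \<open>n + 1\<close>, which are the boundary sets in the totient sum.\<close>

lemma prime_sets_Suc:
  "(prime_sets n :: 'a::{field,finite} poly set set) = {S \<in> prime_sets (Suc n). sum degree S \<noteq> Suc n}"
proof -
  have "p \<in> nonzero_primes n" if S: "S \<subseteq> nonzero_primes (Suc n)" "sum degree S \<le> n" and p: "p \<in> S" for S and p :: "'a poly"
  proof -
    have "finite S" using S(1) finite_nonzero_primes finite_subset by blast
    then have "degree p \<le> sum degree S" using p by (simp add: member_le_sum)
    then show ?thesis using S p by (auto simp: nonzero_primes_def primes_upto_def)
  qed
  moreover have "nonzero_primes n \<subseteq> (nonzero_primes (Suc n) :: 'a poly set)"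
    by (auto simp: nonzero_primes_def primes_upto_def)
  ultimately show ?thesis unfolding prime_sets_def by (auto simp: le_Suc_eq) 
qed

definition weight_sum :: "'a::{field,finite} itself \<Rightarrow> nat \<Rightarrow> real" where
  "weight_sum _ n = (\<Sum>S\<in>(prime_sets n :: 'a poly set set). set_weight S)"

text \<open>Sets of total degree exactly \<open>n + 1\<close> keep their full weight; all others,
  which form \<open>prime_sets n\<close>, lose the fraction \<open>1/q\<close> of it.\<close>

lemma sum_inverse_totient_poly_Suc:
  "(\<Sum>f\<in>sieved {[:0, 1:]} (Suc n). 1 / real (totient_poly (f :: 'a::{field,finite} poly)))
   = weight_sum TYPE('a) (Suc n) - weight_sum TYPE('a) n / real CARD('a)"
proof -
  let ?q = "real CARD('a)"
  let ?A = "prime_sets (Suc n) :: 'a poly set set"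
  have "(\<Sum>S\<in>?A. set_weight S * (if sum degree S = Suc n then 1 else 1 - 1 / ?q))
      = (\<Sum>S\<in>?A. set_weight S - (if sum degree S \<noteq> Suc n then set_weight S / ?q else 0))"
    by (intro sum.cong) (auto simp: algebra_simps)
  also have "\<dots> = (\<Sum>S\<in>?A. set_weight S) - (\<Sum>S\<in>{S \<in> ?A. sum degree S \<noteq> Suc n}. set_weight S / ?q)"
    by (simp only: sum_subtractf sum.inter_filter[OF finite_prime_sets])
  finally show ?thesis
    unfolding sum_inverse_totient_poly weight_sum_def prime_sets_Suc[of n] by (simp add: sum_divide_distrib)
qed

lemma set_weight_nonneg: "S \<subseteq> nonzero_primes n \<Longrightarrow> 0 \<le> set_weight S"
  unfolding set_weight_def using one_less_CARD_power_degree
  by (intro prod_nonneg) (fastforce simp: nonzero_primes_def primes_upto_def)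

text \<open>With \<open>x = 1/N\<close> the second factor is \<open>(1 - x + x^2) / (1 - x)\<close>,
  and \<open>(1 + x)(1 - x + x^2) = 1 + x^3\<close>. Together with
  \<open>1 - x^6 = (1 - x^3)(1 + x^3)\<close> this explains the exponents 2, 3 and 6.\<close>

lemma euler_factor_identity:
  fixes N :: real
  assumes "N > 1"
  shows "(1 - (1 / N) ^ 2) * (1 + 1 / (N * (N - 1))) = 1 + (1 / N) ^ 3"
proof -
  define x where "x = 1 / N"
  define w where "w = 1 / (N * (N - 1))"
  have w: "w * (1 - x) = x ^ 2"
    using assms by (simp add: w_def x_def field_simps power2_eq_square)
  have "(1 - x ^ 2) * (1 + w) = (1 + x) * (1 - x + w * (1 - x))" by (simp add: algebra_simps power2_eq_square)
  also have "\<dots> = 1 + x ^ 3" unfolding w by (simp add: algebra_simps power_numeral_reduce)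
  finally show ?thesis by (simp add: x_def w_def)
qed

text \<open>The Euler products with exponents 2, 3 and 6 converge to \<open>1 - 1/Q\<close>,
  \<open>1 - 1/Q^2\<close> and \<open>1 - 1/Q^5\<close>. They run over all primes, so the factor
  belonging to the variable has to be divided out.\<close>

lemma euler_product_weight:
  defines "Q \<equiv> real CARD('a::{field,finite})"
  shows "(\<lambda>D. \<Prod>p\<in>(nonzero_primes D :: 'a poly set). 1 + 1 / (Q ^ degree p * (Q ^ degree p - 1)))
    \<longlonglongrightarrow> (1 - 1 / Q ^ 5) / (1 - 1 / Q) / (1 + 1 / Q ^ 3)"
proof -
  have Q: "Q \<ge> 2" using CARD_field_ge_2[where ?'a = 'a] by (simp add: Q_def)
  let ?P = "\<lambda>s D. \<Prod>p\<in>(primes_upto D :: 'a poly set). 1 - (1 / Q ^ s) ^ degree p"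
  have lim: "?P (Suc s) \<longlonglongrightarrow> 1 - 1 / Q ^ s" if "s > 0" for s
  proof -
    have "Q * (1 / Q ^ Suc s) = 1 / Q ^ s" using Q by simp
    moreover have "1 / Q ^ s < 1" using Q that by simp
    ultimately show ?thesis
      using euler_product[where ?'a = 'a, of "1 / Q ^ Suc s"] Q unfolding Q_def[symmetric] by simp
  qed
  \<comment> \<open>The degree bound is at least 1 so that the variable is among the primes and its
    factor can be split off.\<close>
  have E: "(\<Prod>p\<in>(nonzero_primes (Suc D) :: 'a poly set). 1 + 1 / (Q ^ degree p * (Q ^ degree p - 1)))
     = ?P 6 (Suc D) / (?P 2 (Suc D) * ?P 3 (Suc D)) / (1 + 1 / (Q * (Q - 1)))" for D
  proof -
    let ?h = "\<lambda>p :: 'a poly. 1 + 1 / (Q ^ degree p * (Q ^ degree p - 1))"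
    have X: "[:0, 1 :: 'a:] \<in> primes_upto (Suc D)" by (simp add: primes_upto_def monic_irred_X)
    have pos: "1 + 1 / (Q * (Q - 1)) > 0" using Q by (intro add_pos_nonneg) auto
    have "prod ?h (primes_upto (Suc D)) = ?h [:0, 1:] * prod ?h (nonzero_primes (Suc D))"
      unfolding nonzero_primes_def by (rule prod.remove[OF finite_primes_upto X])
    then have 1: "prod ?h (nonzero_primes (Suc D)) = prod ?h (primes_upto (Suc D)) / (1 + 1 / (Q * (Q - 1)))"
      using pos by simp
    have "prod ?h (primes_upto (Suc D)) = (\<Prod>p\<in>(primes_upto (Suc D) :: 'a poly set).
       (1 - (1 / Q ^ 6) ^ degree p) / ((1 - (1 / Q ^ 2) ^ degree p) * (1 - (1 / Q ^ 3) ^ degree p)))"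
    proof (rule prod.cong)
      fix p :: "'a poly" assume "p \<in> primes_upto (Suc D)"
      then have "Q ^ degree p > 1" using one_less_CARD_power_degree[of p] by (simp add: Q_def primes_upto_def)
      moreover define N where "N = Q ^ degree p"
      ultimately have N: "N > 1" by simp
      define x where "x = 1 / N"
      have x: "0 < x" "x < 1" using N by (auto simp: x_def)
      have pw: "(1 / Q ^ s) ^ degree p = x ^ s" for s
        by (simp add: x_def N_def power_divide power_mult[symmetric] mult.commute)
      have "x ^ 2 < 1" "x ^ 3 < 1" using x by (auto intro: power_Suc_less_one simp: power_less_one_iff)
      then have nz: "1 - x ^ 2 \<noteq> 0" "1 - x ^ 3 \<noteq> 0" by auto
      have "1 - x ^ 6 = (1 - x ^ 3) * (1 + x ^ 3)" by (simp add: algebra_simps flip: power_add)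
      also have "1 + x ^ 3 = (1 - x ^ 2) * (1 + 1 / (N * (N - 1)))"
        unfolding x_def by (rule euler_factor_identity[OF N, symmetric])
      finally have "1 + 1 / (N * (N - 1)) = (1 - x ^ 6) / ((1 - x ^ 2) * (1 - x ^ 3))"
        using nz by simp
      then show "?h p = (1 - (1 / Q ^ 6) ^ degree p) / ((1 - (1 / Q ^ 2) ^ degree p) * (1 - (1 / Q ^ 3) ^ degree p))"
        unfolding pw N_def[symmetric] by simp
    qed simp
    then show ?thesis unfolding 1 by (simp add: prod_dividef prod.distrib)
  qed
  have Qp: "1 < Q ^ 2" "1 < Q" using Q by (auto intro: one_less_power)
  have "(\<lambda>D. ?P 6 (Suc D) / (?P 2 (Suc D) * ?P 3 (Suc D)) / (1 + 1 / (Q * (Q - 1))))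
     \<longlonglongrightarrow> (1 - 1 / Q ^ 5) / ((1 - 1 / Q ^ 1) * (1 - 1 / Q ^ 2)) / (1 + 1 / (Q * (Q - 1)))"
    using LIMSEQ_Suc[OF lim[of 1]] LIMSEQ_Suc[OF lim[of 2]] LIMSEQ_Suc[OF lim[of 5]] Qp
    by (intro tendsto_divide tendsto_mult tendsto_const) (auto simp: numeral_eq_Suc add_nonneg_eq_0_iff)
  then have "(\<lambda>D. \<Prod>p\<in>(nonzero_primes (Suc D) :: 'a poly set). 1 + 1 / (Q ^ degree p * (Q ^ degree p - 1)))
     \<longlonglongrightarrow> (1 - 1 / Q ^ 5) / ((1 - 1 / Q ^ 1) * (1 - 1 / Q ^ 2)) / (1 + 1 / (Q * (Q - 1)))"
    unfolding E .
  also have "(1 - 1 / Q ^ 5) / ((1 - 1 / Q ^ 1) * (1 - 1 / Q ^ 2)) / (1 + 1 / (Q * (Q - 1)))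
      = (1 - 1 / Q ^ 5) / (1 - 1 / Q) / (1 + 1 / Q ^ 3)"
  proof -
    \<comment> \<open>The factor at the variable is the case \<open>|p| = Q\<close> of the same
      identity, and it combines with the value of the product with exponent 3.\<close>
    have "(1 - 1 / Q ^ 2) * (1 + 1 / (Q * (Q - 1))) = 1 + 1 / Q ^ 3"
      using euler_factor_identity[of Q] Q by (simp add: power_divide)
    then show ?thesis by (simp add: mult.assoc)
  qed
  finally show ?thesis by (subst (asm) filterlim_sequentially_Suc)
qed

text \<open>The partial sums are ordered by total degree, the partial products by the largest degree
  of a prime. All weights are nonnegative, so each family is squeezed between members of the
  other.\<close>

lemma weight_sum_tendsto:
  "weight_sum TYPE('a::{field,finite}) \<longlonglongrightarrow>
    (1 - 1 / real CARD('a) ^ 5) / (1 - 1 / real CARD('a)) / (1 + 1 / real CARD('a) ^ 3)"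
  (is "_ \<longlonglongrightarrow> ?L")
proof -
  let ?q = "real CARD('a)"
  let ?A = "weight_sum TYPE('a)"
  let ?E = "\<lambda>D. \<Prod>p\<in>(nonzero_primes D :: 'a poly set). 1 + 1 / (?q ^ degree p * (?q ^ degree p - 1))"
  have lim: "?E \<longlonglongrightarrow> ?L" by (rule euler_product_weight)
  have E: "?E D = (\<Sum>S\<in>Pow (nonzero_primes D :: 'a poly set). set_weight S)" for D
    unfolding set_weight_def using prod_add[OF finite_nonzero_primes[of D], of "\<lambda>p :: 'a poly. 1 / (?q ^ degree p * (?q ^ degree p - 1))" "\<lambda>_. 1"]
    by (simp add: add.commute)
  have up: "?A n \<le> ?E n" for n
    unfolding E weight_sum_def
    by (rule sum_mono2) (auto simp: finite_nonzero_primes prime_sets_def intro: set_weight_nonneg)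
  \<comment> \<open>The summand \<open>D\<close> makes all primes of degree at most \<open>D\<close>
    available at level \<open>n\<close>; the other summand lets every set of them satisfy the bound
    on the total degree.\<close>
  have low: "?E D \<le> ?A n" if "D + sum degree (nonzero_primes D :: 'a poly set) \<le> n" for D n
    unfolding E weight_sum_def
  proof (rule sum_mono2)
    show "Pow (nonzero_primes D) \<subseteq> (prime_sets n :: 'a poly set set)"
    proof
      fix S :: "'a poly set" assume S: "S \<in> Pow (nonzero_primes D)"
      then have "sum degree S \<le> sum degree (nonzero_primes D :: 'a poly set)"
        using finite_nonzero_primes by (intro sum_mono2) auto
      then show "S \<in> prime_sets n"
        using S that by (auto simp: prime_sets_def nonzero_primes_def primes_upto_def)
    qed
  qed (use finite_prime_sets in \<open>auto simp: prime_sets_def intro: set_weight_nonneg\<close>)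
  show ?thesis
  proof (rule order_tendstoI)
    fix a assume "a < ?L"
    then have "eventually (\<lambda>D. a < ?E D) sequentially" using lim order_tendstoD(1) by blast
    then obtain D where D: "a < ?E D" by (auto simp: eventually_sequentially)
    show "eventually (\<lambda>n. a < ?A n) sequentially"
      using eventually_ge_at_top[of "D + sum degree (nonzero_primes D :: 'a poly set)"]
      by (rule eventually_mono) (use low D in fastforce)
  next
    fix a assume "?L < a"
    then have "eventually (\<lambda>D. ?E D < a) sequentially" using lim order_tendstoD(2) by blast
    then show "eventually (\<lambda>n. ?A n < a) sequentially"
      by (rule eventually_mono) (use up in \<open>fastforce intro: le_less_trans\<close>)
  qed
qed

lemma sum_inverse_totient_poly_tendsto:
  defines "Q \<equiv> real CARD('a::{field,finite})"
  shows "(\<lambda>n. \<Sum>f\<in>sieved {[:0, 1:]} n. 1 / real (totient_poly (f :: 'a poly)))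
    \<longlonglongrightarrow> (1 - 1 / Q ^ 5) / (1 + 1 / Q ^ 3)"
proof -
  have Q: "Q \<ge> 2" using CARD_field_ge_2[where ?'a = 'a] by (simp add: Q_def)
  let ?L = "(1 - 1 / Q ^ 5) / (1 - 1 / Q) / (1 + 1 / Q ^ 3)"
  have "(\<lambda>n. weight_sum TYPE('a) (Suc n) - weight_sum TYPE('a) n / Q) \<longlonglongrightarrow> ?L - ?L / Q"
    using weight_sum_tendsto[where ?'a = 'a] LIMSEQ_Suc[OF weight_sum_tendsto[where ?'a = 'a]] Q
    unfolding Q_def by (intro tendsto_diff tendsto_divide tendsto_const) auto
  moreover have "?L - ?L / Q = (1 - 1 / Q ^ 5) / (1 + 1 / Q ^ 3)"
  proof -
    have "x - x / Q = x * (1 - 1 / Q)" for x by (simp add: algebra_simps)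
    then have "?L - ?L / Q = ?L * (1 - 1 / Q)" .
    also have "\<dots> = (1 - 1 / Q ^ 5) / (1 + 1 / Q ^ 3) * ((1 - 1 / Q) / (1 - 1 / Q))" by simp
    also have "(1 - 1 / Q) / (1 - 1 / Q) = 1" using Q by (intro divide_self) auto
    finally show ?thesis by simp
  qed
  ultimately show ?thesis
    unfolding Q_def by (subst filterlim_sequentially_Suc[symmetric]) (simp add: sum_inverse_totient_poly_Suc)
qed

section \<open>Polynomials in a matrix and cyclic vectors\<close>

text \<open>Horner evaluation; \<open>n\<close> is a parameter because it fixes the size of the zero
  and identity matrices.\<close>

definition eval_mat :: "nat \<Rightarrow> 'a::field mat \<Rightarrow> 'a poly \<Rightarrow> 'a mat" where
  "eval_mat n A p = fold_coeffs (\<lambda>a B. a \<cdot>\<^sub>m 1\<^sub>m n + A * B) p (0\<^sub>m n n)"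

lemma eval_mat_0 [simp]: "eval_mat n A 0 = 0\<^sub>m n n"
  by (simp add: eval_mat_def)

lemma eval_mat_pCons:
  assumes "A \<in> carrier_mat n n"
  shows "eval_mat n A (pCons a p) = a \<cdot>\<^sub>m 1\<^sub>m n + A * eval_mat n A p"
proof (cases "p = 0 \<and> a = 0")
  case True
  have "0 \<cdot>\<^sub>m 1\<^sub>m n + A * 0\<^sub>m n n = 0\<^sub>m n n" using assms by (intro eq_matI) auto
  then show ?thesis using True by simp
qed (auto simp: eval_mat_def)

lemma eval_mat_carrier [simp]:
  assumes A: "A \<in> carrier_mat n n"
  shows "eval_mat n A p \<in> carrier_mat n n"
proof (induction p)
  case (pCons a p)
  then show ?case using A by (simp add: eval_mat_pCons[OF A])
qed simp

lemma eval_mat_dim [simp]: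
  assumes "A \<in> carrier_mat n n"
  shows "dim_row (eval_mat n A p) = n" "dim_col (eval_mat n A p) = n"
  using eval_mat_carrier[OF assms, of p] by auto

lemma eval_mat_pCons_0:
  assumes A: "A \<in> carrier_mat n n"
  shows "eval_mat n A (pCons 0 p) = A * eval_mat n A p"
  unfolding eval_mat_pCons[OF A] using A mult_carrier_mat[OF A eval_mat_carrier[OF A, of p]]
  by (intro eq_matI) auto

lemma eval_mat_const:
  assumes A: "A \<in> carrier_mat n n"
  shows "eval_mat n A [:c:] = c \<cdot>\<^sub>m 1\<^sub>m n"
  using A by (simp add: eval_mat_pCons[OF A] right_add_zero_mat[of _ n n])

lemma eval_mat_1: "A \<in> carrier_mat n n \<Longrightarrow> eval_mat n A 1 = 1\<^sub>m n"
  by (simp only: one_pCons eval_mat_const) (auto intro!: eq_matI)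

lemma eval_mat_X: 
  assumes A: "A \<in> carrier_mat n n"
  shows "eval_mat n A [:0, 1:] = A"
proof -
  have "eval_mat n A [:0, 1:] = 0 \<cdot>\<^sub>m 1\<^sub>m n + A * (1 \<cdot>\<^sub>m 1\<^sub>m n)"
    using A by (simp add: eval_mat_pCons[OF A] right_add_zero_mat[of _ n n])
  also have "\<dots> = A" using A by (intro eq_matI) auto
  finally show ?thesis .
qed

lemma eval_mat_add:
  assumes A: "A \<in> carrier_mat n n"
  shows "eval_mat n A (p + q) = eval_mat n A p + eval_mat n A q"
proof (induction p arbitrary: q)
  case 0
  then show ?case using A by (simp add: left_add_zero_mat[of _ n n])
next
  case (pCons a p)
  obtain b r where q: "q = pCons b r" by (cases q)
  note c = eval_mat_carrier[OF A]
  have "eval_mat n A (pCons a p + q) = (a + b) \<cdot>\<^sub>m 1\<^sub>m n + A * (eval_mat n A p + eval_mat n A r)"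
    unfolding q by (simp add: eval_mat_pCons[OF A] pCons.IH)
  also have "\<dots> = (a + b) \<cdot>\<^sub>m 1\<^sub>m n + (A * eval_mat n A p + A * eval_mat n A r)"
    by (simp add: mult_add_distrib_mat[OF A c c])
  also have "\<dots> = (a \<cdot>\<^sub>m 1\<^sub>m n + A * eval_mat n A p) + (b \<cdot>\<^sub>m 1\<^sub>m n + A * eval_mat n A r)"
    using A mult_carrier_mat[OF A c[of p]] mult_carrier_mat[OF A c[of r]]
    by (intro eq_matI) (auto simp: algebra_simps)
  finally show ?case unfolding q by (simp add: eval_mat_pCons[OF A])
qed

lemma eval_mat_smult:
  assumes A: "A \<in> carrier_mat n n"
  shows "eval_mat n A (smult c p) = c \<cdot>\<^sub>m eval_mat n A p"
proof (induction p)
  case 0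
  then show ?case by (intro eq_matI) auto
next
  case (pCons a p)
  note e = eval_mat_carrier[OF A, of p]
  have "eval_mat n A (smult c (pCons a p)) = (c * a) \<cdot>\<^sub>m 1\<^sub>m n + A * (c \<cdot>\<^sub>m eval_mat n A p)"
    by (simp add: eval_mat_pCons[OF A] pCons.IH)
  also have "\<dots> = (c * a) \<cdot>\<^sub>m 1\<^sub>m n + c \<cdot>\<^sub>m (A * eval_mat n A p)"
    by (simp add: mult_smult_distrib[OF A e])
  also have "\<dots> = c \<cdot>\<^sub>m (a \<cdot>\<^sub>m 1\<^sub>m n + A * eval_mat n A p)"
    using A mult_carrier_mat[OF A e] by (intro eq_matI) (auto simp: algebra_simps)
  finally show ?case by (simp add: eval_mat_pCons[OF A])
qed

lemma eval_mat_mult: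
  assumes A: "A \<in> carrier_mat n n"
  shows "eval_mat n A (p * q) = eval_mat n A p * eval_mat n A q"
proof (induction p)
  case 0
  then show ?case using eval_mat_carrier[OF A, of q] by (simp add: left_mult_zero_mat)
next
  case (pCons a p)
  note c = eval_mat_carrier[OF A]
  have "eval_mat n A (pCons a p * q) = a \<cdot>\<^sub>m eval_mat n A q + eval_mat n A (pCons 0 (p * q))"
    by (simp add: eval_mat_add[OF A] eval_mat_smult[OF A])
  also have "eval_mat n A (pCons 0 (p * q)) = A * (eval_mat n A p * eval_mat n A q)"
    by (simp add: eval_mat_pCons_0[OF A] pCons.IH)
  also have "a \<cdot>\<^sub>m eval_mat n A q + A * (eval_mat n A p * eval_mat n A q)
      = (a \<cdot>\<^sub>m 1\<^sub>m n) * eval_mat n A q + A * eval_mat n A p * eval_mat n A q"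
    using c[of q] by (simp add: assoc_mult_mat[OF A c c] mult_smult_assoc_mat[OF one_carrier_mat c] left_mult_one_mat[OF c])
  also have "\<dots> = (a \<cdot>\<^sub>m 1\<^sub>m n + A * eval_mat n A p) * eval_mat n A q"
    using mult_carrier_mat[OF A c[of p]] c[of q] by (intro add_mult_distrib_mat[symmetric]) auto
  finally show ?case by (simp add: eval_mat_pCons[OF A])
qed

lemma eval_mat_intertwine:
  assumes A: "A \<in> carrier_mat n n" and B: "B \<in> carrier_mat n n" and P: "P \<in> carrier_mat n n"
    and AP: "A * P = P * B"
  shows "eval_mat n A p * P = P * eval_mat n B p"
proof (induction p)
  case 0
  then show ?case using P by simp
next
  case (pCons a p)
  note c = eval_mat_carrier[OF A, of p] and d = eval_mat_carrier[OF B, of p]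
  have "eval_mat n A (pCons a p) * P = (a \<cdot>\<^sub>m 1\<^sub>m n) * P + A * eval_mat n A p * P"
    unfolding eval_mat_pCons[OF A] using A P c by (intro add_mult_distrib_mat) auto
  also have "A * eval_mat n A p * P = A * (P * eval_mat n B p)"
    by (simp add: assoc_mult_mat[OF A c P] pCons.IH)
  also have "\<dots> = P * (B * eval_mat n B p)"
    by (simp add: assoc_mult_mat[OF A P d, symmetric] AP assoc_mult_mat[OF P B d])
  also have "(a \<cdot>\<^sub>m 1\<^sub>m n) * P = P * (a \<cdot>\<^sub>m 1\<^sub>m n)"
    using P by (simp add: mult_smult_assoc_mat[OF one_carrier_mat P] mult_smult_distrib[OF P one_carrier_mat])
  also have "P * (a \<cdot>\<^sub>m 1\<^sub>m n) + P * (B * eval_mat n B p) = P * (a \<cdot>\<^sub>m 1\<^sub>m n + B * eval_mat n B p)"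
    using B P d by (intro mult_add_distrib_mat[symmetric]) auto
  finally show ?case by (simp add: eval_mat_pCons[OF B])
qed

text \<open>The module structure on the column space over the polynomial ring, with the variable
  acting as \<open>A\<close>.\<close>

abbreviation act :: "nat \<Rightarrow> 'a::field mat \<Rightarrow> 'a poly \<Rightarrow> 'a vec \<Rightarrow> 'a vec" where
  "act n A p v \<equiv> eval_mat n A p *\<^sub>v v"

lemma act_carrier [simp]:
  "A \<in> carrier_mat n n \<Longrightarrow> v \<in> carrier_vec n \<Longrightarrow> act n A p v \<in> carrier_vec n"
  by (rule mult_mat_vec_carrier[OF eval_mat_carrier])

lemma mat_vec_zero: "A \<in> carrier_mat n n \<Longrightarrow> A *\<^sub>v 0\<^sub>v n = 0\<^sub>v n"
  by (intro eq_vecI) auto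

lemma smult_mat_mat_vec:
  "A \<in> carrier_mat n n \<Longrightarrow> v \<in> carrier_vec n \<Longrightarrow> (c \<cdot>\<^sub>m A) *\<^sub>v v = (c :: 'a::field) \<cdot>\<^sub>v (A *\<^sub>v v)"
  by (intro eq_vecI) (auto simp: scalar_prod_def sum_distrib_left mult.assoc)

lemma act_zero [simp]: "v \<in> carrier_vec n \<Longrightarrow> act n A 0 v = 0\<^sub>v n"
  by (intro eq_vecI) auto

lemma act_one: "A \<in> carrier_mat n n \<Longrightarrow> v \<in> carrier_vec n \<Longrightarrow> act n A 1 v = v"
  by (simp add: eval_mat_1)

lemma act_add:
  "A \<in> carrier_mat n n \<Longrightarrow> v \<in> carrier_vec n \<Longrightarrow> act n A (p + q) v = act n A p v + act n A q v"
  by (simp add: eval_mat_add add_mult_distrib_mat_vec[OF eval_mat_carrier eval_mat_carrier])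

lemma act_smult:
  "A \<in> carrier_mat n n \<Longrightarrow> v \<in> carrier_vec n \<Longrightarrow> act n A (smult c p) v = c \<cdot>\<^sub>v act n A p v"
  by (simp add: eval_mat_smult smult_mat_mat_vec[OF eval_mat_carrier])

lemma act_mult:
  "A \<in> carrier_mat n n \<Longrightarrow> v \<in> carrier_vec n \<Longrightarrow> act n A (p * q) v = act n A p (act n A q v)"
  by (simp add: eval_mat_mult assoc_mult_mat_vec[OF eval_mat_carrier eval_mat_carrier])

lemma act_diff:
  assumes "A \<in> carrier_mat n n" "v \<in> carrier_vec n"
  shows "act n A (p - q) v = act n A p v - act n A q v"
proof -
  have sum: "act n A p v = act n A (p - q) v + act n A q v"
    using act_add[OF assms, of "p - q" q] by simp
  show ?thesis
    unfolding sum using assms act_carrier[OF assms, of q] act_carrier[OF assms, of "p - q"]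
    by (intro eq_vecI) (simp_all del: index_mult_mat_vec)
qed

lemma act_vec_zero [simp]: "A \<in> carrier_mat n n \<Longrightarrow> act n A p (0\<^sub>v n) = 0\<^sub>v n"
  by (rule mat_vec_zero[OF eval_mat_carrier])

lemma act_eq_zero_mult:
  assumes "A \<in> carrier_mat n n" "v \<in> carrier_vec n" "act n A p v = 0\<^sub>v n" "p dvd r"
  shows "act n A r v = 0\<^sub>v n"
proof -
  obtain s where r: "r = s * p" using assms(4) by (metis dvdE mult.commute)
  show ?thesis unfolding r act_mult[OF assms(1,2)] assms(3) by (rule act_vec_zero[OF assms(1)])
qed

lemma mat_eq_by_action:
  fixes M Y :: "'a::field mat"
  assumes "M \<in> carrier_mat n n" "Y \<in> carrier_mat n n"
    and "\<And>u. u \<in> carrier_vec n \<Longrightarrow> M *\<^sub>v u = Y *\<^sub>v u"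
  shows "M = Y"
proof (rule eq_matI)
  fix i j assume ij: "i < dim_row Y" "j < dim_col Y"
  then have "M *\<^sub>v unit_vec n j = Y *\<^sub>v unit_vec n j" using assms by auto
  then have "(M *\<^sub>v unit_vec n j) $ i = (Y *\<^sub>v unit_vec n j) $ i" by simp
  then show "M $$ (i, j) = Y $$ (i, j)" using ij assms(1,2) by auto
qed (use assms in auto)

text \<open>The columns are \<open>v\<close>, \<open>A v\<close>, ..., \<open>A^(n-1) v\<close>:
  this is the matrix of the map sending a polynomial \<open>p\<close> of degree below
  \<open>n\<close> to \<open>p(A) v\<close>.\<close>

definition krylov :: "nat \<Rightarrow> 'a::field mat \<Rightarrow> 'a vec \<Rightarrow> 'a mat" where
  "krylov n A v = mat n n (\<lambda>(i, j). act n A (monom 1 j) v $ i)"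

lemma krylov_carrier [simp]: "krylov n A v \<in> carrier_mat n n"
  by (simp add: krylov_def)

lemma act_index:
  assumes A: "A \<in> carrier_mat n n" and v: "v \<in> carrier_vec n" and i: "i < n"
    and p: "p \<in> polys_below m"
  shows "act n A p v $ i = (\<Sum>k<m. coeff p k * act n A (monom 1 k) v $ i)"
  using p
proof (induction m arbitrary: p)
  case 0
  then have "p = 0" by (auto simp: polys_below_def poly_eq_iff)
  then show ?case using v i by simp
next
  case (Suc m)
  let ?r = "p - monom (coeff p m) m"
  have r: "?r \<in> polys_below m" unfolding polys_below_def
  proof (intro CollectI allI impI)
    fix i assume "m \<le> i"
    then show "coeff ?r i = 0" using Suc.prems by (cases "i = m") (auto simp: polys_below_def)
  qed
  have "monom (coeff p m) m = smult (coeff p m) (monom 1 m)" by (simp add: smult_monom)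
  then have "p = ?r + smult (coeff p m) (monom 1 m)" by simp
  then have "act n A p v = act n A ?r v + coeff p m \<cdot>\<^sub>v act n A (monom 1 m) v"
    using act_add[OF A v] act_smult[OF A v] by metis
  then have "act n A p v $ i = act n A ?r v $ i + coeff p m * act n A (monom 1 m) v $ i"
    using i A v by (simp del: index_mult_mat_vec)
  also have "act n A ?r v $ i = (\<Sum>k<m. coeff p k * act n A (monom 1 k) v $ i)"
    unfolding Suc.IH[OF r] by (rule sum.cong) auto
  finally show ?case by simp
qed

lemma krylov_mult_vec:
  assumes A: "A \<in> carrier_mat n n" and v: "v \<in> carrier_vec n" and p: "p \<in> polys_below n"
  shows "krylov n A v *\<^sub>v vec n (coeff p) = act n A p v"
proof (rule eq_vecI)
  fix i assume "i < dim_vec (act n A p v)"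
  then have i: "i < n" using act_carrier[OF A v, of p] by (metis carrier_vecD)
  show "(krylov n A v *\<^sub>v vec n (coeff p)) $ i = act n A p v $ i"
    unfolding act_index[OF A v i p] using i
    by (subst index_mult_mat_vec) (auto simp: krylov_def scalar_prod_def lessThan_atLeast0 mult.commute
        simp del: index_mult_mat_vec intro!: sum.cong[OF refl] mult.commute)
qed (use A in \<open>simp add: krylov_def\<close>)

text \<open>Stated as independence of the first \<open>n\<close> iterates, which for
  \<open>n\<close> vectors amounts to spanning; \<open>cyclic_vec_span\<close> recovers the spanning
  form.\<close>

definition cyclic_vec :: "nat \<Rightarrow> 'a::field mat \<Rightarrow> 'a vec \<Rightarrow> bool" where
  "cyclic_vec n A v \<longleftrightarrow> v \<in> carrier_vec n \<and> (\<forall>p\<in>polys_below n. act n A p v = 0\<^sub>v n \<longrightarrow> p = 0)"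

definition cyclic_mat :: "nat \<Rightarrow> 'a::field mat \<Rightarrow> bool" where
  "cyclic_mat n A \<longleftrightarrow> A \<in> carrier_mat n n \<and> (\<exists>v. cyclic_vec n A v)"

lemma ex_poly_below_coeffs:
  assumes "w \<in> carrier_vec n"
  shows "\<exists>p\<in>polys_below n. vec n (coeff p) = (w :: 'a::field vec)"
proof -
  define p where "p = (\<Sum>i<n. monom (w $ i) i)"
  have c: "coeff p k = (if k < n then w $ k else 0)" for k
    unfolding p_def coeff_sum coeff_monom by (subst sum.delta) auto
  have "vec n (coeff p) = w" using assms by (intro eq_vecI) (simp_all add: c)
  moreover have "p \<in> polys_below n" by (simp add: polys_below_def c)
  ultimately show ?thesis by blast
qed

text \<open>Kernel vectors of the Krylov matrix are the coefficient vectors of polynomials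
  annihilating \<open>v\<close>. As the nonvanishing of a determinant, cyclicity is linked to
  \<open>GL n\<close> and is preserved by field extension.\<close>

lemma krylov_det:
  assumes A: "A \<in> carrier_mat n n" and v: "v \<in> carrier_vec n"
  shows "cyclic_vec n A v \<longleftrightarrow> det (krylov n A v) \<noteq> 0"
proof
  assume c: "cyclic_vec n A v"
  show "det (krylov n A v) \<noteq> 0"
  proof
    assume "det (krylov n A v) = 0"
    then obtain w where w: "w \<in> carrier_vec n" "w \<noteq> 0\<^sub>v n" "krylov n A v *\<^sub>v w = 0\<^sub>v n"
      using det_0_iff_vec_prod_zero_field[OF krylov_carrier] by blast
    obtain p where p: "p \<in> polys_below n" "vec n (coeff p) = w" using ex_poly_below_coeffs[OF w(1)] by blast
    then have "act n A p v = 0\<^sub>v n" using krylov_mult_vec[OF A v p(1)] w(3) by simp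
    then have "p = 0" using c p(1) by (simp add: cyclic_vec_def)
    then show False using p(2) w(2) by (auto intro: eq_vecI)
  qed
next
  assume d: "det (krylov n A v) \<noteq> 0"
  show "cyclic_vec n A v"
    unfolding cyclic_vec_def
  proof (intro conjI v ballI impI)
    fix p assume p: "p \<in> polys_below n" "act n A p v = 0\<^sub>v n"
    then have "krylov n A v *\<^sub>v vec n (coeff p) = 0\<^sub>v n" using krylov_mult_vec[OF A v] by simp
    then have z: "vec n (coeff p) = 0\<^sub>v n"
      using d det_0_iff_vec_prod_zero_field[OF krylov_carrier[of n A v]] by (metis vec_carrier)
    have "coeff p k = 0" for k
    proof (cases "k < n")
      case True
      then show ?thesis using arg_cong[OF z, of "\<lambda>w. vec_index w k"] by simp
    next
      case False
      then show ?thesis using p(1) by (simp add: polys_below_def)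
    qed
    then show "p = 0" by (simp add: poly_eq_iff)
  qed
qed

lemma GL_iff_det: "A \<in> GL n \<longleftrightarrow> A \<in> carrier_mat n n \<and> det A \<noteq> (0 :: 'a::field)"
proof
  assume A: "A \<in> GL n"
  then have c: "A \<in> carrier_mat n n" by (simp add: GL_def)
  obtain B where B: "A * B = 1\<^sub>m n" "B * A = 1\<^sub>m (dim_row B)"
    using A by (auto simp: GL_def invertible_mat_def inverts_mat_def)
  have "dim_col B = n" using arg_cong[OF B(1), of dim_col] by simp
  moreover have "dim_row B = n" using arg_cong[OF B(2), of dim_col] c by simp
  ultimately have "B \<in> carrier_mat n n" by auto
  from det_mult[OF c this] B(1) show "A \<in> carrier_mat n n \<and> det A \<noteq> 0" using c by auto
next
  assume "A \<in> carrier_mat n n \<and> det A \<noteq> 0"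
  then have A: "A \<in> carrier_mat n n" "det A \<noteq> 0" by auto
  from det_non_zero_imp_unit[OF this, of "()"] obtain B where
    "B \<in> carrier_mat n n" "B * A = 1\<^sub>m n" "A * B = 1\<^sub>m n"
    by (auto simp: Units_def ring_mat_def)
  then show "A \<in> GL n" using A unfolding GL_def invertible_mat_def inverts_mat_def by auto
qed

lemma GL_inverse:
  assumes "A \<in> GL n"
  obtains B where "B \<in> carrier_mat n n" "A * B = 1\<^sub>m n" "B * A = (1\<^sub>m n :: 'a::field mat)"
proof -
  have A: "A \<in> carrier_mat n n" "det A \<noteq> 0" using assms GL_iff_det by auto
  from det_non_zero_imp_unit[OF this, of "()"] show ?thesis
    using that by (auto simp: Units_def ring_mat_def)
qed

lemma GL_I: "A \<in> carrier_mat n n \<Longrightarrow> B \<in> carrier_mat n n \<Longrightarrow> A * B = 1\<^sub>m n \<Longrightarrow> A \<in> GL n"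
  for A B :: "'a::field mat"
  using det_mult[of A n B] by (auto simp: GL_iff_det)

lemma cyclic_vec_span:
  assumes A: "A \<in> carrier_mat n n" and c: "cyclic_vec n A v" and u: "u \<in> carrier_vec n"
  shows "\<exists>p\<in>polys_below n. u = act n A p v"
proof -
  have v: "v \<in> carrier_vec n" using c by (simp add: cyclic_vec_def)
  have "krylov n A v \<in> GL n" using krylov_det[OF A v] c by (simp add: GL_iff_det)
  then obtain B where B: "B \<in> carrier_mat n n" "krylov n A v * B = 1\<^sub>m n" by (rule GL_inverse)
  have "krylov n A v *\<^sub>v (B *\<^sub>v u) = u"
    using assoc_mult_mat_vec[OF krylov_carrier B(1) u, of A v] B(2) u by simp
  moreover obtain p where "p \<in> polys_below n" "vec n (coeff p) = B *\<^sub>v u"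
    using ex_poly_below_coeffs[OF mult_mat_vec_carrier[OF B(1) u]] by blast
  ultimately show ?thesis using krylov_mult_vec[OF A v] by metis
qed

text \<open>Write \<open>M v = p(A) v\<close>. Since \<open>M\<close> commutes with every
  \<open>g(A)\<close>, it agrees with \<open>p(A)\<close> on all vectors \<open>g(A) v\<close>, and
  these are all vectors.\<close>

lemma commutes_cyclic:
  assumes A: "A \<in> carrier_mat n n" and c: "cyclic_vec n A v"
    and M: "M \<in> carrier_mat n n" and AM: "A * M = M * A"
  shows "\<exists>p\<in>polys_below n. M = eval_mat n A p"
proof -
  have v: "v \<in> carrier_vec n" using c by (simp add: cyclic_vec_def)
  obtain p where p: "p \<in> polys_below n" "M *\<^sub>v v = act n A p v"
    using cyclic_vec_span[OF A c mult_mat_vec_carrier[OF M v]] by auto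
  have "M = eval_mat n A p"
  proof (rule mat_eq_by_action[OF M eval_mat_carrier[OF A]])
    fix u :: "'a vec" assume u: "u \<in> carrier_vec n"
    obtain g where g: "u = act n A g v" using cyclic_vec_span[OF A c u] by auto
    have "M *\<^sub>v u = (M * eval_mat n A g) *\<^sub>v v"
      unfolding g using assoc_mult_mat_vec[OF M eval_mat_carrier[OF A] v] by simp
    also have "M * eval_mat n A g = eval_mat n A g * M"
      using eval_mat_intertwine[OF A A M AM, of g] by simp
    also have "\<dots> *\<^sub>v v = act n A g (act n A p v)"
      using assoc_mult_mat_vec[OF eval_mat_carrier[OF A] M v] p(2) by simp
    also have "\<dots> = act n A p u"
      unfolding g using act_mult[OF A v, of g p] act_mult[OF A v, of p g] by (simp add: mult.commute)
    finally show "M *\<^sub>v u = act n A p u" .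
  qed
  then show ?thesis using p(1) by blast
qed

lemma eval_mat_eq_zero_if_cyclic:
  assumes A: "A \<in> carrier_mat n n" and c: "cyclic_vec n A v" and f: "act n A f v = 0\<^sub>v n"
  shows "eval_mat n A f = 0\<^sub>m n n"
proof (rule mat_eq_by_action[OF eval_mat_carrier[OF A]])
  have v: "v \<in> carrier_vec n" using c by (simp add: cyclic_vec_def)
  fix u :: "'a vec" assume u: "u \<in> carrier_vec n"
  obtain g where g: "u = act n A g v" using cyclic_vec_span[OF A c u] by auto
  have "act n A f u = act n A g (act n A f v)"
    unfolding g using act_mult[OF A v, of g f] act_mult[OF A v, of f g] by (simp add: mult.commute)
  then have "act n A f u = 0\<^sub>v n" using f A by simp
  also have "0\<^sub>v n = 0\<^sub>m n n *\<^sub>v u" using u by (intro eq_vecI) auto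
  finally show "act n A f u = 0\<^sub>m n n *\<^sub>v u" .
qed simp

lemma eval_mat_zero_act: "eval_mat n A f = 0\<^sub>m n n \<Longrightarrow> v \<in> carrier_vec n \<Longrightarrow> act n A f v = 0\<^sub>v n"
  by (intro eq_vecI) auto

text \<open>Writing \<open>A^n v\<close> through the earlier iterates gives such a polynomial; two
  of them differ by a polynomial of degree below \<open>n\<close> that annihilates \<open>v\<close>.
  It is the minimal polynomial and, by its degree, the characteristic polynomial.\<close>

lemma cyclic_char_poly:
  assumes A: "A \<in> carrier_mat n n" and c: "cyclic_vec n A v"
  shows "\<exists>!f. f \<in> monics n \<and> eval_mat n A f = 0\<^sub>m n n"
proof (rule ex_ex1I)
  have v: "v \<in> carrier_vec n" using c by (simp add: cyclic_vec_def)
  obtain p where p: "p \<in> polys_below n" "act n A (monom 1 n) v = act n A p v"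
    using cyclic_vec_span[OF A c act_carrier[OF A v]] by auto
  have "- p \<in> polys_below n" using p(1) by (simp add: polys_below_def)
  then have "monom 1 n - p \<in> monics n"
    using bij_betw_monics[of n, where ?'a = 'a] by (auto simp: bij_betw_def dest!: equalityD1)
  moreover have "act n A (monom 1 n - p) v = 0\<^sub>v n"
    unfolding act_diff[OF A v] p(2) using act_carrier[OF A v] by simp
  ultimately show "\<exists>f. f \<in> monics n \<and> eval_mat n A f = 0\<^sub>m n n"
    using eval_mat_eq_zero_if_cyclic[OF A c] by blast
next
  fix f g assume f: "f \<in> monics n \<and> eval_mat n A f = 0\<^sub>m n n" and g: "g \<in> monics n \<and> eval_mat n A g = 0\<^sub>m n n"
  have v: "v \<in> carrier_vec n" using c by (simp add: cyclic_vec_def)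
  have "act n A (f - g) v = 0\<^sub>v n" unfolding act_diff[OF A v] using f g v by (intro eq_vecI) auto
  moreover have "f - g \<in> polys_below n"
    using f g by (auto simp: polys_below_def monics_def coeff_eq_0 le_less)
  ultimately have "f - g = 0" using c by (auto simp: cyclic_vec_def)
  then show "f = g" by simp
qed

section \<open>Counting cyclic matrices\<close>

lemma act_monom_Suc:
  assumes A: "A \<in> carrier_mat n n" and v: "v \<in> carrier_vec n"
  shows "act n A (monom 1 (Suc j)) v = A *\<^sub>v act n A (monom 1 j) v"
  unfolding monom_Suc eval_mat_pCons_0[OF A] using assoc_mult_mat_vec[OF A eval_mat_carrier[OF A] v] .

lemma act_monom_0:
  assumes A: "A \<in> carrier_mat n n" and v: "v \<in> carrier_vec n"
  shows "act n A (monom 1 0) v = v"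
  using act_one[OF A v] by (simp only: monom_0 one_pCons)

lemma col_krylov:
  assumes A: "A \<in> carrier_mat n n" and v: "v \<in> carrier_vec n" and j: "j < n"
  shows "col (krylov n A v) j = act n A (monom 1 j) v"
  using A act_carrier[OF A v, of "monom 1 j"] j
  by (intro eq_vecI) (auto simp: krylov_def simp del: index_mult_mat_vec)

lemma act_top:
  assumes A: "A \<in> carrier_mat n n" and v: "v \<in> carrier_vec n" and f: "f \<in> monics n" and i: "i < n"
  shows "act n A f v $ i = act n A (monom 1 n) v $ i + (\<Sum>k<n. coeff f k * act n A (monom 1 k) v $ i)"
proof -
  let ?g = "f - monom 1 n"
  have g: "?g \<in> polys_below n" using f by (auto simp: polys_below_def monics_def coeff_eq_0)
  have "act n A f v = act n A (monom 1 n) v + act n A ?g v"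
    using act_add[OF A v, of "monom 1 n" ?g] by simp
  then have "act n A f v $ i = act n A (monom 1 n) v $ i + act n A ?g v $ i"
    using A i by (simp del: index_mult_mat_vec)
  also have "act n A ?g v $ i = (\<Sum>k<n. coeff f k * act n A (monom 1 k) v $ i)"
    unfolding act_index[OF A v i g] by (intro sum.cong) auto
  finally show ?thesis .
qed

text \<open>For \<open>f\<close> monic of degree \<open>n\<close> these are the cyclic matrices with
  characteristic polynomial \<open>f\<close>.\<close>

definition cyclic_class :: "nat \<Rightarrow> 'a::field poly \<Rightarrow> 'a mat set" where
  "cyclic_class n f = {A. cyclic_mat n A \<and> eval_mat n A f = 0\<^sub>m n n}"

text \<open>The Krylov matrix records \<open>A\<close> on all columns but the last, and
  \<open>f(A) v = 0\<close> supplies the missing value, so the pair can be recovered. Conversely,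
  any basis of columns becomes a Krylov matrix for the operator that acts on it like the companion
  matrix of \<open>f\<close>. Positivity of \<open>n\<close> lets \<open>v\<close> be read off the
  first column.\<close>

lemma bij_betw_krylov:
  fixes f :: "'a::field poly"
  assumes n: "n > 0" and f: "f \<in> monics n"
  shows "bij_betw (\<lambda>(A, v). krylov n A v) (SIGMA A:cyclic_class n f. {v. cyclic_vec n A v}) (GL n)"
  unfolding bij_betw_def
proof (intro conjI equalityI subsetI)
  show "inj_on (\<lambda>(A, v). krylov n A v) (SIGMA A:cyclic_class n f. {v. cyclic_vec n A v})"
  proof (rule inj_onI, clarify)
    fix A v B w assume AB: "A \<in> cyclic_class n f" "B \<in> cyclic_class n f"
      and vw: "cyclic_vec n A v" "cyclic_vec n B w" and eq: "krylov n A v = krylov n B w"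
    have A: "A \<in> carrier_mat n n" and B: "B \<in> carrier_mat n n"
      using AB by (auto simp: cyclic_class_def cyclic_mat_def)
    have v: "v \<in> carrier_vec n" and w: "w \<in> carrier_vec n" using vw by (auto simp: cyclic_vec_def)
    have m: "act n A (monom 1 j) v = act n B (monom 1 j) w" if "j < n" for j
      using col_krylov[OF A v that] col_krylov[OF B w that] eq by simp
    \<comment> \<open>As \<open>f\<close> annihilates both vectors, the iterate of index
      \<open>n\<close> is the same combination of the earlier iterates on both sides.\<close>
    have mn: "act n A (monom 1 n) v = act n B (monom 1 n) w"
    proof (rule eq_vecI)
      fix i assume "i < dim_vec (act n B (monom 1 n) w)"
      then have i: "i < n" using B by simp
      have z: "act n A f v = 0\<^sub>v n" "act n B f w = 0\<^sub>v n"
        using AB eval_mat_zero_act[OF _ v] eval_mat_zero_act[OF _ w] by (auto simp: cyclic_class_def)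
      show "act n A (monom 1 n) v $ i = act n B (monom 1 n) w $ i"
        using act_top[OF A v f i] act_top[OF B w f i] i m unfolding z by simp
    qed (use A B in simp)
    have cols: "A *\<^sub>v col (krylov n A v) j = B *\<^sub>v col (krylov n A v) j" if j: "j < n" for j
    proof -
      have "act n A (monom 1 (Suc j)) v = act n B (monom 1 (Suc j)) w"
        using m[of "Suc j"] mn j by (cases "Suc j = n") auto
      then show ?thesis
        unfolding act_monom_Suc[OF A v] act_monom_Suc[OF B w]
        by (simp add: col_krylov[OF A v j] m[OF j])
    qed
    let ?P = "krylov n A v"
    have AP: "A * ?P = B * ?P"
    proof (rule mat_col_eqI)
      fix j assume "j < dim_col (B * ?P)"
      then have j: "j < n" by (simp add: krylov_def)
      show "col (A * ?P) j = col (B * ?P) j"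
        using cols[OF j] col_mult2[OF A krylov_carrier j] col_mult2[OF B krylov_carrier j] by simp
    qed (use A B in auto)
    have "?P \<in> GL n" using krylov_det[OF A v] vw(1) by (simp add: GL_iff_det)
    then obtain R where R: "R \<in> carrier_mat n n" "?P * R = 1\<^sub>m n" by (rule GL_inverse)
    have "A = A * ?P * R" using A R assoc_mult_mat[OF A krylov_carrier R(1)] by simp
    also have "\<dots> = B" unfolding AP using B R assoc_mult_mat[OF B krylov_carrier R(1)] by simp
    finally have "A = B" .
    moreover have "v = w" using m[OF n] act_monom_0[OF A v] act_monom_0[OF B w] by simp
    ultimately show "A = B \<and> v = w" ..
  qed
next
  fix P assume "P \<in> (\<lambda>(A, v). krylov n A v) ` (SIGMA A:cyclic_class n f. {v. cyclic_vec n A v})"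
  then obtain A v where "cyclic_mat n A" "cyclic_vec n A v" "P = krylov n A v"
    by (auto simp: cyclic_class_def)
  then show "P \<in> GL n" using krylov_det[of A n v] by (simp add: GL_iff_det cyclic_mat_def cyclic_vec_def)
next
  fix P :: "'a mat" assume PG: "P \<in> GL n"
  then have P: "P \<in> carrier_mat n n" by (simp add: GL_def)
  obtain R where R: "R \<in> carrier_mat n n" "R * P = 1\<^sub>m n" using PG by (rule GL_inverse)
  \<comment> \<open>This is what \<open>A * P\<close> has to be: the columns of \<open>P\<close>
    moved one place to the left, and a last column forced by \<open>f(A) v = 0\<close>.\<close>
  define Q where "Q = mat n n (\<lambda>(i, j). if Suc j < n then P $$ (i, Suc j) else - (\<Sum>k<n. coeff f k * P $$ (i, k)))"
  define A where "A = Q * R"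
  define v where "v = col P 0"
  have Q: "Q \<in> carrier_mat n n" by (simp add: Q_def)
  have A: "A \<in> carrier_mat n n" using Q R by (simp add: A_def)
  have v: "v \<in> carrier_vec n" using P n by (simp add: v_def)
  have AP: "A * P = Q" unfolding A_def using assoc_mult_mat[OF Q R(1) P] R(2) Q by simp
  have step: "A *\<^sub>v col P j = col Q j" if "j < n" for j
    using col_mult2[OF A P that] AP by simp
  have m: "act n A (monom 1 j) v = col P j" if "j < n" for j
    using that
  proof (induction j)
    case 0
    then show ?case using act_monom_0[OF A v] by (simp add: v_def)
  next
    case (Suc j)
    then have "act n A (monom 1 (Suc j)) v = col Q j" by (simp add: act_monom_Suc[OF A v] step)
    also have "\<dots> = col P (Suc j)" using Suc.prems P by (intro eq_vecI) (auto simp: Q_def)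
    finally show ?case .
  qed
  have mn: "act n A (monom 1 n) v = col Q (n - 1)"
    using act_monom_Suc[OF A v, of "n - 1"] m[of "n - 1"] step[of "n - 1"] n by simp
  have K: "krylov n A v = P"
    using P col_krylov[OF A v] m by (intro mat_col_eqI) (auto simp: krylov_def)
  then have c: "cyclic_vec n A v" using krylov_det[OF A v] PG by (simp add: GL_iff_det)
  have "act n A f v = 0\<^sub>v n"
  proof (rule eq_vecI)
    fix i assume "i < dim_vec (0\<^sub>v n :: 'a vec)"
    then have i: "i < n" by simp
    have "(\<Sum>k<n. coeff f k * act n A (monom 1 k) v $ i) = (\<Sum>k<n. coeff f k * P $$ (i, k))"
      using i P by (intro sum.cong refl) (simp add: m del: index_mult_mat_vec)
    then show "act n A f v $ i = 0\<^sub>v n $ i"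
      unfolding act_top[OF A v f i] mn using i n by (simp add: Q_def)
  qed (use A in simp)
  then have "eval_mat n A f = 0\<^sub>m n n" by (rule eval_mat_eq_zero_if_cyclic[OF A c])
  then have "A \<in> cyclic_class n f" using A c by (auto simp: cyclic_class_def cyclic_mat_def)
  then show "P \<in> (\<lambda>(A, v). krylov n A v) ` (SIGMA A:cyclic_class n f. {v. cyclic_vec n A v})"
    using c K by force
qed

text \<open>A common prime factor \<open>p\<close> with \<open>f = p h\<close> makes
  \<open>h\<close>, of degree below \<open>n\<close>, annihilate \<open>g(A) v\<close>. Conversely,
  a Bezout relation inverts \<open>g\<close> modulo \<open>f\<close>, so whatever annihilates
  \<open>g(A) v\<close> annihilates \<open>v\<close>.\<close>

lemma cyclic_vec_act_iff:
  assumes A: "A \<in> carrier_mat n n" and c: "cyclic_vec n A v"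
    and f: "f \<in> monics n" "eval_mat n A f = 0\<^sub>m n n"
  shows "cyclic_vec n A (act n A g v) \<longleftrightarrow> coprime g f"
proof
  have v: "v \<in> carrier_vec n" using c by (simp add: cyclic_vec_def)
  have fv: "act n A f v = 0\<^sub>v n" by (rule eval_mat_zero_act[OF f(2) v])
  {
    assume cg: "cyclic_vec n A (act n A g v)"
    show "coprime g f"
      unfolding coprime_iff_prime_divisors
    proof (intro ballI notI)
      fix p assume p: "p \<in> prime_divisors f" "p dvd g"
      then have mi: "monic_irred p" and "p dvd f" by (auto simp: prime_divisors_def)
      then obtain h where h: "f = p * h" by blast
      have "f \<noteq> 0" using f by (auto simp: monics_def)
      then have h0: "h \<noteq> 0" "p \<noteq> 0" using h by auto
      have "degree h < n"
        using f(1) monic_irred_degree[OF mi] h0 by (simp add: monics_def h degree_mult_eq)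
      then have hb: "h \<in> polys_below n" by (simp add: polys_below_iff)
      have "f dvd h * g" using p(2) unfolding h by (metis dvd_refl mult.commute mult_dvd_mono)
      then have "act n A (h * g) v = 0\<^sub>v n" by (rule act_eq_zero_mult[OF A v fv])
      then have "act n A h (act n A g v) = 0\<^sub>v n" by (simp add: act_mult[OF A v])
      then show False using cg hb h0 by (auto simp: cyclic_vec_def)
    qed
  }
  {
    assume "coprime g f"
    then obtain s t where st: "s * g + t * f = 1" by (rule field_poly_coprime_bezout)
    show "cyclic_vec n A (act n A g v)"
      unfolding cyclic_vec_def
    proof (intro conjI ballI impI act_carrier A v)
      fix p assume p: "p \<in> polys_below n" "act n A p (act n A g v) = 0\<^sub>v n"
      have pg: "act n A (p * g) v = 0\<^sub>v n" using p(2) by (simp add: act_mult[OF A v])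
      have "p = p * (s * g + t * f)" using st by simp
      then have "p = s * (p * g) + (p * t) * f" by (simp add: algebra_simps)
      then have "act n A p v = act n A (s * (p * g)) v + act n A ((p * t) * f) v"
        using act_add[OF A v] by metis
      also have "\<dots> = 0\<^sub>v n"
        using act_eq_zero_mult[OF A v pg] act_eq_zero_mult[OF A v fv] by simp
      finally show "p = 0" using c p(1) by (simp add: cyclic_vec_def)
    qed
  }
qed

lemma card_cyclic_vecs:
  assumes "A \<in> cyclic_class n f" and f: "f \<in> monics n"
  shows "card {v. cyclic_vec n A v} = totient_poly f"
proof -
  have A: "A \<in> carrier_mat n n" and f0: "eval_mat n A f = 0\<^sub>m n n"
    using assms by (auto simp: cyclic_class_def cyclic_mat_def)
  obtain v where c: "cyclic_vec n A v" using assms by (auto simp: cyclic_class_def cyclic_mat_def)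
  have v: "v \<in> carrier_vec n" using c by (simp add: cyclic_vec_def)
  have deg: "degree f = n" using f by (simp add: monics_def)
  note iff = cyclic_vec_act_iff[OF A c f f0]
  have "bij_betw (\<lambda>g. act n A g v) {g \<in> polys_below n. coprime g f} {w. cyclic_vec n A w}"
    unfolding bij_betw_def
  proof (intro conjI equalityI subsetI)
    show "inj_on (\<lambda>g. act n A g v) {g \<in> polys_below n. coprime g f}"
    proof (rule inj_onI)
      fix g h assume gh: "g \<in> {g \<in> polys_below n. coprime g f}" "h \<in> {g \<in> polys_below n. coprime g f}"
        and eq: "act n A g v = act n A h v"
      have "act n A (g - h) v = 0\<^sub>v n" unfolding act_diff[OF A v] eq using act_carrier[OF A v] by simp
      moreover have "g - h \<in> polys_below n" using gh by (simp add: polys_below_def)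
      ultimately have "g - h = 0" using c by (auto simp: cyclic_vec_def)
      then show "g = h" by simp
    qed
  next
    fix w assume "w \<in> (\<lambda>g. act n A g v) ` {g \<in> polys_below n. coprime g f}"
    then show "w \<in> {w. cyclic_vec n A w}" using iff by auto
  next
    fix w assume w: "w \<in> {w. cyclic_vec n A w}"
    then obtain g where "g \<in> polys_below n" "w = act n A g v"
      using cyclic_vec_span[OF A c, of w] by (auto simp: cyclic_vec_def)
    then show "w \<in> (\<lambda>g. act n A g v) ` {g \<in> polys_below n. coprime g f}" using iff w by auto
  qed
  then show ?thesis unfolding totient_poly_def deg by (rule bij_betw_same_card[symmetric])
qed

lemma card_cyclic_class:
  fixes f :: "'a::{field,finite} poly"
  assumes n: "n > 0" and f: "f \<in> monics n"
  shows "card (cyclic_class n f) * totient_poly f = card (GL n :: 'a mat set)"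
    and "finite (cyclic_class n f)"
proof -
  let ?S = "SIGMA A:cyclic_class n f. {v. cyclic_vec n A v}"
  have fin: "finite ?S" using bij_betw_finite[OF bij_betw_krylov[OF n f]] finite_GL by blast
  have "cyclic_class n f = fst ` ?S"
    by (force simp: cyclic_class_def cyclic_mat_def)
  then show finc: "finite (cyclic_class n f)" using fin by (metis finite_imageI)
  have "finite {v. cyclic_vec n A v}" if "A \<in> cyclic_class n f" for A
    using finite_subset[of "Pair A ` {v. cyclic_vec n A v}" ?S] fin that
    by (auto simp: finite_image_iff inj_on_def)
  then have "card ?S = (\<Sum>A\<in>cyclic_class n f. card {v. cyclic_vec n A v})"
    using finc by (simp add: card_SigmaI)
  also have "\<dots> = card (cyclic_class n f) * totient_poly f"
    using card_cyclic_vecs[OF _ f] by simp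
  finally show "card (cyclic_class n f) * totient_poly f = card (GL n :: 'a mat set)"
    using bij_betw_same_card[OF bij_betw_krylov[OF n f]] by simp
qed

text \<open>If \<open>f = X h\<close> and \<open>A\<close> is invertible, then
  \<open>h(A) = 0\<close> although \<open>h\<close> has degree below \<open>n\<close>. If
  \<open>X\<close> does not divide \<open>f\<close>, a Bezout relation \<open>s X + t f = 1\<close>
  evaluated at \<open>A\<close> exhibits \<open>s(A)\<close> as the inverse.\<close>

lemma cyclic_class_GL:
  fixes f :: "'a::field poly"
  assumes f: "f \<in> monics n" and A: "A \<in> cyclic_class n f"
  shows "A \<in> GL n \<longleftrightarrow> \<not> [:0, 1:] dvd f"
proof
  have Ac: "A \<in> carrier_mat n n" and f0: "eval_mat n A f = 0\<^sub>m n n"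
    using A by (auto simp: cyclic_class_def cyclic_mat_def)
  obtain v where c: "cyclic_vec n A v" using A by (auto simp: cyclic_class_def cyclic_mat_def)
  have v: "v \<in> carrier_vec n" using c by (simp add: cyclic_vec_def)
  {
    assume AG: "A \<in> GL n"
    show "\<not> [:0, 1:] dvd f"
    proof
      assume "[:0, 1:] dvd f"
      then obtain h where h: "f = [:0, 1:] * h" by blast
      have "f \<noteq> 0" using f by (auto simp: monics_def)
      then have h0: "h \<noteq> 0" using h by auto
      have "degree h < n" using f h0 by (auto simp: monics_def h degree_mult_eq)
      then have hb: "h \<in> polys_below n" by (simp add: polys_below_iff)
      obtain B where B: "B \<in> carrier_mat n n" "B * A = 1\<^sub>m n" using AG by (rule GL_inverse)
      have "A * eval_mat n A h = 0\<^sub>m n n"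
        using f0 unfolding h eval_mat_mult[OF Ac] eval_mat_X[OF Ac] .
      then have "B * (A * eval_mat n A h) = 0\<^sub>m n n" using B(1) by simp
      then have "eval_mat n A h = 0\<^sub>m n n"
        using assoc_mult_mat[OF B(1) Ac eval_mat_carrier[OF Ac, of h]] B(2) Ac by simp
      then have "act n A h v = 0\<^sub>v n" using v by (rule eval_mat_zero_act)
      then show False using c hb h0 by (auto simp: cyclic_vec_def)
    qed
  }
  {
    assume nd: "\<not> [:0, 1:] dvd f"
    have "coprime [:0, 1:] f"
      unfolding coprime_iff_prime_divisors
    proof (intro ballI notI)
      fix p assume p: "p \<in> prime_divisors f" "p dvd [:0, 1:]"
      then have "p = [:0, 1:]" using monic_irred_dvd_eq[OF _ monic_irred_X] by (auto simp: prime_divisors_def)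
      then show False using p nd by (simp add: prime_divisors_def)
    qed
    then obtain s t where st: "s * [:0, 1:] + t * f = 1" by (rule field_poly_coprime_bezout)
    have "1\<^sub>m n = eval_mat n A (s * [:0, 1:] + t * f)" unfolding st using eval_mat_1[OF Ac] by simp
    also have "\<dots> = eval_mat n A [:0, 1:] * eval_mat n A s"
      unfolding eval_mat_add[OF Ac] eval_mat_mult[OF Ac, of t] f0
      using eval_mat_mult[OF Ac, of "[:0, 1:]" s] eval_mat_carrier[OF Ac] 
        right_add_zero_mat[OF eval_mat_carrier[OF Ac, of "s * [:0, 1:]"]] Ac
      by (simp add: mult.commute right_mult_zero_mat[OF eval_mat_carrier[OF Ac]])
    finally have "A * eval_mat n A s = 1\<^sub>m n" unfolding eval_mat_X[OF Ac] by simp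
    then show "A \<in> GL n" by (rule GL_I[OF Ac eval_mat_carrier[OF Ac]])
  }
qed

lemma cyclic_proportion:
  assumes n: "n > 0"
  shows "real (card {A \<in> (GL n :: 'a::{field,finite} mat set). cyclic_mat n A}) / real (card (GL n :: 'a mat set))
    = (\<Sum>f\<in>sieved {[:0, 1:]} n. 1 / real (totient_poly (f :: 'a poly)))"
proof -
  let ?G = "card (GL n :: 'a mat set)"
  have G: "?G > 0" using finite_GL one_mat_in_GL by (metis card_gt_0_iff empty_iff)
  have sm: "f \<in> monics n" if "f \<in> sieved {[:0, 1:]} n" for f :: "'a poly" using that by (simp add: sieved_def)
  have U: "{A \<in> (GL n :: 'a mat set). cyclic_mat n A} = (\<Union>f\<in>sieved {[:0, 1:]} n. cyclic_class n f)"
  proof (intro equalityI subsetI)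
    fix A :: "'a mat" assume A: "A \<in> {A \<in> GL n. cyclic_mat n A}"
    then obtain v where "A \<in> carrier_mat n n" "cyclic_vec n A v" by (auto simp: cyclic_mat_def)
    then obtain f where f: "f \<in> monics n" "eval_mat n A f = 0\<^sub>m n n" using cyclic_char_poly by blast
    then have Ac: "A \<in> cyclic_class n f" using A by (simp add: cyclic_class_def)
    then have "f \<in> sieved {[:0, 1:]} n" using cyclic_class_GL[OF f(1) Ac] A f(1) by (simp add: sieved_def)
    then show "A \<in> (\<Union>f\<in>sieved {[:0, 1:]} n. cyclic_class n f)" using Ac by blast
  next
    fix A assume "A \<in> (\<Union>f\<in>sieved {[:0, 1 :: 'a:]} n. cyclic_class n f)"
    then obtain f where f: "f \<in> sieved {[:0, 1:]} n" "A \<in> cyclic_class n f" by blast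
    then show "A \<in> {A \<in> GL n. cyclic_mat n A}"
      using cyclic_class_GL[OF sm[OF f(1)] f(2)] by (simp add: sieved_def cyclic_class_def)
  qed
  have disj: "cyclic_class n f \<inter> cyclic_class n g = {}"
    if "f \<in> monics n" "g \<in> monics n" "f \<noteq> g" for f g :: "'a poly"
    using that cyclic_char_poly unfolding cyclic_class_def cyclic_mat_def by blast
  have "card {A \<in> (GL n :: 'a mat set). cyclic_mat n A} = (\<Sum>f\<in>sieved {[:0, 1:]} n. card (cyclic_class n (f :: 'a poly)))"
    unfolding U
  proof (rule card_UN_disjoint)
    show "finite (sieved {[:0, 1 :: 'a:]} n)" by (simp add: sieved_def finite_monics)
  qed (use sm disj card_cyclic_class(2)[OF n] in blast)+
  also have "real \<dots> / real ?G = (\<Sum>f\<in>sieved {[:0, 1:]} n. 1 / real (totient_poly (f :: 'a poly)))"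
    unfolding of_nat_sum sum_divide_distrib
  proof (rule sum.cong)
    fix f :: "'a poly" assume "f \<in> sieved {[:0, 1:]} n"
    then have e: "?G = card (cyclic_class n f) * totient_poly f" using card_cyclic_class(1)[OF n sm] by metis
    show "real (card (cyclic_class n f)) / real ?G = 1 / real (totient_poly f)"
      using G unfolding e by simp
  qed simp
  finally show ?thesis .
qed

section \<open>Matrices without a cyclic vector\<close>

lemma prime_power_dvd_mult_cancel:
  fixes p :: "'a::idom_divide"
  assumes p: "prime_elem p" "\<not> p dvd y" and d: "p ^ k dvd y * c"
  shows "p ^ k dvd c"
  using d
proof (induction k)
  case (Suc k)
  then have "p ^ k dvd y * c" by (meson dvd_trans le_imp_power_dvd lessI less_imp_le)
  then obtain e where e: "c = p ^ k * e" using Suc.IH by blast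
  have "p ^ k * p dvd p ^ k * (y * e)" using Suc.prems e by (simp add: mult_ac)
  then have "p dvd y * e" using p(1) by (simp add: prime_elem_def)
  then have "p dvd e" using p by (simp add: prime_elem_dvd_mult_iff)
  then show ?case unfolding e by (simp add: mult.commute mult_dvd_mono)
qed simp

lemma dvd_prime_power_mult_cancel:
  fixes p :: "'a::idom_divide"
  assumes p: "prime_elem p" "\<not> p dvd y" and d: "y dvd p ^ k * c"
  shows "y dvd c"
  using d
proof (induction k arbitrary: c)
  case (Suc k)
  from Suc.prems have "y dvd p ^ k * (p * c)" unfolding power_Suc2 mult.assoc .
  then have "y dvd p * c" by (rule Suc.IH)
  then obtain e where e: "p * c = y * e" by blast
  then have "p dvd y * e" by (metis dvd_triv_left)
  then have "p dvd e" using p by (simp add: prime_elem_dvd_mult_iff)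
  then obtain e' where "e = p * e'" by blast
  then have "p * c = p * (y * e')" using e by (simp add: mult_ac)
  then have "c = y * e'" using p(1) by (simp add: prime_elem_def)
  then show ?case by simp
qed simp

lemma monic_irred_power_split:
  fixes a :: "'a::field poly"
  assumes p: "monic_irred p" and a: "a \<noteq> 0"
  shows "\<exists>i y. a = p ^ i * y \<and> \<not> p dvd y"
  using a
proof (induction "degree a" arbitrary: a rule: less_induct)
  case less
  show ?case
  proof (cases "p dvd a")
    case False
    then have "a = p ^ 0 * a \<and> \<not> p dvd a" by simp
    then show ?thesis by blast
  next
    case True
    then obtain b where b: "a = p * b" by blast
    have "b \<noteq> 0" "p \<noteq> 0" using less.prems b by auto
    then have "degree b < degree a" using monic_irred_degree[OF p] by (simp add: b degree_mult_eq)
    then obtain i y where "b = p ^ i * y" "\<not> p dvd y" using less.hyps \<open>b \<noteq> 0\<close> by blast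
    then have "a = p ^ Suc i * y \<and> \<not> p dvd y" using b by (simp add: mult.assoc)
    then show ?thesis by blast
  qed
qed

text \<open>One full prime power is split off at a time. The contrapositive is what matters: when
  one order fails to divide another, some prime occurs in it to a higher power.\<close>

lemma dvd_if_prime_powers_dvd:
  fixes a b :: "'a::field poly"
  assumes "b \<noteq> 0" and "\<And>p k. monic_irred p \<Longrightarrow> p ^ k dvd b \<Longrightarrow> p ^ k dvd a"
  shows "b dvd a"
  using assms
proof (induction "degree b" arbitrary: b rule: less_induct)
  case less
  show ?case
  proof (cases "is_unit b")
    case True
    then show ?thesis by (rule unit_imp_dvd)
  next
    case False
    then obtain p where p: "monic_irred p" "p dvd b" using exists_monic_irred_factor by blast
    then obtain i y where iy: "b = p ^ i * y" "\<not> p dvd y"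
      using monic_irred_power_split less.prems(1) by blast
    have "i \<noteq> 0" using iy p(2) by (cases i) auto
    moreover have nz: "y \<noteq> 0" "p \<noteq> 0" using iy less.prems(1) p by (auto simp: monic_irred_def)
    ultimately have "degree y < degree b"
      using monic_irred_degree[OF p(1)] by (simp add: iy(1) degree_mult_eq degree_power_eq)
    moreover have "r ^ k dvd a" if "monic_irred r" "r ^ k dvd y" for r k
      using less.prems(2)[OF that(1), of k] that(2) iy(1) by simp
    ultimately have "y dvd a" using less.hyps nz by blast
    then obtain c where c: "a = y * c" by blast
    have "p ^ i dvd a" using less.prems(2)[OF p(1), of i] iy(1) by simp
    then have "p ^ i dvd c"
      unfolding c by (rule prime_power_dvd_mult_cancel[OF monic_irred_prime_elem[OF p(1)] iy(2)])
    then show ?thesis unfolding iy(1) c by (metis mult.commute mult_dvd_mono dvd_refl)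
  qed
qed

text \<open>A generator of the annihilator ideal of \<open>v\<close>, that is, the minimal
  polynomial of \<open>A\<close> at \<open>v\<close> up to a constant factor.\<close>

definition is_order :: "nat \<Rightarrow> 'a::field mat \<Rightarrow> 'a vec \<Rightarrow> 'a poly \<Rightarrow> bool" where
  "is_order n A v a \<longleftrightarrow> a \<noteq> 0 \<and> (\<forall>r. act n A r v = 0\<^sub>v n \<longleftrightarrow> a dvd r)"

lemma is_orderD:
  assumes "is_order n A v a"
  shows "a \<noteq> 0" "act n A r v = 0\<^sub>v n \<longleftrightarrow> a dvd r"
  using assms unfolding is_order_def by blast+

lemma exists_order:
  assumes A: "A \<in> carrier_mat n n" and v: "v \<in> carrier_vec n"
  shows "\<exists>a. is_order n A v a \<and> degree a \<le> n"
proof -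
  let ?K = "\<lambda>r. r \<noteq> 0 \<and> act n A r v = 0\<^sub>v n"
  have "\<exists>r. ?K r \<and> degree r \<le> n"
  proof (cases "cyclic_vec n A v")
    case True
    obtain f where f: "f \<in> monics n" "eval_mat n A f = 0\<^sub>m n n" using cyclic_char_poly[OF A True] by blast
    then show ?thesis using eval_mat_zero_act[OF f(2) v] by (auto simp: monics_def intro!: exI[of _ f])
  next
    case False
    then obtain r where "r \<in> polys_below n" "?K r" using v by (auto simp: cyclic_vec_def)
    then show ?thesis by (intro exI[of _ r]) (auto simp: polys_below_iff)
  qed
  then obtain r where r: "?K r" "degree r \<le> n" by blast
  obtain a where a: "?K a" and least: "\<And>r. ?K r \<Longrightarrow> degree a \<le> degree r"
    using ex_has_least_nat[of ?K r degree] r(1) by blast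
  have "a dvd s" if s: "act n A s v = 0\<^sub>v n" for s
  proof -
    have "s mod a = s - (s div a) * a" by (simp add: minus_div_mult_eq_mod)
    then have "act n A (s mod a) v = 0\<^sub>v n - 0\<^sub>v n"
      using act_diff[OF A v, of s "s div a * a"] act_eq_zero_mult[OF A v, of a "s div a * a"] a s by simp
    then have z: "act n A (s mod a) v = 0\<^sub>v n" by simp
    have "s mod a = 0"
    proof (rule ccontr)
      assume "s mod a \<noteq> 0"
      then have "degree a \<le> degree (s mod a)" using least z by blast
      then show False using degree_mod_less[of a s] a \<open>s mod a \<noteq> 0\<close> by linarith
    qed
    then show ?thesis by (simp add: dvd_eq_mod_eq_0)
  qed
  then have "is_order n A v a" using a act_eq_zero_mult[OF A v] by (auto simp: is_order_def)
  moreover have "degree a \<le> n" using least[OF r(1)] r(2) by simp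
  ultimately show ?thesis by blast
qed

lemma is_order_act:
  assumes A: "A \<in> carrier_mat n n" and v: "v \<in> carrier_vec n" and o: "is_order n A v (x * y)"
  shows "is_order n A (act n A x v) y"
  unfolding is_order_def
proof (intro conjI allI)
  have xy: "x * y \<noteq> 0" by (rule is_orderD(1)[OF o])
  then show "y \<noteq> 0" by auto
  fix r
  have "act n A r (act n A x v) = act n A (x * r) v" by (subst mult.commute) (simp only: act_mult[OF A v])
  then show "act n A r (act n A x v) = 0\<^sub>v n \<longleftrightarrow> y dvd r"
    using is_orderD(2)[OF o, of "x * r"] xy by simp
qed

text \<open>Multiplying an annihilator \<open>c\<close> of the sum by \<open>p ^ k\<close> removes
  \<open>u\<close>, so \<open>a\<close> divides \<open>p ^ k * c\<close> and hence \<open>c\<close>.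
  Then \<open>c\<close> kills \<open>v\<close>, therefore also \<open>u\<close>, so
  \<open>p ^ k\<close> divides the cofactor too.\<close>

lemma is_order_add:
  assumes A: "A \<in> carrier_mat n n" and v: "v \<in> carrier_vec n" and u: "u \<in> carrier_vec n"
    and a: "is_order n A v a" and b: "is_order n A u (p ^ k)"
    and p: "prime_elem p" "\<not> p dvd a" and c: "act n A c (v + u) = 0\<^sub>v n"
  shows "a * p ^ k dvd c"
proof -
  have split: "act n A r (v + u) = act n A r v + act n A r u" for r
    by (rule mult_add_distrib_mat_vec[OF eval_mat_carrier[OF A] v u])
  have vu: "v + u \<in> carrier_vec n" using v u by simp
  have "act n A (p ^ k * c) (v + u) = 0\<^sub>v n" by (rule act_eq_zero_mult[OF A vu c]) simp
  moreover have "act n A (p ^ k * c) u = 0\<^sub>v n" using is_orderD(2)[OF b] by simp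
  ultimately have "act n A (p ^ k * c) v = 0\<^sub>v n"
    unfolding split using act_carrier[OF A v] by (metis right_zero_vec)
  then have "a dvd p ^ k * c" using is_orderD(2)[OF a] by simp
  then have "a dvd c" by (rule dvd_prime_power_mult_cancel[OF p])
  then obtain e where e: "c = a * e" by blast
  have "act n A c v = 0\<^sub>v n" using is_orderD(2)[OF a] e by simp
  then have "act n A c u = 0\<^sub>v n"
    using c act_carrier[OF A u] unfolding split by (metis left_zero_vec)
  then have "p ^ k dvd a * e" using is_orderD(2)[OF b] e by simp
  then have "p ^ k dvd e" by (rule prime_power_dvd_mult_cancel[OF p])
  then show ?thesis unfolding e by (simp add: mult_dvd_mono)
qed

text \<open>A vector whose order has maximal degree is annihilated only by polynomials annihilating
  everything: otherwise the prime-to-\<open>p\<close> part of its order could be combined with a higher power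
  of \<open>p\<close> occurring in another order.\<close>

lemma cyclic_mat_if_no_annihilator:
  fixes A :: "'a::field mat"
  assumes A: "A \<in> carrier_mat n n"
    and no: "\<And>p. p \<in> polys_below n \<Longrightarrow> eval_mat n A p = 0\<^sub>m n n \<Longrightarrow> p = 0"
  shows "cyclic_mat n A"
proof -
  define K where "K = (\<lambda>(v, a). v \<in> carrier_vec n \<and> is_order n A v a)"
  obtain a0 where "K (0\<^sub>v n, a0)" using exists_order[OF A, of "0\<^sub>v n"] by (auto simp: K_def)
  \<comment> \<open>Orders of the same vector divide one another, so the degree bound of
    \<open>exists_order\<close> holds for every order. This makes a maximal degree exist.\<close>
  moreover have bound: "degree a \<le> n" if "K (v, a)" for v a
  proof -
    have v: "v \<in> carrier_vec n" and a: "is_order n A v a" using that by (auto simp: K_def)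
    obtain b where b: "is_order n A v b" "degree b \<le> n" using exists_order[OF A v] by blast
    then have "a dvd b" "b \<noteq> 0" using is_orderD(2)[OF a, of b] is_orderD(2)[OF b(1), of b] is_orderD(1)[OF b(1)] by simp_all
    then show ?thesis using b(2) dvd_imp_degree_le le_trans by blast
  qed
  ultimately have "\<exists>x. K x \<and> (\<forall>y. K y \<longrightarrow> degree (snd y) \<le> degree (snd x))"
    by (intro ex_has_greatest_nat[of K "(0\<^sub>v n, a0)" "\<lambda>x. degree (snd x)" "Suc n"])
       (auto simp: less_Suc_eq_le)
  then obtain v a where va: "K (v, a)" and max: "\<And>w b. K (w, b) \<Longrightarrow> degree b \<le> degree a"
    by (metis snd_conv surj_pair)
  have v: "v \<in> carrier_vec n" and oa: "is_order n A v a" using va by (auto simp: K_def)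
  then have a0: "a \<noteq> 0" using is_orderD(1) by blast
  have kill: "act n A a u = 0\<^sub>v n" if u: "u \<in> carrier_vec n" for u
  proof (rule ccontr)
    assume ne: "act n A a u \<noteq> 0\<^sub>v n"
    obtain b where ob: "is_order n A u b" using exists_order[OF A u] by blast
    have "\<not> b dvd a" "b \<noteq> 0" using ne is_orderD(2)[OF ob, of a] is_orderD(1)[OF ob] by simp_all
    then obtain p k where p: "monic_irred p" and pk: "p ^ k dvd b" "\<not> p ^ k dvd a"
      using dvd_if_prime_powers_dvd by blast
    obtain i y where iy: "a = p ^ i * y" "\<not> p dvd y" using monic_irred_power_split[OF p a0] by blast
    have "i < k"
    proof (rule ccontr)
      assume "\<not> i < k"
      then have "p ^ k dvd p ^ i" by (simp add: le_imp_power_dvd)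
      then show False using pk(2) iy(1) by simp
    qed
    obtain z where z: "b = z * p ^ k" using pk(1) by (metis dvdE mult.commute)
    let ?v = "act n A (p ^ i) v" and ?u = "act n A z u"
    have o1: "is_order n A ?v y" using is_order_act[OF A v] oa iy(1) by simp
    have o2: "is_order n A ?u (p ^ k)" using is_order_act[OF A u] ob z by simp
    have vu: "?v + ?u \<in> carrier_vec n" using act_carrier[OF A v] act_carrier[OF A u] by simp
    obtain c where oc: "is_order n A (?v + ?u) c" using exists_order[OF A vu] by blast
    have cz: "act n A c (?v + ?u) = 0\<^sub>v n" and c0: "c \<noteq> 0" using is_orderD(2)[OF oc, of c] is_orderD(1)[OF oc] by simp_all
    have "y * p ^ k dvd c"
      by (rule is_order_add[OF A act_carrier[OF A v] act_carrier[OF A u] o1 o2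
            monic_irred_prime_elem[OF p] iy(2) cz])
    then have le: "degree (y * p ^ k) \<le> degree c" using c0 by (rule dvd_imp_degree_le)
    have nz: "y \<noteq> 0" "p \<noteq> 0" using iy(1) a0 p by (auto simp: monic_irred_def)
    have "i * degree p < k * degree p" using \<open>i < k\<close> monic_irred_degree[OF p] by simp
    moreover have "degree y + k * degree p \<le> degree c"
      using le nz by (simp add: degree_mult_eq degree_power_eq mult.commute)
    moreover have "degree a = degree y + i * degree p"
      unfolding iy(1) using nz by (simp add: degree_mult_eq degree_power_eq mult.commute)
    ultimately have "degree a < degree c" by linarith
    moreover have "degree c \<le> degree a" using max[of "?v + ?u" c] vu oc by (simp add: K_def)
    ultimately show False by simp
  qed
  have "eval_mat n A a = 0\<^sub>m n n"
  proof (rule mat_eq_by_action[OF eval_mat_carrier[OF A] zero_carrier_mat])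
    fix u :: "'a vec" assume u: "u \<in> carrier_vec n"
    have "0\<^sub>m n n *\<^sub>v u = 0\<^sub>v n" using u by (intro eq_vecI) auto
    then show "act n A a u = 0\<^sub>m n n *\<^sub>v u" using kill[OF u] by simp
  qed
  \<comment> \<open>Since \<open>a\<close> annihilates the whole space, the hypothesis forces its
    degree up to \<open>n\<close>; hence no nonzero polynomial of degree below \<open>n\<close> can
    be a multiple of it.\<close>
  then have "a \<notin> polys_below n" using no a0 by blast
  then have deg: "n \<le> degree a" using a0 by (simp add: polys_below_iff)
  have "cyclic_vec n A v"
    unfolding cyclic_vec_def
  proof (intro conjI v ballI impI)
    fix p assume p: "p \<in> polys_below n" "act n A p v = 0\<^sub>v n"
    then have "a dvd p" using is_orderD(2)[OF oa] by simp
    then show "p = 0" using p(1) deg dvd_imp_degree_le[of a p] by (cases "p = 0") (auto simp: polys_below_iff)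
  qed
  then show ?thesis using A by (auto simp: cyclic_mat_def)
qed

text \<open>The equations are padded to a square matrix whose row \<open>card E\<close> is zero, so
  its determinant vanishes and a kernel vector exists. The rows after the zero row are
  arbitrary.\<close>

lemma homogeneous_system_solution:
  fixes E :: "('i \<Rightarrow> 'a::field) set"
  assumes E: "finite E" and I: "finite I" and lt: "card E < card I"
  shows "\<exists>x. (\<exists>i\<in>I. x i \<noteq> 0) \<and> (\<forall>a\<in>E. (\<Sum>i\<in>I. a i * x i) = 0)"
proof -
  let ?N = "card I"
  obtain f where f: "bij_betw f {0..<?N} I" using ex_bij_betw_nat_finite[OF I] by blast
  obtain g where g: "bij_betw g {0..<card E} E" using ex_bij_betw_nat_finite[OF E] by blast
  define A where "A = mat\<^sub>r ?N ?N (\<lambda>r. if r = card E then 0\<^sub>v ?N else vec ?N (\<lambda>c. g r (f c)))"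
  have A: "A \<in> carrier_mat ?N ?N" by (simp add: A_def)
  have "det A = 0" unfolding A_def using lt by (intro det_row_0) auto
  then obtain v where v: "v \<in> carrier_vec ?N" "v \<noteq> 0\<^sub>v ?N" "A *\<^sub>v v = 0\<^sub>v ?N"
    using det_0_iff_vec_prod_zero_field[OF A] by blast
  define x where "x = (\<lambda>i. v $ the_inv_into {0..<?N} f i)"
  have xf: "x (f c) = v $ c" if "c < ?N" for c
    using that f by (simp add: x_def bij_betw_def the_inv_into_f_f)
  obtain c where c: "c < ?N" "v $ c \<noteq> 0" using v(1,2) by (metis carrier_vecD eq_vecI index_zero_vec)
  have "f c \<in> I" using f c(1) by (auto simp: bij_betw_def)
  moreover have "(\<Sum>i\<in>I. a i * x i) = 0" if a: "a \<in> E" for a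
  proof -
    have "a \<in> g ` {0..<card E}" using g a by (simp add: bij_betw_def)
    then obtain r where r: "r < card E" "a = g r" by auto
    have "(\<Sum>i\<in>I. a i * x i) = (\<Sum>c\<in>{0..<?N}. a (f c) * x (f c))"
      by (rule sum.reindex_bij_betw[OF f, symmetric])
    also have "\<dots> = (A *\<^sub>v v) $ r"
      using r lt v(1) xf by (auto simp: A_def scalar_prod_def intro!: sum.cong)
    also have "\<dots> = 0" using r lt v(3) by simp
    finally show ?thesis .
  qed
  ultimately show ?thesis using xf[OF c(1)] c(2) by metis
qed

section \<open>The dimension of the commutant\<close>

definition linear_form :: "'i set \<Rightarrow> (('i \<Rightarrow> 'a::field) \<Rightarrow> 'a) \<Rightarrow> bool" where
  "linear_form I \<phi> \<longleftrightarrow> (\<exists>a. \<forall>x. \<phi> x = (\<Sum>i\<in>I. a i * x i))"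

lemma linear_form_var: "finite I \<Longrightarrow> i \<in> I \<Longrightarrow> linear_form I (\<lambda>x. x i)"
  unfolding linear_form_def
  by (intro exI[of _ "\<lambda>j. if j = i then 1 else 0"]) (simp add: if_distrib[of "\<lambda>c. c * _"] sum.delta cong: if_cong)

lemma linear_form_zero: "linear_form I (\<lambda>x. 0)"
  unfolding linear_form_def by (intro exI[of _ "\<lambda>_. 0"]) simp

lemma linear_form_scale:
  assumes "linear_form I \<phi>" shows "linear_form I (\<lambda>x. c * \<phi> x)"
proof -
  obtain a where "\<And>x. \<phi> x = (\<Sum>i\<in>I. a i * x i)" using assms linear_form_def by metis
  then show ?thesis unfolding linear_form_def
    by (intro exI[of _ "\<lambda>i. c * a i"]) (simp add: sum_distrib_left mult.assoc)
qed

lemma linear_form_diff: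
  assumes "linear_form I \<phi>" "linear_form I \<psi>" shows "linear_form I (\<lambda>x. \<phi> x - \<psi> x)"
proof -
  obtain a where "\<And>x. \<phi> x = (\<Sum>i\<in>I. a i * x i)" using assms(1) linear_form_def by metis
  moreover obtain b where "\<And>x. \<psi> x = (\<Sum>i\<in>I. b i * x i)" using assms(2) linear_form_def by metis
  ultimately show ?thesis unfolding linear_form_def
    by (intro exI[of _ "\<lambda>i. a i - b i"]) (simp add: sum_subtractf left_diff_distrib)
qed

lemma linear_form_sum:
  assumes "\<And>k. k \<in> K \<Longrightarrow> linear_form I (\<phi> k)"
  shows "linear_form I (\<lambda>x. \<Sum>k\<in>K. \<phi> k x)"
proof -
  have "\<forall>k\<in>K. \<exists>a. \<forall>x. \<phi> k x = (\<Sum>i\<in>I. a i * x i)" using assms linear_form_def by blast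
  from bchoice[OF this] obtain a where a: "\<And>k x. k \<in> K \<Longrightarrow> \<phi> k x = (\<Sum>i\<in>I. a k i * x i)" by blast
  have "(\<Sum>k\<in>K. \<phi> k x) = (\<Sum>i\<in>I. (\<Sum>k\<in>K. a k i) * x i)" for x
    using a by (simp add: sum_distrib_right sum.swap[of _ I K])
  then show ?thesis unfolding linear_form_def by (intro exI[of _ "\<lambda>i. \<Sum>k\<in>K. a k i"]) blast
qed

lemma linear_forms_common_zero:
  fixes \<phi> :: "'j \<Rightarrow> ('i \<Rightarrow> 'a::field) \<Rightarrow> 'a"
  assumes I: "finite I" and J: "finite J" "card J < card I"
    and l: "\<And>j. j \<in> J \<Longrightarrow> linear_form I (\<phi> j)"
  shows "\<exists>x. (\<exists>i\<in>I. x i \<noteq> 0) \<and> (\<forall>j\<in>J. \<phi> j x = 0)"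
proof -
  have "\<forall>j\<in>J. \<exists>a. \<forall>x. \<phi> j x = (\<Sum>i\<in>I. a i * x i)" using l linear_form_def by blast
  from bchoice[OF this] obtain a where a: "\<And>j x. j \<in> J \<Longrightarrow> \<phi> j x = (\<Sum>i\<in>I. a j i * x i)"
    by blast
  have "card (a ` J) < card I" using card_image_le[OF J(1), of a] J(2) by linarith
  then obtain x where "\<exists>i\<in>I. x i \<noteq> 0" "\<forall>b\<in>a ` J. (\<Sum>i\<in>I. b i * x i) = 0"
    using homogeneous_system_solution[of "a ` J" I] I J(1) by auto
  then have "\<phi> j x = 0" if "j \<in> J" for j using a[OF that, of x] that by auto
  then show ?thesis using \<open>\<exists>i\<in>I. x i \<noteq> 0\<close> by blast
qed

text \<open>\<open>mat_dim_ge n S d\<close> certifies \<open>dim S \<ge> d\<close> for a space \<open>S\<close> of matrices by elements in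
  echelon form.\<close>

definition echelon :: "nat \<Rightarrow> 'a::field mat set \<Rightarrow> nat \<Rightarrow> (nat \<Rightarrow> 'a mat) \<Rightarrow> (nat \<Rightarrow> nat \<times> nat) \<Rightarrow> bool" where
  "echelon n S d M e \<longleftrightarrow> (\<forall>i<d. M i \<in> S \<and> M i \<in> carrier_mat n n \<and> e i \<in> {..<n} \<times> {..<n} \<and>
     M i $$ e i \<noteq> 0 \<and> (\<forall>j<i. M i $$ e j = 0))"

definition mat_dim_ge :: "nat \<Rightarrow> 'a::field mat set \<Rightarrow> nat \<Rightarrow> bool" where
  "mat_dim_ge n S d \<longleftrightarrow> (\<exists>M e. echelon n S d M e)"

lemma mat_dim_ge_mono:
  assumes "mat_dim_ge n S d" "d' \<le> d"
  shows "mat_dim_ge n S d'"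
proof -
  obtain M e where "echelon n S d M e" using assms(1) by (auto simp: mat_dim_ge_def)
  then have "echelon n S d' M e" using assms(2) by (simp add: echelon_def)
  then show ?thesis by (auto simp: mat_dim_ge_def)
qed

text \<open>At the pivot \<open>e l\<close> the later matrices vanish, and the coefficients of the
  earlier ones are zero by induction, so only the term of \<open>l\<close> remains.\<close>

lemma echelon_independent:
  assumes t: "echelon n S d M e"
    and z: "\<And>r s. r < n \<Longrightarrow> s < n \<Longrightarrow> (\<Sum>l<d. c l * M l $$ (r, s)) = 0" and l: "l < d"
  shows "c l = 0"
  using l
proof (induction l rule: less_induct)
  case (less l)
  have e: "e l \<in> {..<n} \<times> {..<n}" using t less.prems by (simp add: echelon_def)
  have "(\<Sum>k<d. c k * M k $$ e l) = (\<Sum>k\<in>{l}. c k * M k $$ e l)"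
  proof (rule sum.mono_neutral_right)
    show "\<forall>k\<in>{..<d} - {l}. c k * M k $$ e l = 0"
    proof
      fix k assume k: "k \<in> {..<d} - {l}"
      show "c k * M k $$ e l = 0"
      proof (cases "k < l")
        case True
        then show ?thesis using less.IH k by simp
      next
        case False
        then have "l < k" using k by simp
        then show ?thesis using t k by (simp add: echelon_def)
      qed
    qed
  qed (use less.prems in auto)
  moreover have "(\<Sum>k<d. c k * M k $$ e l) = 0" using z[of "fst (e l)" "snd (e l)"] e by (auto simp: mem_Times_iff)
  ultimately have "c l * M l $$ e l = 0" by simp
  then show ?case using t less.prems by (simp add: echelon_def)
qed

text \<open>A rank-nullity bound: the \<open>card J\<close> equations leave at least
  \<open>card I - card J\<close> dimensions, which \<Phi> embeds into \<open>S\<close>. The echelon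
  family is built greedily. Vanishing at the \<open>d\<close> pivots found so far costs
  \<open>d\<close> further equations, and any nonzero entry of the resulting matrix serves as the
  next pivot.\<close>

lemma mat_dim_geI:
  fixes \<Phi> :: "('i \<Rightarrow> 'a::field) \<Rightarrow> 'a mat"
  assumes I: "finite I" and J: "finite J"
    and entries: "\<And>r s. r < n \<Longrightarrow> s < n \<Longrightarrow> linear_form I (\<lambda>x. \<Phi> x $$ (r, s))"
    and eqs: "\<And>j. j \<in> J \<Longrightarrow> linear_form I (\<psi> j)"
    and carrier: "\<And>x. \<Phi> x \<in> carrier_mat n n"
    and sol: "\<And>x. \<exists>i\<in>I. x i \<noteq> 0 \<Longrightarrow> \<forall>j\<in>J. \<psi> j x = 0 \<Longrightarrow> \<Phi> x \<in> S \<and> \<Phi> x \<noteq> 0\<^sub>m n n"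
  shows "mat_dim_ge n S (card I - card J)"
proof -
  have "\<exists>M e. echelon n S d M e" if "d \<le> card I - card J" for d
    using that
  proof (induction d)
    case 0
    then show ?case by (simp add: echelon_def)
  next
    case (Suc d)
    then obtain M e where t: "echelon n S d M e" by auto
    define \<theta> where "\<theta> = (\<lambda>k x. case k of Inl j \<Rightarrow> \<psi> j x | Inr i \<Rightarrow> \<Phi> x $$ e i)"
    have "card (J <+> {..<d}) < card I" using Suc.prems J by (simp add: card_Plus)
    moreover have "linear_form I (\<theta> k)" if k: "k \<in> J <+> {..<d}" for k
    proof (cases k)
      case (Inl j)
      then show ?thesis using eqs k by (auto simp: \<theta>_def)
    next
      case (Inr i)
      then have "i < d" using k by auto
      then have "e i \<in> {..<n} \<times> {..<n}" using t by (simp add: echelon_def)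
      then show ?thesis using entries[of "fst (e i)" "snd (e i)"] Inr by (auto simp: \<theta>_def mem_Times_iff)
    qed
    moreover have "finite (J <+> {..<d})" using J by simp
    ultimately obtain x where x: "\<exists>i\<in>I. x i \<noteq> 0" "\<forall>k\<in>J <+> {..<d}. \<theta> k x = 0"
      using linear_forms_common_zero[OF I, of "J <+> {..<d}" \<theta>] by blast
    have "\<psi> j x = 0" if "j \<in> J" for j using x(2) that by (force simp: \<theta>_def)
    then have \<Phi>: "\<Phi> x \<in> S" "\<Phi> x \<noteq> 0\<^sub>m n n" using sol[OF x(1)] by blast+
    have z: "\<Phi> x $$ e i = 0" if "i < d" for i using x(2) that by (force simp: \<theta>_def)
    have "\<exists>r s. r < n \<and> s < n \<and> \<Phi> x $$ (r, s) \<noteq> 0"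
    proof (rule ccontr)
      assume "\<not> ?thesis"
      then have "\<Phi> x = 0\<^sub>m n n" using carrier[of x] by (intro eq_matI) auto
      then show False using \<Phi>(2) by simp
    qed
    then obtain r s where rs: "r < n" "s < n" "\<Phi> x $$ (r, s) \<noteq> 0" by blast
    have "echelon n S (Suc d) (M(d := \<Phi> x)) (e(d := (r, s)))"
      using t \<Phi>(1) carrier z rs unfolding echelon_def by (auto simp: less_Suc_eq)
    then show ?case by blast
  qed
  then show ?thesis by (simp add: mat_dim_ge_def)
qed

definition commutant :: "nat \<Rightarrow> 'a::field mat \<Rightarrow> 'a mat set" where
  "commutant n A = {M \<in> carrier_mat n n. A * M = M * A}"

definition mat_comb :: "nat \<Rightarrow> nat \<Rightarrow> (nat \<Rightarrow> 'a::field mat) \<Rightarrow> (nat \<Rightarrow> 'a) \<Rightarrow> 'a mat" where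
  "mat_comb n d M x = mat n n (\<lambda>(r, s). \<Sum>l<d. x l * M l $$ (r, s))"

lemma mat_comb_carrier [simp]: "mat_comb n d M x \<in> carrier_mat n n"
  by (simp add: mat_comb_def)

lemma mat_mult_index:
  assumes "A \<in> carrier_mat n n" "B \<in> carrier_mat n n" "i < n" "j < n"
  shows "(A * B) $$ (i, j) = (\<Sum>l<n. A $$ (i, l) * B $$ (l, j))"
  using assms by (auto simp: scalar_prod_def lessThan_atLeast0)

lemma mult_mat_comb:
  assumes A: "A \<in> carrier_mat n n" and M: "\<And>l. l < d \<Longrightarrow> M l \<in> carrier_mat n n"
  shows "A * mat_comb n d M x = mat_comb n d (\<lambda>l. A * M l) x"
proof (rule eq_matI)
  fix i j assume "i < dim_row (mat_comb n d (\<lambda>l. A * M l) x)" "j < dim_col (mat_comb n d (\<lambda>l. A * M l) x)"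
  then have ij: "i < n" "j < n" by (auto simp: mat_comb_def)
  have "(A * mat_comb n d M x) $$ (i, j) = (\<Sum>k<n. A $$ (i, k) * (\<Sum>l<d. x l * M l $$ (k, j)))"
    unfolding mat_mult_index[OF A mat_comb_carrier ij] using ij by (intro sum.cong) (auto simp: mat_comb_def)
  also have "\<dots> = (\<Sum>l<d. x l * (\<Sum>k<n. A $$ (i, k) * M l $$ (k, j)))"
    unfolding sum_distrib_left by (subst sum.swap) (simp add: mult_ac)
  also have "\<dots> = (\<Sum>l<d. x l * (A * M l) $$ (i, j))"
    using mat_mult_index[OF A M ij] by (intro sum.cong) auto
  finally show "(A * mat_comb n d M x) $$ (i, j) = mat_comb n d (\<lambda>l. A * M l) x $$ (i, j)"
    using ij by (simp add: mat_comb_def)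
qed (use A in \<open>auto simp: mat_comb_def\<close>)

lemma mat_comb_mult:
  assumes A: "A \<in> carrier_mat n n" and M: "\<And>l. l < d \<Longrightarrow> M l \<in> carrier_mat n n"
  shows "mat_comb n d M x * A = mat_comb n d (\<lambda>l. M l * A) x"
proof (rule eq_matI)
  fix i j assume "i < dim_row (mat_comb n d (\<lambda>l. M l * A) x)" "j < dim_col (mat_comb n d (\<lambda>l. M l * A) x)"
  then have ij: "i < n" "j < n" by (auto simp: mat_comb_def)
  have "(mat_comb n d M x * A) $$ (i, j) = (\<Sum>k<n. (\<Sum>l<d. x l * M l $$ (i, k)) * A $$ (k, j))"
    unfolding mat_mult_index[OF mat_comb_carrier A ij] using ij by (intro sum.cong) (auto simp: mat_comb_def)
  also have "\<dots> = (\<Sum>l<d. x l * (\<Sum>k<n. M l $$ (i, k) * A $$ (k, j)))"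
    unfolding sum_distrib_left sum_distrib_right by (subst sum.swap) (simp add: mult_ac)
  also have "\<dots> = (\<Sum>l<d. x l * (M l * A) $$ (i, j))"
    using mat_mult_index[OF M A ij] by (intro sum.cong) auto
  finally show "(mat_comb n d M x * A) $$ (i, j) = mat_comb n d (\<lambda>l. M l * A) x $$ (i, j)"
    using ij by (simp add: mat_comb_def)
qed (use A in \<open>auto simp: mat_comb_def\<close>)

lemma mat_comb_cong: "(\<And>l. l < d \<Longrightarrow> M l = N l) \<Longrightarrow> mat_comb n d M x = mat_comb n d N x"
  by (auto simp: mat_comb_def intro!: eq_matI sum.cong)

lemma mat_comb_commutant:
  assumes A: "A \<in> carrier_mat n n" and M: "\<And>l. l < d \<Longrightarrow> M l \<in> commutant n A"
  shows "mat_comb n d M x \<in> commutant n A"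
proof -
  have c: "\<And>l. l < d \<Longrightarrow> M l \<in> carrier_mat n n" using M by (simp add: commutant_def)
  have "A * mat_comb n d M x = mat_comb n d M x * A"
    using mult_mat_comb[where d = d and M = M and x = x, OF A c] mat_comb_mult[where d = d and M = M and x = x, OF A c]
      mat_comb_cong[of d "\<lambda>l. A * M l" "\<lambda>l. M l * A" n x] M by (simp add: commutant_def)
  then show ?thesis by (simp add: commutant_def)
qed

lemma echelon_mat_comb_zero:
  assumes "echelon n S d M e" "mat_comb n d M x = 0\<^sub>m n n" "l < d"
  shows "x l = 0"
proof (rule echelon_independent[OF assms(1) _ assms(3)])
  fix r s assume "r < n" "s < n"
  then show "(\<Sum>l<d. x l * M l $$ (r, s)) = 0"
    using arg_cong[OF assms(2), of "\<lambda>A. A $$ (r, s)"] by (simp add: mat_comb_def)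
qed

text \<open>Conjugation keeps independence but destroys the echelon form. A new echelon family is
  therefore extracted from the combinations of the conjugated matrices by \<open>mat_dim_geI\<close>
  without equations.\<close>

lemma mat_dim_ge_conj:
  assumes A: "A \<in> carrier_mat n n" and P: "P \<in> GL n" and B: "B \<in> carrier_mat n n"
    and AP: "A * P = P * B" and d: "mat_dim_ge n (commutant n B) d"
  shows "mat_dim_ge n (commutant n A) d"
proof -
  have Pc: "P \<in> carrier_mat n n" using P by (simp add: GL_def)
  obtain R where R: "R \<in> carrier_mat n n" "P * R = 1\<^sub>m n" "R * P = 1\<^sub>m n" using P by (rule GL_inverse)
  have RA: "R * A = B * R"
  proof -
    have "R * A = R * (A * P) * R"
      using A Pc R assoc_mult_mat[OF R(1) mult_carrier_mat[OF A Pc] R(1)] assoc_mult_mat[OF A Pc R(1)] by simp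
    also have "R * (A * P) = B" unfolding AP using assoc_mult_mat[OF R(1) Pc B] R(3) B by simp
    finally show ?thesis .
  qed
  obtain M e where t: "echelon n (commutant n B) d M e" using d by (auto simp: mat_dim_ge_def)
  have M: "M l \<in> carrier_mat n n" "B * M l = M l * B" if "l < d" for l
    using t that by (auto simp: echelon_def commutant_def)
  define N where "N = (\<lambda>l. P * M l * R)"
  have Nc: "N l \<in> carrier_mat n n" if "l < d" for l using Pc R M[OF that] by (simp add: N_def)
  have N: "N l \<in> commutant n A" if "l < d" for l
  proof -
    note m = M[OF that]
    have "A * N l = A * P * M l * R"
      unfolding N_def using assoc_mult_mat[OF A mult_carrier_mat[OF Pc m(1)] R(1)] assoc_mult_mat[OF A Pc m(1)] by simp
    also have "\<dots> = P * (B * M l) * R" unfolding AP using assoc_mult_mat[OF Pc B m(1)] by simp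
    also have "\<dots> = P * M l * (B * R)"
      unfolding m(2) using assoc_mult_mat[OF Pc m(1) B] assoc_mult_mat[OF mult_carrier_mat[OF Pc m(1)] B R(1)] by simp
    also have "\<dots> = N l * A"
      unfolding N_def RA[symmetric] using assoc_mult_mat[OF mult_carrier_mat[OF Pc m(1)] R(1) A] by simp
    finally show ?thesis using Nc[OF that] by (simp add: commutant_def)
  qed
  have RNP: "R * N l * P = M l" if "l < d" for l
  proof -
    note m = M(1)[OF that]
    have "R * N l = M l * R"
      unfolding N_def using assoc_mult_mat[OF R(1) mult_carrier_mat[OF Pc m] R(1)] assoc_mult_mat[OF R(1) Pc m] R(3) m by simp
    then show ?thesis using assoc_mult_mat[OF m R(1) Pc] R(3) m by simp
  qed
  have "mat_dim_ge n (commutant n A) (card {..<d} - card ({} :: nat set))"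
  proof (rule mat_dim_geI[where \<Phi> = "mat_comb n d N" and \<psi> = "\<lambda>_ _. 0"])
    show "linear_form {..<d} (\<lambda>x. mat_comb n d N x $$ (r, s))" if "r < n" "s < n" for r s
    proof -
      have "mat_comb n d N x $$ (r, s) = (\<Sum>l<d. N l $$ (r, s) * x l)" for x
        using that by (simp add: mat_comb_def mult.commute)
      then show ?thesis unfolding linear_form_def by (intro exI[of _ "\<lambda>l. N l $$ (r, s)"]) blast
    qed
    fix x :: "nat \<Rightarrow> 'a" assume x: "\<exists>i\<in>{..<d}. x i \<noteq> 0"
    have "mat_comb n d N x \<noteq> 0\<^sub>m n n"
    proof
      assume z: "mat_comb n d N x = 0\<^sub>m n n"
      have "mat_comb n d M x = mat_comb n d (\<lambda>l. R * N l * P) x" by (rule mat_comb_cong) (simp add: RNP)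
      also have "\<dots> = R * mat_comb n d N x * P"
        using mult_mat_comb[OF R(1) Nc] mat_comb_mult[OF Pc, of d "\<lambda>l. R * N l"] mult_carrier_mat[OF R(1) Nc] by simp
      also have "\<dots> = 0\<^sub>m n n" unfolding z using R Pc by simp
      finally show False using echelon_mat_comb_zero[OF t] x by auto
    qed
    then show "mat_comb n d N x \<in> commutant n A \<and> mat_comb n d N x \<noteq> 0\<^sub>m n n"
      using mat_comb_commutant[where d = d and M = N and x = x, OF A N] by blast
  qed auto
  then show ?thesis by simp
qed

text \<open>\<open>A\<close> is block upper triangular with a scalar block of size \<open>k\<close>
  and the block \<open>D\<close>. Among block upper triangular matrices with free upper rows and
  lower block in the commutant of \<open>D\<close>, there are \<open>k (k + m) + d\<close>
  parameters. Commutation with \<open>A\<close> can fail only in the upper right block, which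
  imposes \<open>k m\<close> equations and leaves \<open>k^2 + d\<close>.\<close>

lemma commutant_block:
  fixes A :: "'a::field mat"
  assumes A: "A \<in> carrier_mat (k + m) (k + m)"
    and cols: "\<And>i j. i < k + m \<Longrightarrow> j < k \<Longrightarrow> A $$ (i, j) = (if i = j then \<mu> else 0)"
    and D: "D = mat m m (\<lambda>(i, j). A $$ (i + k, j + k))"
    and d: "mat_dim_ge m (commutant m D) d"
  shows "mat_dim_ge (k + m) (commutant (k + m) A) (k * k + d)"
proof -
  let ?n = "k + m"
  obtain Z e where t: "echelon m (commutant m D) d Z e" using d by (auto simp: mat_dim_ge_def)
  have Dc: "D \<in> carrier_mat m m" by (simp add: D)
  define I where "I = Inl ` ({..<k} \<times> {..<?n}) \<union> (Inr ` {..<d} :: ((nat \<times> nat) + nat) set)"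
  define W where "W = (\<lambda>x :: (nat \<times> nat) + nat \<Rightarrow> 'a. mat_comb m d Z (\<lambda>l. x (Inr l)))"
  define \<Phi> where "\<Phi> = (\<lambda>x :: (nat \<times> nat) + nat \<Rightarrow> 'a. mat ?n ?n (\<lambda>(i, j).
     if i < k then x (Inl (i, j)) else if j < k then 0 else W x $$ (i - k, j - k)))"
  define J where "J = {..<k} \<times> {k..<?n}"
  define \<psi> where "\<psi> = (\<lambda>(i, j) x. (\<Sum>l<?n. A $$ (i, l) * \<Phi> x $$ (l, j)) - (\<Sum>l<?n. A $$ (l, j) * \<Phi> x $$ (i, l)))"
  have finI: "finite I" by (simp add: I_def)
  have cardI: "card I = k * ?n + d"
    unfolding I_def by (subst card_Un_disjoint) (auto simp: card_image card_cartesian_product)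
  have cardJ: "card J = k * m" by (simp add: J_def card_cartesian_product)
  have \<Phi>c: "\<Phi> x \<in> carrier_mat ?n ?n" for x by (simp add: \<Phi>_def)
  have Wc: "W x \<in> carrier_mat m m" for x by (simp add: W_def)
  have entries: "linear_form I (\<lambda>x. \<Phi> x $$ (i, j))" if ij: "i < ?n" "j < ?n" for i j
  proof (cases "i < k")
    case True
    then have "(\<lambda>x. \<Phi> x $$ (i, j)) = (\<lambda>x. x (Inl (i, j)))" using ij by (simp add: \<Phi>_def)
    moreover have "Inl (i, j) \<in> I" using True ij by (simp add: I_def)
    ultimately show ?thesis using linear_form_var[OF finI] by metis
  next
    case False
    show ?thesis
    proof (cases "j < k")
      case True
      then have "(\<lambda>x. \<Phi> x $$ (i, j)) = (\<lambda>x. 0)" using ij False by (simp add: \<Phi>_def)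
      then show ?thesis using linear_form_zero by metis
    next
      case j: False
      have "(\<lambda>x. \<Phi> x $$ (i, j)) = (\<lambda>x. \<Sum>l<d. Z l $$ (i - k, j - k) * x (Inr l))"
        using ij False j by (intro ext) (simp add: \<Phi>_def W_def mat_comb_def mult.commute)
      moreover have "linear_form I (\<lambda>x. \<Sum>l<d. Z l $$ (i - k, j - k) * x (Inr l))"
        by (intro linear_form_sum linear_form_scale linear_form_var finI) (simp add: I_def)
      ultimately show ?thesis by simp
    qed
  qed
  have shift: "(\<Sum>l<?n. g l) = (\<Sum>l<k. g l) + (\<Sum>l<m. g (l + k))" for g :: "nat \<Rightarrow> 'a"
  proof -
    have "{..<?n} = {..<k} \<union> {k..<?n}" by auto
    then have "(\<Sum>l<?n. g l) = (\<Sum>l<k. g l) + (\<Sum>l\<in>{k..<?n}. g l)"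
      by (simp add: sum.union_disjoint ivl_disj_int)
    also have "(\<Sum>l\<in>{k..<?n}. g l) = (\<Sum>l<m. g (l + k))"
      using sum.shift_bounds_nat_ivl[of g 0 k m] by (simp add: lessThan_atLeast0 add.commute)
    finally show ?thesis .
  qed
  have comm: "A * \<Phi> x = \<Phi> x * A" if eq: "\<forall>j\<in>J. \<psi> j x = 0" for x
  proof (rule eq_matI)
    fix i j assume "i < dim_row (\<Phi> x * A)" "j < dim_col (\<Phi> x * A)"
    then have ij: "i < ?n" "j < ?n" using A \<Phi>c[of x] by auto
    have low: "\<Phi> x $$ (l, j) = 0" if "k \<le> l" "l < ?n" "j < k" for l j using that by (simp add: \<Phi>_def)
    have top: "(\<Sum>l<k. (if l = j then \<mu> else 0) * g l) = (if j < k then \<mu> * g j else 0)" for g :: "nat \<Rightarrow> 'a" and j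
      by (simp add: if_distrib[of "\<lambda>c. c * _"] sum.delta' cong: if_cong)
    show "(A * \<Phi> x) $$ (i, j) = (\<Phi> x * A) $$ (i, j)"
      unfolding mat_mult_index[OF A \<Phi>c ij] mat_mult_index[OF \<Phi>c A ij]
    proof (cases "j < k")
      case True
      have "(\<Sum>l<?n. A $$ (i, l) * \<Phi> x $$ (l, j)) = (\<Sum>l<k. (if l = i then \<mu> else 0) * \<Phi> x $$ (l, j))"
        unfolding shift using True low[of _ j] cols ij by (auto intro!: sum.cong)
      also have "\<dots> = \<mu> * \<Phi> x $$ (i, j)" unfolding top using low[of i j] ij True by simp
      also have "\<dots> = (\<Sum>l<?n. (if l = j then \<mu> * \<Phi> x $$ (i, l) else 0))"
        using ij by (simp add: sum.delta)
      also have "\<dots> = (\<Sum>l<?n. \<Phi> x $$ (i, l) * A $$ (l, j))"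
        using cols True by (intro sum.cong) auto
      finally show "(\<Sum>l<?n. A $$ (i, l) * \<Phi> x $$ (l, j)) = (\<Sum>l<?n. \<Phi> x $$ (i, l) * A $$ (l, j))" .
    next
      case j: False
      show "(\<Sum>l<?n. A $$ (i, l) * \<Phi> x $$ (l, j)) = (\<Sum>l<?n. \<Phi> x $$ (i, l) * A $$ (l, j))"
      proof (cases "i < k")
        case True
        then have "(i, j) \<in> J" using j ij by (simp add: J_def)
        then have "\<psi> (i, j) x = 0" using eq by blast
        then show ?thesis by (simp add: \<psi>_def mult.commute)
      next
        case False
        define i' j' where "i' = i - k" and "j' = j - k"
        have i': "i = i' + k" "i' < m" and j': "j = j' + k" "j' < m" using False j ij by (auto simp: i'_def j'_def)
        have "(\<Sum>l<?n. A $$ (i, l) * \<Phi> x $$ (l, j)) = (\<Sum>l<m. D $$ (i', l) * W x $$ (l, j'))"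
          unfolding shift using cols i' j' ij by (simp add: D \<Phi>_def)
        also have "\<dots> = (D * W x) $$ (i', j')" by (rule mat_mult_index[OF Dc Wc i'(2) j'(2), symmetric])
        also have "D * W x = W x * D"
          using mat_comb_commutant[where d = d and M = Z and x = "\<lambda>l. x (Inr l)", OF Dc] t
          by (auto simp: W_def echelon_def commutant_def)
        also have "(W x * D) $$ (i', j') = (\<Sum>l<m. W x $$ (i', l) * D $$ (l, j'))"
          by (rule mat_mult_index[OF Wc Dc i'(2) j'(2)])
        also have "\<dots> = (\<Sum>l<?n. \<Phi> x $$ (i, l) * A $$ (l, j))"
          unfolding shift using i' j' ij by (simp add: D \<Phi>_def)
        finally show ?thesis .
      qed
    qed
  qed (use A carrier_matD[OF \<Phi>c[of x]] in auto)
  have "mat_dim_ge ?n (commutant ?n A) (card I - card J)"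
  proof (rule mat_dim_geI[OF finI _ entries, where \<psi> = \<psi>])
    show "finite J" by (simp add: J_def)
    show "linear_form I (\<psi> p)" if "p \<in> J" for p
    proof -
      obtain i j where p: "p = (i, j)" "i < k" "j < ?n" using \<open>p \<in> J\<close> by (auto simp: J_def)
      have "linear_form I (\<lambda>x. (\<Sum>l<?n. A $$ (i, l) * \<Phi> x $$ (l, j)) - (\<Sum>l<?n. A $$ (l, j) * \<Phi> x $$ (i, l)))"
        using p(2,3) by (intro linear_form_diff linear_form_sum linear_form_scale entries) auto
      then show ?thesis by (simp add: \<psi>_def p(1))
    qed
    show "\<Phi> x \<in> carrier_mat ?n ?n" for x by (rule \<Phi>c)
    fix x assume x: "\<exists>i\<in>I. x i \<noteq> 0" and eq: "\<forall>j\<in>J. \<psi> j x = 0"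
    have "\<Phi> x \<noteq> 0\<^sub>m ?n ?n"
    proof
      assume z: "\<Phi> x = 0\<^sub>m ?n ?n"
      have "x (Inl (i, j)) = 0" if "i < k" "j < ?n" for i j
        using arg_cong[OF z, of "\<lambda>M. M $$ (i, j)"] that by (simp add: \<Phi>_def)
      moreover have "W x = 0\<^sub>m m m"
      proof (rule eq_matI)
        fix i j assume "i < dim_row (0\<^sub>m m m :: 'a mat)" "j < dim_col (0\<^sub>m m m :: 'a mat)"
        then show "W x $$ (i, j) = 0\<^sub>m m m $$ (i, j)"
          using arg_cong[OF z, of "\<lambda>M. M $$ (i + k, j + k)"] by (simp add: \<Phi>_def)
      qed (use Wc[of x] in auto)
      then have "x (Inr l) = 0" if "l < d" for l
        using echelon_mat_comb_zero[OF t, of "\<lambda>l. x (Inr l)"] that by (simp add: W_def)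
      ultimately show False using x by (auto simp: I_def)
    qed
    then show "\<Phi> x \<in> commutant ?n A \<and> \<Phi> x \<noteq> 0\<^sub>m ?n ?n"
      using comm[OF eq] \<Phi>c by (simp add: commutant_def)
  qed
  moreover have "card I - card J = k * k + d" unfolding cardI cardJ by (simp add: algebra_simps)
  ultimately show ?thesis by simp
qed

section \<open>Eigenvectors and lower bounds for the commutant\<close>

definition independent_vecs :: "nat \<Rightarrow> nat \<Rightarrow> (nat \<Rightarrow> 'a::field vec) \<Rightarrow> bool" where
  "independent_vecs n k v \<longleftrightarrow> (\<forall>i<k. v i \<in> carrier_vec n) \<and>
     (\<forall>c. (\<forall>r<n. (\<Sum>i<k. c i * v i $ r) = 0) \<longrightarrow> (\<forall>i<k. c i = 0))"

text \<open>Fewer than \<open>n\<close> vectors are orthogonal to some nonzero \<open>y\<close>. A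
  unit vector at a nonzero coordinate of \<open>y\<close> is not orthogonal to \<open>y\<close>, so
  it lies outside their span.\<close>

lemma independent_vecs_extend_one:
  fixes v :: "nat \<Rightarrow> 'a::field vec"
  assumes v: "independent_vecs n k v" and k: "k < n"
  shows "\<exists>p<n. independent_vecs n (Suc k) (v(k := unit_vec n p))"
proof -
  have "\<exists>y. (\<exists>r\<in>{..<n}. y r \<noteq> 0) \<and> (\<forall>i\<in>{..<k}. (\<Sum>r<n. v i $ r * y r) = 0)"
    using k by (intro linear_forms_common_zero) (auto simp: linear_form_def)
  then obtain y p where p: "p < n" "y p \<noteq> 0" and y: "\<And>i. i < k \<Longrightarrow> (\<Sum>r<n. v i $ r * y r) = 0" by auto
  have "independent_vecs n (Suc k) (v(k := unit_vec n p))"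
    unfolding independent_vecs_def
  proof (intro conjI allI impI)
    show "(v(k := unit_vec n p)) i \<in> carrier_vec n" if "i < Suc k" for i
      using v that by (auto simp: independent_vecs_def less_Suc_eq)
    fix c i assume c: "\<forall>r<n. (\<Sum>i<Suc k. c i * (v(k := unit_vec n p)) i $ r) = 0" and i: "i < Suc k"
    have c': "(\<Sum>i<k. c i * v i $ r) + c k * (if r = p then 1 else 0) = 0" if r: "r < n" for r
    proof -
      have "(\<Sum>i<k. c i * (v(k := unit_vec n p)) i $ r) = (\<Sum>i<k. c i * v i $ r)" by (intro sum.cong) auto
      then show ?thesis using c[rule_format, OF r] r p(1) by (simp add: unit_vec_def)
    qed
    have "0 = (\<Sum>r<n. ((\<Sum>i<k. c i * v i $ r) + c k * (if r = p then 1 else 0)) * y r)"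
      using c' by simp
    also have "\<dots> = (\<Sum>r<n. \<Sum>i<k. c i * (v i $ r * y r)) + (\<Sum>r<n. if r = p then c k * y r else 0)"
      unfolding sum.distrib[symmetric] by (intro sum.cong) (auto simp: distrib_right sum_distrib_right mult.assoc)
    also have "(\<Sum>r<n. \<Sum>i<k. c i * (v i $ r * y r)) = 0"
      by (subst sum.swap) (simp add: sum_distrib_left[symmetric] y)
    finally have ck: "c k = 0" using p by simp
    then have "\<forall>r<n. (\<Sum>i<k. c i * v i $ r) = 0" using c' by simp
    then have "\<forall>i<k. c i = 0" using v by (simp add: independent_vecs_def)
    then show "c i = 0" using ck i by (auto simp: less_Suc_eq)
  qed
  then show ?thesis using p(1) by blast
qed

lemma independent_vecs_extend:
  assumes "independent_vecs n k v" "k \<le> n"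
  shows "\<exists>P\<in>GL n. \<forall>i<k. col P i = v i"
  using assms
proof (induction "n - k" arbitrary: k v)
  case 0
  then have k: "k = n" by simp
  have vc: "\<And>i. i < n \<Longrightarrow> v i \<in> carrier_vec n"
    and vi: "\<And>c. \<forall>r<n. (\<Sum>i<n. c i * v i $ r) = 0 \<Longrightarrow> \<forall>i<n. c i = 0"
    using 0 k unfolding independent_vecs_def by blast+
  let ?P = "mat n n (\<lambda>(r, i). v i $ r)"
  have "det ?P \<noteq> 0"
  proof
    assume "det ?P = 0"
    then obtain w where w: "w \<in> carrier_vec n" "w \<noteq> 0\<^sub>v n" "?P *\<^sub>v w = 0\<^sub>v n"
      using det_0_iff_vec_prod_zero_field[of ?P n] by auto
    have "(\<Sum>i<n. w $ i * v i $ r) = 0" if "r < n" for r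
    proof -
      have "(?P *\<^sub>v w) $ r = (\<Sum>i<n. w $ i * v i $ r)"
        using that w(1) by (auto simp: scalar_prod_def lessThan_atLeast0 mult.commute)
      then show ?thesis using w(3) that by simp
    qed
    then have "\<forall>i<n. w $ i = 0" using vi[of "\<lambda>i. w $ i"] by blast
    then show False using w(1,2) by (auto intro: eq_vecI)
  qed
  then have "?P \<in> GL n" by (simp add: GL_iff_det)
  moreover have "col ?P i = v i" if "i < k" for i using that k vc[of i] by (intro eq_vecI) auto
  ultimately show ?case by blast
next
  case (Suc m)
  then have "k < n" by simp
  then obtain p where p: "independent_vecs n (Suc k) (v(k := unit_vec n p))"
    using independent_vecs_extend_one Suc.prems by blast
  have "m = n - Suc k" "Suc k \<le> n" using Suc.hyps(2) by simp_all
  then obtain P where P: "P \<in> GL n" "\<And>i. i < Suc k \<Longrightarrow> col P i = (v(k := unit_vec n p)) i"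
    using Suc.hyps(1)[OF _ p] by blast
  have "col P i = v i" if "i < k" for i using P(2)[of i] that by simp
  then show ?case using P(1) by blast
qed

text \<open>In a basis beginning with \<open>k\<close> independent eigenvectors for one eigenvalue
  the matrix has the form required by \<open>commutant_block\<close>. With \<open>k = 1\<close> this
  is the induction step of the general bound; with \<open>k = 2\<close> it produces the surplus for
  noncyclic matrices.\<close>

lemma commutant_eigenvectors:
  fixes A :: "'a::field mat"
  assumes A: "A \<in> carrier_mat (k + m) (k + m)"
    and v: "independent_vecs (k + m) k v" and eig: "\<And>i. i < k \<Longrightarrow> A *\<^sub>v v i = \<mu> \<cdot>\<^sub>v v i"
    and d: "\<And>D :: 'a mat. D \<in> carrier_mat m m \<Longrightarrow> mat_dim_ge m (commutant m D) d"
  shows "mat_dim_ge (k + m) (commutant (k + m) A) (k * k + d)"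
proof -
  let ?n = "k + m"
  obtain P where P: "P \<in> GL ?n" "\<And>i. i < k \<Longrightarrow> col P i = v i" using independent_vecs_extend[OF v] by auto
  have Pc: "P \<in> carrier_mat ?n ?n" using P(1) by (simp add: GL_def)
  obtain R where R: "R \<in> carrier_mat ?n ?n" "P * R = 1\<^sub>m ?n" "R * P = 1\<^sub>m ?n" using P(1) by (rule GL_inverse)
  let ?B = "R * (A * P)"
  have B: "?B \<in> carrier_mat ?n ?n" using R A Pc by simp
  have AP: "A * P = P * ?B"
    using assoc_mult_mat[OF Pc R(1) mult_carrier_mat[OF A Pc]] R(2) A Pc by simp
  have "?B $$ (i, j) = (if i = j then \<mu> else 0)" if ij: "i < ?n" "j < k" for i j
  proof -
    have j: "j < ?n" using ij by simp
    have vc: "v j \<in> carrier_vec ?n" using v ij by (simp add: independent_vecs_def)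
    have "R *\<^sub>v v j = col (R * P) j" using col_mult2[OF R(1) Pc j] P(2) ij by simp
    then have Rv: "R *\<^sub>v v j = unit_vec ?n j" unfolding R(3) using j by simp
    have "col ?B j = R *\<^sub>v (\<mu> \<cdot>\<^sub>v v j)"
      using col_mult2[OF R(1) mult_carrier_mat[OF A Pc] j] col_mult2[OF A Pc j] P(2) eig ij by simp
    also have "\<dots> = \<mu> \<cdot>\<^sub>v unit_vec ?n j" using mult_mat_vec[OF R(1) vc] Rv by simp
    finally have "col ?B j $ i = (\<mu> \<cdot>\<^sub>v unit_vec ?n j) $ i" by simp
    moreover have "col ?B j $ i = ?B $$ (i, j)" by (rule index_col) (use R A Pc ij j in auto)
    ultimately show ?thesis using ij j by (simp add: unit_vec_def)
  qed
  then have "mat_dim_ge ?n (commutant ?n ?B) (k * k + d)"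
    by (intro commutant_block[OF B _ refl]) (auto intro: d)
  then show ?thesis by (rule mat_dim_ge_conj[OF A P(1) B AP])
qed

lemma independent_vecs_1:
  assumes "v \<in> carrier_vec n" "v \<noteq> 0\<^sub>v n"
  shows "independent_vecs n 1 (\<lambda>_. v)"
proof -
  obtain r where "r < n" "v $ r \<noteq> 0" using assms by (metis carrier_vecD eq_vecI index_zero_vec)
  then show ?thesis using assms by (auto simp: independent_vecs_def)
qed

text \<open>One eigenvector is split off at each step, and each contributes \<open>1 * 1\<close> to
  the bound.\<close>

lemma alg_closed_commutant_dim:
  fixes A :: "'a::alg_closed_field mat"
  assumes "A \<in> carrier_mat n n"
  shows "mat_dim_ge n (commutant n A) n"
  using assms
proof (induction n arbitrary: A)
  case 0
  then show ?case by (simp add: mat_dim_ge_def echelon_def)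
next
  case (Suc n)
  have "degree (char_poly A) > 0" using degree_monic_char_poly[OF Suc.prems] by simp
  then obtain \<mu> where "poly (char_poly A) \<mu> = 0" using alg_closed_imp_poly_has_root by blast
  then have "eigenvalue A \<mu>" using eigenvalue_root_char_poly[OF Suc.prems] by simp
  then obtain v where v: "v \<in> carrier_vec (Suc n)" "v \<noteq> 0\<^sub>v (Suc n)" "A *\<^sub>v v = \<mu> \<cdot>\<^sub>v v"
    using Suc.prems by (auto simp: eigenvalue_def eigenvector_def)
  have "mat_dim_ge (1 + n) (commutant (1 + n) A) (1 * 1 + n)"
    using Suc v independent_vecs_1[OF v(1,2)] by (intro commutant_eigenvectors[where v = "\<lambda>_. v"]) auto
  then show ?case by simp
qed

text \<open>If all eigenspaces were lines, the kernel of a product of \<open>m\<close> linear factors would be cut out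
  by \<open>m\<close> linear forms.\<close>

lemma kernel_linear_forms:
  fixes A :: "'a::field mat"
  assumes A: "A \<in> carrier_mat n n"
    and line: "\<And>\<mu> v w. v \<in> carrier_vec n \<Longrightarrow> w \<in> carrier_vec n \<Longrightarrow> v \<noteq> 0\<^sub>v n \<Longrightarrow>
      A *\<^sub>v v = \<mu> \<cdot>\<^sub>v v \<Longrightarrow> A *\<^sub>v w = \<mu> \<cdot>\<^sub>v w \<Longrightarrow> \<exists>c. w = c \<cdot>\<^sub>v v"
  shows "\<exists>E. finite E \<and> card E \<le> size L \<and>
    (\<forall>u\<in>carrier_vec n. act n A (\<Prod>x\<in>#L. [:- x, 1:]) u = 0\<^sub>v n \<longrightarrow>
       (\<forall>a\<in>E. (\<Sum>j<n. a j * u $ j) = 0) \<longrightarrow> u = 0\<^sub>v n)"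
proof (induction L)
  case empty
  then show ?case using act_one[OF A] by (intro exI[of _ "{}"]) auto
next
  case (add \<mu> L)
  let ?m = "\<Prod>x\<in>#L. [:- x, 1:]"
  obtain E where E: "finite E" "card E \<le> size L"
    "\<And>u. u \<in> carrier_vec n \<Longrightarrow> act n A ?m u = 0\<^sub>v n \<Longrightarrow> \<forall>a\<in>E. (\<Sum>j<n. a j * u $ j) = 0 \<Longrightarrow> u = 0\<^sub>v n"
    using add.IH by blast
  \<comment> \<open>Applying the last linear factor to \<open>?m(A) u\<close> gives zero, so this
    vector lies in the eigenspace of \<mu>, which is at most a line.\<close>
  have eig: "A *\<^sub>v act n A ?m u = \<mu> \<cdot>\<^sub>v act n A ?m u"
    if u: "u \<in> carrier_vec n" and z: "act n A (\<Prod>x\<in>#add_mset \<mu> L. [:- x, 1:]) u = 0\<^sub>v n" for u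
  proof -
    let ?w = "act n A ?m u"
    have w: "?w \<in> carrier_vec n" using act_carrier[OF A u] .
    have "[:- \<mu>, 1:] * ?m = [:0, 1:] * ?m - smult \<mu> ?m" by simp
    then have "act n A [:0, 1:] ?w - \<mu> \<cdot>\<^sub>v ?w = 0\<^sub>v n"
      using z act_diff[OF A u, of "[:0, 1:] * ?m" "smult \<mu> ?m"] act_mult[OF A u, of "[:0, 1:]" ?m]
        act_smult[OF A u, of \<mu> ?m] by simp
    then have e: "A *\<^sub>v ?w - \<mu> \<cdot>\<^sub>v ?w = 0\<^sub>v n" by (simp only: eval_mat_X[OF A])
    show ?thesis
    proof (rule eq_vecI)
      fix i assume "i < dim_vec (\<mu> \<cdot>\<^sub>v ?w)"
      then have i: "i < n" using A by simp
      show "(A *\<^sub>v ?w) $ i = (\<mu> \<cdot>\<^sub>v ?w) $ i"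
        using arg_cong[OF e, of "\<lambda>v. vec_index v i"] i A w by (simp del: index_mult_mat_vec)
    qed (use A w in simp)
  qed
  show ?case
  proof (cases "\<exists>u\<in>carrier_vec n. act n A (\<Prod>x\<in>#add_mset \<mu> L. [:- x, 1:]) u = 0\<^sub>v n \<and> act n A ?m u \<noteq> 0\<^sub>v n")
    case False
    then show ?thesis using E by (intro exI[of _ E]) auto
  next
    case True
    then obtain u0 where u0: "u0 \<in> carrier_vec n" "act n A (\<Prod>x\<in>#add_mset \<mu> L. [:- x, 1:]) u0 = 0\<^sub>v n"
      "act n A ?m u0 \<noteq> 0\<^sub>v n" by blast
    let ?z = "act n A ?m u0"
    have zc: "?z \<in> carrier_vec n" using act_carrier[OF A u0(1)] .
    obtain r where r: "r < n" "?z $ r \<noteq> 0" using zc u0(3) by (metis carrier_vecD eq_vecI index_zero_vec)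
    \<comment> \<open>The vectors \<open>?m(A) u\<close> are multiples of \<open>?z\<close>. The
      coordinate \<open>r\<close>, where \<open>?z\<close> is nonzero, decides whether such a
      multiple vanishes, and as a function of \<open>u\<close> it is a linear form.\<close>
    define b where "b = (\<lambda>j. eval_mat n A ?m $$ (r, j))"
    have b: "(\<Sum>j<n. b j * u $ j) = act n A ?m u $ r" if "u \<in> carrier_vec n" for u
      using that r(1) A by (auto simp: b_def scalar_prod_def lessThan_atLeast0)
    show ?thesis
    proof (intro exI[of _ "insert b E"] conjI ballI impI)
      show "finite (insert b E)" using E(1) by simp
      show "card (insert b E) \<le> size (add_mset \<mu> L)" using E(1,2) by (simp add: card_insert_if)
      fix u :: "'a vec" assume u: "u \<in> carrier_vec n" and z: "act n A (\<Prod>x\<in>#add_mset \<mu> L. [:- x, 1:]) u = 0\<^sub>v n"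
        and f: "\<forall>a\<in>insert b E. (\<Sum>j<n. a j * u $ j) = 0"
      obtain c where c: "act n A ?m u = c \<cdot>\<^sub>v ?z"
        using line[OF zc act_carrier[OF A u] u0(3) eig[OF u0(1,2)] eig[OF u z]] by blast
      have "c * ?z $ r = 0" using f b[OF u] c r(1) zc A by (simp del: index_mult_mat_vec)
      then have "c = 0" using r(2) by simp
      then have "act n A ?m u = 0\<^sub>v n" unfolding c using zc A by (intro eq_vecI) (auto simp del: index_mult_mat_vec)
      then show "u = 0\<^sub>v n" using E(3)[OF u] f by blast
    qed
  qed
qed

text \<open>\<open>f\<close> splits into fewer than \<open>n\<close> linear factors. If all
  eigenspaces were at most lines, \<open>kernel_linear_forms\<close> would cut the whole space down
  to zero by fewer than \<open>n\<close> linear forms. So some eigenvalue has two independent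
  eigenvectors.\<close>

lemma alg_closed_commutant_dim_noncyclic:
  fixes A :: "'a::alg_closed_field mat"
  assumes A: "A \<in> carrier_mat n n" and f: "f \<noteq> 0" "f \<in> polys_below n" "eval_mat n A f = 0\<^sub>m n n"
  shows "mat_dim_ge n (commutant n A) (Suc n)"
proof -
  obtain L where L: "size L = degree f" "f = smult (lead_coeff f) (\<Prod>x\<in>#L. [:-x, 1:])"
    using alg_closed_imp_factorization[OF f(1)] by blast
  have sz: "size L < n" using L(1) f by (simp add: polys_below_iff)
  define m where "m = (\<Prod>x\<in>#L. [:-x, 1:])"
  have km: "act n A m u = 0\<^sub>v n" if u: "u \<in> carrier_vec n" for u
  proof -
    have "m = smult (inverse (lead_coeff f)) f" using f(1) by (subst L(2)) (simp add: m_def)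
    then show ?thesis using act_smult[OF A u] eval_mat_zero_act[OF f(3) u]
      by (simp only:) (intro eq_vecI; simp)
  qed
  have "\<exists>\<mu> v w. v \<in> carrier_vec n \<and> w \<in> carrier_vec n \<and> v \<noteq> 0\<^sub>v n \<and>
      A *\<^sub>v v = \<mu> \<cdot>\<^sub>v v \<and> A *\<^sub>v w = \<mu> \<cdot>\<^sub>v w \<and> (\<forall>c. w \<noteq> c \<cdot>\<^sub>v v)"
  proof (rule ccontr)
    assume line: "\<not> ?thesis"
    have "\<exists>E. finite E \<and> card E \<le> size L \<and> (\<forall>u\<in>carrier_vec n. act n A m u = 0\<^sub>v n \<longrightarrow>
       (\<forall>a\<in>E. (\<Sum>j<n. a j * u $ j) = 0) \<longrightarrow> u = 0\<^sub>v n)"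
      unfolding m_def by (rule kernel_linear_forms[OF A]) (use line in blast)
    then obtain E where E: "finite E" "card E \<le> size L"
      and E': "\<forall>u\<in>carrier_vec n. act n A m u = 0\<^sub>v n \<longrightarrow>
         (\<forall>a\<in>E. (\<Sum>j<n. a j * u $ j) = 0) \<longrightarrow> u = 0\<^sub>v n" by (elim exE conjE)
    have "card E < card {..<n}" using E(2) sz by simp
    then obtain x where x: "\<exists>i\<in>{..<n}. x i \<noteq> 0" "\<forall>a\<in>E. (\<Sum>i<n. a i * x i) = 0"
      using homogeneous_system_solution[OF E(1), of "{..<n}"] by auto
    have "(\<Sum>j<n. a j * vec n x $ j) = 0" if "a \<in> E" for a
    proof -
      have "(\<Sum>j<n. a j * vec n x $ j) = (\<Sum>j<n. a j * x j)" by (rule sum.cong) auto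
      then show ?thesis using x(2) that by simp
    qed
    then have z: "vec n x = 0\<^sub>v n" using E' km[of "vec n x"] vec_carrier[of n x] by blast
    have "x i = 0" if "i < n" for i using arg_cong[OF z, of "\<lambda>v. vec_index v i"] that by simp
    then show False using x(1) by auto
  qed
  then obtain \<mu> v w where vw: "v \<in> carrier_vec n" "w \<in> carrier_vec n" "v \<noteq> 0\<^sub>v n"
    "A *\<^sub>v v = \<mu> \<cdot>\<^sub>v v" "A *\<^sub>v w = \<mu> \<cdot>\<^sub>v w" "\<And>c. w \<noteq> c \<cdot>\<^sub>v v" by blast
  define u where "u = (\<lambda>i :: nat. if i = 0 then v else w)"
  have ind: "independent_vecs n 2 u"
    unfolding independent_vecs_def
  proof (intro conjI allI impI)
    show "u i \<in> carrier_vec n" for i using vw by (simp add: u_def)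
    fix c i assume c: "\<forall>r<n. (\<Sum>i<2. c i * u i $ r) = 0" and i: "i < (2 :: nat)"
    have c': "c 0 * v $ r + c 1 * w $ r = 0" if "r < n" for r
      using c that by (simp add: u_def numeral_2_eq_2)
    have c1: "c 1 = 0"
    proof (rule ccontr)
      assume "c 1 \<noteq> 0"
      have "w = (- c 0 / c 1) \<cdot>\<^sub>v v"
      proof (rule eq_vecI)
        fix r assume "r < dim_vec ((- c 0 / c 1) \<cdot>\<^sub>v v)"
        then have r: "r < n" using vw(1) by simp
        have "c 1 * w $ r = - c 0 * v $ r" using c'[OF r] by (simp add: eq_neg_iff_add_eq_0 add.commute)
        then show "w $ r = ((- c 0 / c 1) \<cdot>\<^sub>v v) $ r"
          using \<open>c 1 \<noteq> 0\<close> r vw(1) by (simp add: field_simps)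
      qed (use vw in simp)
      then show False using vw(6) by blast
    qed
    obtain r where "r < n" "v $ r \<noteq> 0" using vw(1,3) by (metis carrier_vecD eq_vecI index_zero_vec)
    then have "c 0 = 0" using c'[of r] c1 by simp
    then show "c i = 0" using c1 i by (auto simp: less_2_cases_iff)
  qed
  have "n \<ge> 2"
  proof (rule ccontr)
    assume "\<not> n \<ge> 2"
    then have "card {..<n} < card {..<2 :: nat}" by simp
    then have "\<exists>x. (\<exists>i\<in>{..<2}. x i \<noteq> 0) \<and> (\<forall>r\<in>{..<n}. (\<Sum>i<2. u i $ r * x i) = 0)"
      by (intro linear_forms_common_zero) (auto simp: linear_form_def)
    then obtain x where x: "\<exists>i\<in>{..<2}. x i \<noteq> 0" "\<forall>r<n. (\<Sum>i<2. x i * u i $ r) = 0"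
      by (auto simp: mult.commute)
    then have "\<forall>i<2. x i = 0" using ind unfolding independent_vecs_def by blast
    then show False using x(1) by auto
  qed
  then obtain m' where n: "n = 2 + m'" using le_Suc_ex by blast
  \<comment> \<open>Two eigenvectors contribute \<open>2 * 2\<close> and the remaining block of size
    \<open>n - 2\<close> at least its size, in total \<open>n + 2\<close>.\<close>
  have "mat_dim_ge (2 + m') (commutant (2 + m') A) (2 * 2 + m')"
    using A ind vw unfolding n
    by (intro commutant_eigenvectors[where v = u and \<mu> = \<mu>] alg_closed_commutant_dim) (auto simp: u_def)
  then show ?thesis unfolding n by (rule mat_dim_ge_mono) simp
qed

section \<open>Krull dimension of centralizers\<close>

lemma poly_fun_sum:
  assumes "finite S" "\<And>s. s \<in> S \<Longrightarrow> f s \<in> poly_fun n"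
  shows "(\<lambda>A. \<Sum>s\<in>S. f s A) \<in> poly_fun n"
  using assms
proof (induction S)
  case empty
  then show ?case using poly_fun.const[of 0] by simp
next
  case (insert s S)
  then have "(\<lambda>A. f s A + (\<Sum>s\<in>S. f s A)) \<in> poly_fun n" by (intro poly_fun.add) simp_all
  then show ?case using insert.hyps by simp
qed

lemma poly_fun_prod:
  assumes "finite S" "\<And>s. s \<in> S \<Longrightarrow> f s \<in> poly_fun n"
  shows "(\<lambda>A. \<Prod>s\<in>S. f s A) \<in> poly_fun n"
  using assms
proof (induction S)
  case empty
  then show ?case using poly_fun.const[of 1] by simp
next
  case (insert s S)
  then have "(\<lambda>A. f s A * (\<Prod>s\<in>S. f s A)) \<in> poly_fun n" by (intro poly_fun.mult) simp_all
  then show ?case using insert.hyps by simp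
qed

lemma det_poly_fun:
  "\<exists>f\<in>poly_fun n. \<forall>A\<in>carrier_mat n n. f A = det (A :: 'a::field mat)"
proof (intro bexI ballI)
  let ?f = "\<lambda>A :: 'a mat. \<Sum>p\<in>{p. p permutes {0..<n}}. signof p * (\<Prod>i\<in>{0..<n}. A $$ (i, p i))"
  show "?f \<in> poly_fun n"
  proof (intro poly_fun_sum poly_fun.mult poly_fun.const poly_fun_prod poly_fun.entry finite_permutations)
    fix p i assume "p \<in> {p. p permutes {0..<n}}" "i \<in> {0..<n}"
    then have "p i \<in> {0..<n}" by (simp add: permutes_in_image)
    then show "i < n" "p i < n" using \<open>i \<in> {0..<n}\<close> by auto
  qed auto
  show "?f A = det A" if "A \<in> carrier_mat n n" for A
    using that by (simp add: det_def')
qed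

section \<open>Lower bound for the Krull dimension: lines and linear sections\<close>

definition mat_line :: "nat \<Rightarrow> 'a::field mat \<Rightarrow> 'a mat \<Rightarrow> 'a \<Rightarrow> 'a mat" where
  "mat_line n a b t = mat n n (\<lambda>ij. a $$ ij + t * b $$ ij)"

lemma mat_line_carrier [simp]: "mat_line n a b t \<in> carrier_mat n n"
  by (simp add: mat_line_def)

lemma mat_line_0: "a \<in> carrier_mat n n \<Longrightarrow> mat_line n a b 0 = a"
  by (auto simp: mat_line_def intro!: eq_matI)

lemma mat_line_1: "a \<in> carrier_mat n n \<Longrightarrow> b \<in> carrier_mat n n \<Longrightarrow> mat_line n a (b - a) 1 = b"
  by (auto simp: mat_line_def intro!: eq_matI)

lemma mat_line_commutant:
  assumes A: "A \<in> carrier_mat n n" and a: "a \<in> commutant n A" and b: "b \<in> commutant n A"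
  shows "mat_line n a b t \<in> commutant n A"
proof -
  have "mat_line n a b t = mat_comb n 2 (\<lambda>l. if l = 0 then a else b) (\<lambda>l. if l = 0 then 1 else t)"
    by (auto simp: mat_line_def mat_comb_def numeral_2_eq_2 intro!: eq_matI)
  moreover have "mat_comb n 2 (\<lambda>l. if l = 0 then a else b) (\<lambda>l. if l = 0 then 1 else t) \<in> commutant n A"
    by (rule mat_comb_commutant[OF A]) (simp add: a b)
  ultimately show ?thesis by simp
qed

lemma commutant_diff:
  assumes A: "A \<in> carrier_mat n n" and a: "a \<in> commutant n A" and b: "b \<in> commutant n A"
  shows "b - a \<in> commutant n A"
proof -
  have c: "a \<in> carrier_mat n n" "b \<in> carrier_mat n n" using a b by (auto simp: commutant_def)
  have "b - a = mat_line n b a (- 1)" using c by (auto simp: mat_line_def intro!: eq_matI)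
  then show ?thesis using mat_line_commutant[OF A b a] by simp
qed

lemma poly_fun_on_line:
  assumes "f \<in> poly_fun n"
  shows "\<exists>\<pi>. \<forall>t. f (mat_line n a b t) = poly \<pi> t"
  using assms
proof induction
  case (const c)
  then show ?case by (intro exI[of _ "[:c:]"]) simp
next
  case (entry i j)
  then show ?case by (intro exI[of _ "[:a $$ (i, j), b $$ (i, j):]"]) (simp add: mat_line_def)
next
  case (add p q)
  from add.IH obtain \<pi> \<rho> where "\<forall>t. p (mat_line n a b t) = poly \<pi> t" "\<forall>t. q (mat_line n a b t) = poly \<rho> t"
    by (elim exE)
  then show ?case by (intro exI[of _ "\<pi> + \<rho>"]) simp
next
  case (mult p q)
  from mult.IH obtain \<pi> \<rho> where "\<forall>t. p (mat_line n a b t) = poly \<pi> t" "\<forall>t. q (mat_line n a b t) = poly \<rho> t"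
    by (elim exE)
  then show ?case by (intro exI[of _ "\<pi> * \<rho>"]) simp
qed

lemma exists_non_root:
  fixes \<pi> :: "'a::field poly"
  assumes "infinite (UNIV :: 'a set)" "\<pi> \<noteq> 0"
  shows "\<exists>t. poly \<pi> t \<noteq> 0"
proof (rule ccontr)
  assume "\<not> ?thesis"
  then have "{t. poly \<pi> t = 0} = UNIV" by auto
  then show False using poly_roots_finite[OF assms(2)] assms(1) by simp
qed

lemma closedin_centralizer:
  "closedin (subtopology (zariski n) (centralizer_GL n A)) Z \<longleftrightarrow>
     (\<exists>S\<subseteq>poly_fun n. Z = zero_locus n S \<inter> centralizer_GL n A)"
  unfolding closedin_subtopology closedin_zariski by (metis (no_types))

lemma topspace_centralizer:
  "topspace (subtopology (zariski n) (centralizer_GL n A)) = centralizer_GL n A"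
  unfolding topspace_subtopology topspace_zariski centralizer_GL_def GL_def by blast

lemma centralizer_GL_alt: "centralizer_GL n A = commutant n A \<inter> GL n"
  unfolding centralizer_GL_def commutant_def GL_def by blast

text \<open>Two polynomial functions nonzero at points \<open>a\<close>, \<open>b\<close> of \<open>Z\<close> are simultaneously nonzero at a point of
  the line through \<open>a\<close> and \<open>b\<close>.\<close>

lemma irreducible_in_if_line_closed:
  fixes A :: "'a::field mat"
  assumes inf: "infinite (UNIV :: 'a set)"
    and Z: "Z \<subseteq> centralizer_GL n A" "Z \<noteq> {}"
    and line: "\<And>a b t. a \<in> Z \<Longrightarrow> b \<in> Z \<Longrightarrow> det (mat_line n a (b - a) t) \<noteq> 0 \<Longrightarrow> mat_line n a (b - a) t \<in> Z"
  shows "irreducible_in (subtopology (zariski n) (centralizer_GL n A)) Z"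
  unfolding irreducible_in_def topspace_centralizer
proof (intro conjI Z allI impI)
  fix C D assume C: "closedin (subtopology (zariski n) (centralizer_GL n A)) C"
    and D: "closedin (subtopology (zariski n) (centralizer_GL n A)) D" and sub: "Z \<subseteq> C \<union> D"
  obtain S where S: "S \<subseteq> poly_fun n" "C = zero_locus n S \<inter> centralizer_GL n A" using C closedin_centralizer by blast
  obtain T where T: "T \<subseteq> poly_fun n" "D = zero_locus n T \<inter> centralizer_GL n A" using D closedin_centralizer by blast
  have GL: "a \<in> GL n" if "a \<in> Z" for a using that Z(1) by (auto simp: centralizer_GL_def)
  have car: "a \<in> carrier_mat n n" if "a \<in> Z" for a using GL[OF that] by (simp add: GL_def)
  show "Z \<subseteq> C \<or> Z \<subseteq> D"
  proof (rule ccontr)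
    assume "\<not> (Z \<subseteq> C \<or> Z \<subseteq> D)"
    then obtain a b where ab: "a \<in> Z" "a \<notin> C" "b \<in> Z" "b \<notin> D" by blast
    obtain p where p: "p \<in> S" "p a \<noteq> 0" using ab(1,2) S(2) Z(1) car by (auto simp: zero_locus_def)
    obtain r where r: "r \<in> T" "r b \<noteq> 0" using ab(3,4) T(2) Z(1) car by (auto simp: zero_locus_def)
    obtain f where f: "f \<in> poly_fun n" "\<forall>M\<in>carrier_mat n n. f M = det (M :: 'a mat)" using det_poly_fun by blast
    let ?l = "mat_line n a (b - a)"
    obtain \<pi> where \<pi>: "\<And>t. p (?l t) = poly \<pi> t" using poly_fun_on_line[of p n a "b - a"] p(1) S(1) by blast
    obtain \<rho> where \<rho>: "\<And>t. r (?l t) = poly \<rho> t" using poly_fun_on_line[of r n a "b - a"] r(1) T(1) by blast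
    \<comment> \<open>The determinant is carried along so that the chosen point of the line is
      invertible and hence lies in \<open>Z\<close>.\<close>
    obtain \<delta> where \<delta>: "\<And>t. f (?l t) = poly \<delta> t" using poly_fun_on_line[OF f(1), of a "b - a"] by blast
    have "poly \<pi> 0 \<noteq> 0" using \<pi>[of 0] p(2) mat_line_0[OF car[OF ab(1)]] by simp
    moreover have "poly \<rho> 1 \<noteq> 0" using \<rho>[of 1] r(2) mat_line_1[OF car[OF ab(1)] car[OF ab(3)]] by simp
    moreover have "poly \<delta> 0 \<noteq> 0"
      using \<delta>[of 0] f(2) mat_line_0[OF car[OF ab(1)]] car[OF ab(1)] GL[OF ab(1)] by (simp add: GL_iff_det)
    ultimately have "\<pi> * \<rho> * \<delta> \<noteq> 0" by auto
    then obtain t where t: "poly (\<pi> * \<rho> * \<delta>) t \<noteq> 0" using exists_non_root[OF inf] by blast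
    have "det (?l t) \<noteq> 0" using t \<delta>[of t] f(2) by auto
    then have "?l t \<in> Z" using line[OF ab(1,3)] by blast
    then consider "?l t \<in> C" | "?l t \<in> D" using sub by blast
    then show False
    proof cases
      case 1
      then have "p (?l t) = 0" using p(1) S(2) by (auto simp: zero_locus_def)
      then show False using t \<pi>[of t] by simp
    next
      case 2
      then have "r (?l t) = 0" using r(1) T(2) by (auto simp: zero_locus_def)
      then show False using t \<rho>[of t] by simp
    qed
  qed
qed

lemma krull_dim_geI:
  assumes "\<And>i. i \<le> d \<Longrightarrow> closedin T (Z i)" "\<And>i. i \<le> d \<Longrightarrow> irreducible_in T (Z i)"
    and "\<And>i. i < d \<Longrightarrow> Z i \<subset> Z (Suc i)"
  shows "enat d \<le> krull_dim T"
  unfolding krull_dim_def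
proof (intro Sup_upper CollectI exI conjI)
  show "\<forall>i\<le>d. closedin T (Z i) \<and> irreducible_in T (Z i)" "\<forall>i<d. Z i \<subset> Z (Suc i)"
    using assms by simp_all
qed (rule refl)

text \<open>An echelon family of length \<open>d\<close> gives a chain of length \<open>d\<close>:
  the pivots are released one by one, starting with the last. Each set is the invertible part of an
  affine space, hence irreducible, and the matrix belonging to the released pivot shows that the
  inclusion is strict.\<close>

lemma centralizer_dim_ge:
  fixes A :: "'a::field mat"
  assumes inf: "infinite (UNIV :: 'a set)" and A: "A \<in> carrier_mat n n"
    and d: "mat_dim_ge n (commutant n A) d"
  shows "enat d \<le> centralizer_dim n A"
proof -
  let ?C = "centralizer_GL n A"
  let ?T = "subtopology (zariski n) ?C"
  let ?E = "1\<^sub>m n :: 'a mat"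
  obtain M e where t: "echelon n (commutant n A) d M e" using d by (auto simp: mat_dim_ge_def)
  \<comment> \<open>The entries are prescribed to be those of the identity, not zero, so that every
    set contains an invertible matrix. The index \<open>d - i\<close> makes the chain
    increase.\<close>
  define Z where "Z = (\<lambda>i. {N \<in> ?C. \<forall>j<d - i. N $$ e j = ?E $$ e j})"
  have e: "e j \<in> {..<n} \<times> {..<n}" if "j < d" for j using t that by (simp add: echelon_def)
  have onecomm: "?E \<in> commutant n A" using A by (simp add: commutant_def)
  have one: "?E \<in> Z i" for i
    using onecomm one_mat_in_GL by (auto simp: Z_def centralizer_GL_alt)
  have sub: "Z i \<subseteq> ?C" for i by (auto simp: Z_def)
  show ?thesis
    unfolding centralizer_dim_def
  proof (rule krull_dim_geI[where Z = Z])
    fix i assume "i \<le> d"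
    let ?S = "(\<lambda>j N. N $$ e j + - (?E $$ e j)) ` {..<d - i}"
    have "?S \<subseteq> poly_fun n"
    proof
      fix f assume "f \<in> ?S"
      then obtain j where "j \<in> {..<d - i}" and f: "f = (\<lambda>N. N $$ e j + - (?E $$ e j))" by (rule imageE)
      then have j: "j < d" by simp
      have "(\<lambda>N :: 'a mat. N $$ (fst (e j), snd (e j))) \<in> poly_fun n"
        using e[OF j] by (intro poly_fun.entry) (auto simp: mem_Times_iff)
      then show "f \<in> poly_fun n" unfolding f by (intro poly_fun.add poly_fun.const) simp
    qed
    moreover have "Z i = zero_locus n ?S \<inter> ?C"
      by (auto simp: Z_def zero_locus_def centralizer_GL_def GL_def)
    ultimately show "closedin ?T (Z i)" unfolding closedin_centralizer by blast
    show "irreducible_in ?T (Z i)"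
    proof (rule irreducible_in_if_line_closed[OF inf sub])
      show "Z i \<noteq> {}" using one by blast
      fix a b u assume a: "a \<in> Z i" and b: "b \<in> Z i" and det: "det (mat_line n a (b - a) u) \<noteq> 0"
      have ab: "a \<in> commutant n A" "b \<in> commutant n A" using a b sub by (auto simp: centralizer_GL_alt)
      then have c: "a \<in> carrier_mat n n" "b \<in> carrier_mat n n" by (auto simp: commutant_def)
      have "mat_line n a (b - a) u \<in> commutant n A"
        by (rule mat_line_commutant[OF A ab(1) commutant_diff[OF A ab]])
      then have "mat_line n a (b - a) u \<in> ?C" using det by (simp add: centralizer_GL_alt GL_iff_det)
      moreover have "mat_line n a (b - a) u $$ e j = ?E $$ e j" if j: "j < d - i" for j
      proof -
        have "e j \<in> {..<n} \<times> {..<n}" using e j by simp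
        then obtain r s where rs: "e j = (r, s)" "r < n" "s < n" by auto
        have "a $$ (r, s) = ?E $$ (r, s)" "b $$ (r, s) = ?E $$ (r, s)"
          using a b j rs(1) by (auto simp: Z_def)
        then show ?thesis using c rs by (simp add: mat_line_def del: index_one_mat)
      qed
      ultimately show "mat_line n a (b - a) u \<in> Z i" by (simp add: Z_def)
    qed
  next
    fix i assume i: "i < d"
    define k where "k = d - Suc i"
    have k: "k < d" "d - i = Suc k" using i by (auto simp: k_def)
    have Mk: "M k \<in> commutant n A" "M k \<in> carrier_mat n n" "M k $$ e k \<noteq> 0" "\<And>j. j < k \<Longrightarrow> M k $$ e j = 0"
      using t k(1) by (auto simp: echelon_def)
    obtain f where f: "f \<in> poly_fun n" "\<forall>M\<in>carrier_mat n n. f M = det (M :: 'a mat)" using det_poly_fun by blast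
    obtain \<delta> where \<delta>: "\<And>t. f (mat_line n ?E (M k) t) = poly \<delta> t" using poly_fun_on_line[OF f(1)] by blast
    have "poly \<delta> 0 \<noteq> 0" using \<delta>[of 0] f(2) mat_line_0[of ?E n "M k"] by simp
    \<comment> \<open>The extra factor forces the parameter \<open>u\<close> to be nonzero, so that
      \<open>1 + u M\<close> differs from the identity at the pivot.\<close>
    then have "[:0, 1:] * \<delta> \<noteq> 0" by auto
    then obtain u where u: "poly ([:0, 1:] * \<delta>) u \<noteq> 0" using exists_non_root[OF inf] by blast
    let ?N = "mat_line n ?E (M k) u"
    have "det ?N \<noteq> 0" using u \<delta>[of u] f(2) by auto
    then have NC: "?N \<in> ?C"
      using mat_line_commutant[OF A onecomm Mk(1)] by (simp add: centralizer_GL_alt GL_iff_det)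
    have entry: "?N $$ e j = ?E $$ e j + u * M k $$ e j" if "j < d" for j
    proof -
      obtain r s where "e j = (r, s)" "r < n" "s < n" using e[OF \<open>j < d\<close>] by auto
      then show ?thesis by (simp add: mat_line_def)
    qed
    have "?N \<in> Z (Suc i)" using NC entry Mk(4) k by (auto simp: Z_def k_def)
    moreover have "?N \<notin> Z i" using entry[OF k(1)] Mk(3) u k by (auto simp: Z_def)
    moreover have "Z i \<subseteq> Z (Suc i)" by (auto simp: Z_def)
    ultimately show "Z i \<subset> Z (Suc i)" by blast
  qed
qed

section \<open>Upper bound for the Krull dimension: counting monomials\<close>

definition exponents :: "nat \<Rightarrow> nat \<Rightarrow> nat list set" where
  "exponents n D = {as. set as \<subseteq> {..D} \<and> length as = n}"

lemma card_exponents: "card (exponents n D) = Suc D ^ n"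
  and finite_exponents: "finite (exponents n D)"
  unfolding exponents_def by (simp_all add: card_lists_length_eq finite_lists_length_eq)

definition monomial_val :: "nat \<Rightarrow> (nat \<Rightarrow> 'a::field) \<Rightarrow> nat list \<Rightarrow> 'a" where
  "monomial_val n x as = (\<Prod>l<n. x l ^ (as ! l))"

text \<open>Functions of \<open>M\<close> that are polynomials, of degree at most \<open>D\<close> in each variable, in \<open>n\<close>
  coordinates \<open>x M\<close>.\<close>

inductive bounded_poly :: "nat \<Rightarrow> ('m \<Rightarrow> nat \<Rightarrow> 'a::field) \<Rightarrow> nat \<Rightarrow> ('m \<Rightarrow> 'a) \<Rightarrow> bool"
  for n x D where
  monomial: "as \<in> exponents n D \<Longrightarrow> bounded_poly n x D (\<lambda>M. monomial_val n (x M) as)"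
| add: "bounded_poly n x D f \<Longrightarrow> bounded_poly n x D g \<Longrightarrow> bounded_poly n x D (\<lambda>M. f M + g M)"
| scale: "bounded_poly n x D f \<Longrightarrow> bounded_poly n x D (\<lambda>M. c * f M)"

lemma bounded_poly_const: "bounded_poly n x D (\<lambda>M. c)"
proof -
  have "replicate n 0 \<in> exponents n D" by (auto simp: exponents_def)
  from bounded_poly.scale[OF bounded_poly.monomial[OF this], of x c]
  show ?thesis by (simp add: monomial_val_def)
qed

lemma bounded_poly_var:
  fixes x :: "'m \<Rightarrow> nat \<Rightarrow> 'a::field"
  assumes "l < n" "0 < D"
  shows "bounded_poly n x D (\<lambda>M. x M l)"
proof -
  have e: "(replicate n 0)[l := 1] \<in> exponents n D"
    using assms by (auto simp: exponents_def set_conv_nth nth_list_update)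
  have "monomial_val n y ((replicate n 0)[l := 1]) = y l" for y :: "nat \<Rightarrow> 'a"
  proof -
    have "monomial_val n y ((replicate n 0)[l := 1]) = (\<Prod>k<n. if k = l then y k else 1)"
      unfolding monomial_val_def using assms(1) by (intro prod.cong refl) (auto simp: nth_list_update)
    then show ?thesis using assms(1) by (simp add: prod.delta)
  qed
  then show ?thesis using bounded_poly.monomial[OF e, of x] by simp
qed

lemma bounded_poly_mono:
  assumes "bounded_poly n x D f" "D \<le> D'"
  shows "bounded_poly n x D' f"
  using assms(1)
proof induction
  case (monomial as)
  then have "as \<in> exponents n D'" using assms(2) by (force simp: exponents_def)
  then show ?case by (rule bounded_poly.monomial)
next
  case (add f g)
  show ?case by (rule bounded_poly.add[OF add.IH])
next
  case (scale f c)
  show ?case by (rule bounded_poly.scale[OF scale.IH])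
qed

lemma bounded_poly_sum:
  assumes "finite S" "\<And>s. s \<in> S \<Longrightarrow> bounded_poly n x D (f s)"
  shows "bounded_poly n x D (\<lambda>M. \<Sum>s\<in>S. f s M)"
  using assms
proof (induction S)
  case empty
  then show ?case using bounded_poly_const[of n x D 0] by simp
next
  case (insert s S)
  then have "bounded_poly n x D (\<lambda>M. f s M + (\<Sum>s\<in>S. f s M))" by (intro bounded_poly.add) simp_all
  then show ?case using insert.hyps by simp
qed

lemma bounded_poly_monomial_mult:
  fixes x :: "'m \<Rightarrow> nat \<Rightarrow> 'a::field"
  assumes as: "as \<in> exponents n D" and g: "bounded_poly n x D' g"
  shows "bounded_poly n x (D + D') (\<lambda>M. monomial_val n (x M) as * g M)"
  using g
proof induction
  case (monomial bs)
  let ?cs = "map2 (+) as bs"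
  have l: "length as = n" "length bs = n" using as monomial by (auto simp: exponents_def)
  have "as ! k + bs ! k \<le> D + D'" if k: "k < n" for k
  proof (rule add_mono)
    have "as ! k \<in> set as" "bs ! k \<in> set bs" using k l by simp_all
    moreover have "set as \<subseteq> {..D}" "set bs \<subseteq> {..D'}" using as monomial by (auto simp: exponents_def)
    ultimately have "as ! k \<in> {..D}" "bs ! k \<in> {..D'}" by blast+
    then show "as ! k \<le> D" "bs ! k \<le> D'" by simp_all
  qed
  then have "?cs \<in> exponents n (D + D')"
    using l by (auto simp: exponents_def set_conv_nth)
  then have "bounded_poly n x (D + D') (\<lambda>M. monomial_val n (x M) ?cs)" by (rule bounded_poly.monomial)
  moreover have "monomial_val n y ?cs = monomial_val n y as * monomial_val n y bs" for y :: "nat \<Rightarrow> 'a"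
    unfolding monomial_val_def prod.distrib[symmetric] using l by (intro prod.cong refl) (simp add: power_add)
  ultimately show ?case by simp
next
  case (add f g)
  then have "bounded_poly n x (D + D') (\<lambda>M. monomial_val n (x M) as * f M + monomial_val n (x M) as * g M)"
    by (intro bounded_poly.add) simp_all
  then show ?case by (simp add: distrib_left)
next
  case (scale f c)
  then have "bounded_poly n x (D + D') (\<lambda>M. c * (monomial_val n (x M) as * f M))"
    by (intro bounded_poly.scale) simp_all
  then show ?case by (simp add: mult_ac)
qed

lemma bounded_poly_mult:
  assumes f: "bounded_poly n x D f" and g: "bounded_poly n x D' g"
  shows "bounded_poly n x (D + D') (\<lambda>M. f M * g M)"
  using f
proof induction
  case (monomial as)
  then show ?case by (rule bounded_poly_monomial_mult[OF _ g])
next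
  case (add f h)
  then have "bounded_poly n x (D + D') (\<lambda>M. f M * g M + h M * g M)" by (intro bounded_poly.add) simp_all
  then show ?case by (simp add: distrib_right)
next
  case (scale f c)
  then have "bounded_poly n x (D + D') (\<lambda>M. c * (f M * g M))" by (intro bounded_poly.scale) simp_all
  then show ?case by (simp add: mult_ac)
qed

lemma bounded_poly_power:
  assumes "bounded_poly n x D f"
  shows "bounded_poly n x (D * k) (\<lambda>M. f M ^ k)"
proof (induction k)
  case 0
  then show ?case using bounded_poly_const[of n x 0 1] by simp
next
  case (Suc k)
  from bounded_poly_mult[OF assms Suc.IH] show ?case by simp
qed

lemma bounded_poly_coeffs:
  assumes "bounded_poly n x D f"
  shows "\<exists>c. \<forall>M. f M = (\<Sum>as\<in>exponents n D. c as * monomial_val n (x M) as)"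
  using assms
proof induction
  case (monomial as)
  have "monomial_val n (x M) as = (\<Sum>bs\<in>exponents n D. (if bs = as then 1 else 0) * monomial_val n (x M) bs)" for M
  proof -
    have "(\<Sum>bs\<in>exponents n D. (if bs = as then 1 else 0) * monomial_val n (x M) bs)
        = (\<Sum>bs\<in>exponents n D. if bs = as then monomial_val n (x M) bs else 0)"
      by (intro sum.cong) auto
    then show ?thesis using monomial finite_exponents[of n D] by simp
  qed
  then show ?case by (intro exI[of _ "\<lambda>bs. if bs = as then 1 else 0"] allI)
next
  case (add f g)
  from add.IH obtain c d where "\<forall>M. f M = (\<Sum>as\<in>exponents n D. c as * monomial_val n (x M) as)"
    "\<forall>M. g M = (\<Sum>as\<in>exponents n D. d as * monomial_val n (x M) as)" by (elim exE)
  then show ?case by (intro exI[of _ "\<lambda>as. c as + d as"]) (simp add: distrib_right sum.distrib)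
next
  case (scale f c)
  from scale.IH obtain d where "\<forall>M. f M = (\<Sum>as\<in>exponents n D. d as * monomial_val n (x M) as)" by (elim exE)
  then show ?case by (intro exI[of _ "\<lambda>as. c * d as"]) (simp add: sum_distrib_left mult.assoc)
qed

text \<open>On \<open>C\<close> the matrix entries are linear in the coordinates \<open>x\<close>,
  so a polynomial in the entries becomes a polynomial in the coordinates. Only the existence of some
  degree bound matters.\<close>

lemma poly_fun_bounded_poly:
  fixes A :: "'a::field mat"
  assumes f: "f \<in> poly_fun n"
    and C: "\<And>M i j. M \<in> C \<Longrightarrow> i < n \<Longrightarrow> j < n \<Longrightarrow> M $$ (i, j) = (\<Sum>l<m. b l $$ (i, j) * x M l)"
  shows "\<exists>D h. bounded_poly m x D h \<and> (\<forall>M\<in>C. f M = h M)"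
  using f
proof induction
  case (const c)
  show ?case using bounded_poly_const[of m x 0 c] by (intro exI[of _ 0] exI[of _ "\<lambda>_. c"]) simp
next
  case (entry i j)
  have "bounded_poly m x 1 (\<lambda>M. \<Sum>l<m. b l $$ (i, j) * x M l)"
    by (intro bounded_poly_sum bounded_poly.scale bounded_poly_var) auto
  then show ?case using C entry by (intro exI[of _ 1] exI[of _ "\<lambda>M. \<Sum>l<m. b l $$ (i, j) * x M l"]) simp
next
  case (add p q)
  from add.IH obtain D h D' h' where h: "bounded_poly m x D h" "\<forall>M\<in>C. p M = h M"
    "bounded_poly m x D' h'" "\<forall>M\<in>C. q M = h' M" by (elim exE conjE)
  have "bounded_poly m x (max D D') (\<lambda>M. h M + h' M)"
    by (intro bounded_poly.add bounded_poly_mono[OF h(1)] bounded_poly_mono[OF h(3)]) auto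
  then show ?case using h by (intro exI[of _ "max D D'"] exI[of _ "\<lambda>M. h M + h' M"]) simp
next
  case (mult p q)
  from mult.IH obtain D h D' h' where h: "bounded_poly m x D h" "\<forall>M\<in>C. p M = h M"
    "bounded_poly m x D' h'" "\<forall>M\<in>C. q M = h' M" by (elim exE conjE)
  have "bounded_poly m x (D + D') (\<lambda>M. h M * h' M)" by (rule bounded_poly_mult[OF h(1,3)])
  then show ?case using h by (intro exI[of _ "D + D'"] exI[of _ "\<lambda>M. h M * h' M"]) simp
qed

text \<open>The head of the list is the exponent of the function with the largest index. The tail
  then concerns an initial part of the chain, which suits induction along it.\<close>

fun chain_monomial :: "(nat \<Rightarrow> 'm \<Rightarrow> 'a::field) \<Rightarrow> nat list \<Rightarrow> 'm \<Rightarrow> 'a" where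
  "chain_monomial f [] M = 1"
| "chain_monomial f (j # js) M = f (length js) M ^ j * chain_monomial f js M"

lemma chain_monomial_bounded_poly:
  assumes "\<And>i. i < length js \<Longrightarrow> bounded_poly n x D (f i)" "set js \<subseteq> {..N}"
  shows "bounded_poly n x (length js * (D * N)) (chain_monomial f js)"
  using assms
proof (induction js)
  case Nil
  have "chain_monomial f [] = (\<lambda>_. 1)" by (rule ext) simp
  then show ?case using bounded_poly_const[of n x 0 1] by simp
next
  case (Cons j js)
  have "chain_monomial f (j # js) = (\<lambda>M. f (length js) M ^ j * chain_monomial f js M)" by (rule ext) simp
  moreover have "bounded_poly n x (D * j + length js * (D * N)) (\<lambda>M. f (length js) M ^ j * chain_monomial f js M)"
    using Cons by (intro bounded_poly_mult bounded_poly_power) simp_all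
  then have "bounded_poly n x (length (j # js) * (D * N)) (\<lambda>M. f (length js) M ^ j * chain_monomial f js M)"
    by (rule bounded_poly_mono) (use Cons.prems in simp)
  ultimately show ?case by simp
qed

lemma chain_monomial_cong:
  "(\<And>i. i < length js \<Longrightarrow> f i M = g i M) \<Longrightarrow> chain_monomial f js M = chain_monomial g js M"
  by (induction js) simp_all

lemma exponents_Suc: "exponents (Suc k) N = (\<lambda>(j, js). j # js) ` ({..N} \<times> exponents k N)"
  unfolding exponents_def by (auto simp: length_Suc_conv image_iff)

text \<open>Along a chain of irreducible closed sets, functions \<open>f i\<close> vanishing on \<open>Z i\<close> but not on
  \<open>Z (i + 1)\<close> are algebraically independent.\<close>

lemma chain_monomials_independent:
  fixes f :: "nat \<Rightarrow> 'a::field mat \<Rightarrow> 'a"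
  assumes P: "\<And>i. i < k \<Longrightarrow> f i \<in> poly_fun n"
    and Z0: "Z 0 \<noteq> {}" and sub: "\<And>i. i < k \<Longrightarrow> Z i \<subseteq> Z (Suc i)"
    and van: "\<And>i M. i < k \<Longrightarrow> M \<in> Z i \<Longrightarrow> f i M = 0" and nv: "\<And>i. i < k \<Longrightarrow> \<exists>M\<in>Z (Suc i). f i M \<noteq> 0"
    and irr: "\<And>i g h. i \<le> k \<Longrightarrow> g \<in> poly_fun n \<Longrightarrow> h \<in> poly_fun n \<Longrightarrow> \<forall>M\<in>Z i. g M * h M = 0 \<Longrightarrow>
       (\<forall>M\<in>Z i. g M = 0) \<or> (\<forall>M\<in>Z i. h M = 0)"
    and i: "i \<le> k"
    and rel: "\<forall>M\<in>Z i. (\<Sum>js\<in>exponents i N. c js * chain_monomial f js M) = 0"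
  shows "\<forall>js\<in>exponents i N. c js = 0"
  using i rel
proof (induction i arbitrary: c)
  case 0
  have "exponents 0 N = {[]}" by (auto simp: exponents_def)
  then show ?case using 0 Z0 by auto
next
  case (Suc i)
  have i: "i < k" "i \<le> k" using Suc.prems(1) by auto
  define G where "G = (\<lambda>d (j :: nat) M. \<Sum>js\<in>exponents i N. d j js * chain_monomial f js M)"
  have outer: "\<forall>M\<in>Z i. (\<Sum>js\<in>exponents i N. e js * chain_monomial f js M) = 0 \<Longrightarrow> \<forall>js\<in>exponents i N. e js = 0" for e
    using Suc.IH[OF i(2)] .
  have powP: "(\<lambda>M. f l M ^ j) \<in> poly_fun n" if "l < k" for l j
    using poly_fun_prod[of "{..<j}" "\<lambda>_. f l" n, OF _ P[OF that]] by simp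
  have chainP: "chain_monomial f js \<in> poly_fun n" if "length js \<le> k" for js
    using that
  proof (induction js)
    case Nil
    have "chain_monomial f [] = (\<lambda>_. 1)" by (rule ext) simp
    then show ?case using poly_fun.const[of 1] by simp
  next
    case (Cons j js)
    have "chain_monomial f (j # js) = (\<lambda>M. f (length js) M ^ j * chain_monomial f js M)" by (rule ext) simp
    then show ?case using poly_fun.mult[OF powP Cons.IH] Cons.prems by simp
  qed
  have GP: "G d j \<in> poly_fun n" for d j
    unfolding G_def
    by (intro poly_fun_sum finite_exponents poly_fun.mult poly_fun.const chainP)
      (use i in \<open>simp add: exponents_def\<close>)
  \<comment> \<open>A relation is read as a polynomial in \<open>f i\<close>. Restricting it to
    \<open>Z i\<close>, where \<open>f i\<close> vanishes, leaves the constant term, whose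
    coefficients are zero by the outer induction. The rest is divisible by \<open>f i\<close>, which
    can be cancelled on the irreducible set \<open>Z (Suc i)\<close> because it does not vanish
    there identically.\<close>
  have key: "\<forall>j<m. \<forall>js\<in>exponents i N. d j js = 0"
    if "\<forall>M\<in>Z (Suc i). (\<Sum>j<m. f i M ^ j * G d j M) = 0" for m d
    using that
  proof (induction m arbitrary: d)
    case 0
    then show ?case by simp
  next
    case (Suc m)
    have split: "(\<Sum>j<Suc m. f i M ^ j * G d j M) = G d 0 M + f i M * (\<Sum>j<m. f i M ^ j * G (\<lambda>j. d (Suc j)) j M)" for M
      unfolding sum.lessThan_Suc_shift sum_distrib_left by (simp add: mult.assoc G_def)
    have "\<forall>M\<in>Z i. G d 0 M = 0"
    proof
      fix M assume M: "M \<in> Z i"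
      then have "M \<in> Z (Suc i)" using sub[OF i(1)] by blast
      then have "G d 0 M + f i M * (\<Sum>j<m. f i M ^ j * G (\<lambda>j. d (Suc j)) j M) = 0"
        using Suc.prems unfolding split by blast
      then show "G d 0 M = 0" using van[OF i(1) M] by simp
    qed
    then have d0: "\<forall>js\<in>exponents i N. d 0 js = 0"
      using outer[of "d 0"] by (simp add: G_def)
    then have "G d 0 M = 0" for M by (simp add: G_def)
    then have "\<forall>M\<in>Z (Suc i). f i M * (\<Sum>j<m. f i M ^ j * G (\<lambda>j. d (Suc j)) j M) = 0"
      using Suc.prems unfolding split by simp
    then have "(\<forall>M\<in>Z (Suc i). f i M = 0) \<or> (\<forall>M\<in>Z (Suc i). (\<Sum>j<m. f i M ^ j * G (\<lambda>j. d (Suc j)) j M) = 0)"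
      by (intro irr poly_fun_sum poly_fun.mult powP GP P) (use i in simp_all)
    then have "\<forall>M\<in>Z (Suc i). (\<Sum>j<m. f i M ^ j * G (\<lambda>j. d (Suc j)) j M) = 0"
      using nv[OF i(1)] by blast
    then have "\<forall>j<m. \<forall>js\<in>exponents i N. d (Suc j) js = 0" by (rule Suc.IH)
    then show ?case using d0 by (auto simp: less_Suc_eq_0_disj)
  qed
  have inj: "inj_on (\<lambda>(j, js). j # js) ({..N} \<times> exponents i N)" by (auto simp: inj_on_def)
  have "(\<Sum>js\<in>exponents (Suc i) N. c js * chain_monomial f js M) = (\<Sum>j<Suc N. f i M ^ j * G (\<lambda>j js. c (j # js)) j M)" for M
  proof -
    have "(\<Sum>js\<in>exponents (Suc i) N. c js * chain_monomial f js M)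
      = (\<Sum>(j, js)\<in>{..N} \<times> exponents i N. c (j # js) * chain_monomial f (j # js) M)"
      unfolding exponents_Suc by (subst sum.reindex[OF inj]) (simp add: case_prod_unfold)
    also have "\<dots> = (\<Sum>j\<in>{..N}. \<Sum>js\<in>exponents i N. c (j # js) * chain_monomial f (j # js) M)"
      by (rule sum.cartesian_product[symmetric])
    also have "\<dots> = (\<Sum>j<Suc N. f i M ^ j * G (\<lambda>j js. c (j # js)) j M)"
      unfolding lessThan_Suc_atMost G_def sum_distrib_left
      by (intro sum.cong refl) (simp add: exponents_def mult_ac)
    finally show ?thesis .
  qed
  then have "\<forall>M\<in>Z (Suc i). (\<Sum>j<Suc N. f i M ^ j * G (\<lambda>j js. c (j # js)) j M) = 0" using Suc.prems(2) by simp
  from key[OF this] show ?case unfolding exponents_Suc by (auto simp: less_Suc_eq_le)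
qed

lemma irreducible_in_poly_fun:
  fixes A :: "'a::field mat"
  assumes irr: "irreducible_in (subtopology (zariski n) (centralizer_GL n A)) Z"
    and g: "g \<in> poly_fun n" and h: "h \<in> poly_fun n" and z: "\<forall>M\<in>Z. g M * h M = 0"
  shows "(\<forall>M\<in>Z. g M = 0) \<or> (\<forall>M\<in>Z. h M = 0)"
proof -
  let ?C = "centralizer_GL n A"
  have Z: "Z \<subseteq> ?C" using irr by (simp add: irreducible_in_def topspace_centralizer)
  have closed: "closedin (subtopology (zariski n) ?C) (zero_locus n {f} \<inter> ?C)" if "f \<in> poly_fun n" for f
    unfolding closedin_centralizer using that by (intro exI[of _ "{f}"]) simp
  have mem: "M \<in> zero_locus n {f} \<inter> ?C \<longleftrightarrow> f M = 0" if "M \<in> Z" for M f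
    using Z that by (auto simp: zero_locus_def centralizer_GL_def GL_def)
  have "Z \<subseteq> (zero_locus n {g} \<inter> ?C) \<union> (zero_locus n {h} \<inter> ?C)"
  proof
    fix M assume M: "M \<in> Z"
    then have "g M = 0 \<or> h M = 0" using z by simp
    then show "M \<in> (zero_locus n {g} \<inter> ?C) \<union> (zero_locus n {h} \<inter> ?C)"
      using mem[OF M] by blast
  qed
  then have "Z \<subseteq> zero_locus n {g} \<inter> ?C \<or> Z \<subseteq> zero_locus n {h} \<inter> ?C"
    using irr closed[OF g] closed[OF h] unfolding irreducible_in_def by blast
  then show ?thesis using mem by blast
qed

lemma eval_mat_index:
  assumes A: "A \<in> carrier_mat n n" and p: "p \<in> polys_below m" and ij: "i < n" "j < n"
  shows "eval_mat n A p $$ (i, j) = (\<Sum>l<m. eval_mat n A (monom 1 l) $$ (i, j) * coeff p l)"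
proof -
  have u: "act n A q (unit_vec n j) $ i = eval_mat n A q $$ (i, j)" for q
    using A ij by simp
  show ?thesis
    using act_index[OF A unit_vec_carrier ij(1) p, of j] unfolding u by (simp add: mult.commute)
qed

text \<open>Centralizer elements are polynomials in \<open>A\<close>, so their \<open>n\<close>
  coefficients are coordinates. A chain of length \<open>k\<close> supplies algebraically
  independent functions that are polynomials of degree at most \<open>D\<close> in each coordinate.
  Their monomials with exponents up to \<open>N\<close> number \<open>(N + 1)^k\<close> and lie in a
  space spanned by \<open>(k D N + 1)^n\<close> monomials; for large \<open>N\<close> this forces
  \<open>k \<le> n\<close>.\<close>

lemma centralizer_dim_cyclic_le:
  fixes A :: "'a::field mat"
  assumes cyc: "cyclic_mat n A"
  shows "centralizer_dim n A \<le> enat n"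
  unfolding centralizer_dim_def krull_dim_def
proof (rule Sup_least)
  let ?C = "centralizer_GL n A"
  let ?T = "subtopology (zariski n) ?C"
  fix d assume "d \<in> {enat k |k. \<exists>Z. (\<forall>i\<le>k. closedin ?T (Z i) \<and> irreducible_in ?T (Z i)) \<and> (\<forall>i<k. Z i \<subset> Z (Suc i))}"
  then obtain k Z where d: "d = enat k" and cl: "\<And>i. i \<le> k \<Longrightarrow> closedin ?T (Z i)"
    and irr: "\<And>i. i \<le> k \<Longrightarrow> irreducible_in ?T (Z i)" and strict: "\<And>i. i < k \<Longrightarrow> Z i \<subset> Z (Suc i)"
    by blast
  have A: "A \<in> carrier_mat n n" using cyc by (simp add: cyclic_mat_def)
  obtain v where v: "cyclic_vec n A v" using cyc by (auto simp: cyclic_mat_def)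
  have sub: "Z i \<subseteq> ?C" if "i \<le> k" for i using irr[OF that] by (simp add: irreducible_in_def topspace_centralizer)
  have "\<forall>M\<in>?C. \<exists>p. p \<in> polys_below n \<and> M = eval_mat n A p"
    using commutes_cyclic[OF A v] by (auto simp: centralizer_GL_alt commutant_def)
  from bchoice[OF this] obtain p where p: "\<And>M. M \<in> ?C \<Longrightarrow> p M \<in> polys_below n" "\<And>M. M \<in> ?C \<Longrightarrow> M = eval_mat n A (p M)"
    by blast
  define x where "x = (\<lambda>M. coeff (p M))"
  have coords: "M $$ (i, j) = (\<Sum>l<n. eval_mat n A (monom 1 l) $$ (i, j) * x M l)"
    if "M \<in> ?C" "i < n" "j < n" for M i j
    using eval_mat_index[OF A p(1)[OF that(1)] that(2,3)] p(2)[OF that(1)] by (simp add: x_def)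
  have "\<exists>f. f \<in> poly_fun n \<and> (\<forall>M\<in>Z i. f M = 0) \<and> (\<exists>M\<in>Z (Suc i). f M \<noteq> 0)" if i: "i < k" for i
  proof -
    obtain S where S: "S \<subseteq> poly_fun n" "Z i = zero_locus n S \<inter> ?C"
      using cl[of i] i unfolding closedin_centralizer by auto
    obtain M where M: "M \<in> Z (Suc i)" "M \<notin> Z i" using strict[OF i] by blast
    then have "M \<in> ?C" using sub[of "Suc i"] i by auto
    then obtain f where f: "f \<in> S" "f M \<noteq> 0"
      using M(2) S(2) by (auto simp: zero_locus_def centralizer_GL_def GL_def)
    then have "\<forall>M\<in>Z i. f M = 0" using S(2) by (auto simp: zero_locus_def)
    then show ?thesis using f S(1) M(1) by blast
  qed
  then have "\<forall>i\<in>{..<k}. \<exists>f. f \<in> poly_fun n \<and> (\<forall>M\<in>Z i. f M = 0) \<and> (\<exists>M\<in>Z (Suc i). f M \<noteq> 0)" by simp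
  from bchoice[OF this] obtain f where f: "\<And>i. i < k \<Longrightarrow> f i \<in> poly_fun n"
    "\<And>i M. i < k \<Longrightarrow> M \<in> Z i \<Longrightarrow> f i M = 0" "\<And>i. i < k \<Longrightarrow> \<exists>M\<in>Z (Suc i). f i M \<noteq> 0"
    by auto
  have "\<forall>i\<in>{..<k}. \<exists>Dh. bounded_poly n x (fst Dh) (snd Dh) \<and> (\<forall>M\<in>?C. f i M = snd Dh M)"
    using poly_fun_bounded_poly[where C = ?C and m = n and x = x, OF f(1) coords] by fastforce
  from bchoice[OF this] obtain Dh where
    Dh: "\<And>i. i < k \<Longrightarrow> bounded_poly n x (fst (Dh i)) (snd (Dh i))" "\<And>i M. i < k \<Longrightarrow> M \<in> ?C \<Longrightarrow> f i M = snd (Dh i) M"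
    by auto
  define D where "D = (\<Sum>i<k. fst (Dh i))"
  define h where "h = (\<lambda>i. snd (Dh i))"
  have h: "bounded_poly n x D (h i)" if "i < k" for i
    unfolding h_def by (rule bounded_poly_mono[OF Dh(1)[OF that]])
      (use that in \<open>auto simp: D_def intro: member_le_sum\<close>)
  have fh: "f i M = h i M" if "i < k" "M \<in> ?C" for i M using Dh(2)[OF that] by (simp add: h_def)
  have indep: "\<forall>js\<in>exponents k N. c js = 0"
    if "\<forall>M\<in>Z k. (\<Sum>js\<in>exponents k N. c js * chain_monomial f js M) = 0" for N c
  proof (rule chain_monomials_independent[where Z = Z and k = k, OF f(1) _ _ f(2,3)])
    show "Z 0 \<noteq> {}" using irr[of 0] by (simp add: irreducible_in_def)
    show "(\<forall>M\<in>Z i. g M = 0) \<or> (\<forall>M\<in>Z i. h M = 0)"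
      if "i \<le> k" "g \<in> poly_fun n" "h \<in> poly_fun n" "\<forall>M\<in>Z i. g M * h M = 0" for i g h
      by (rule irreducible_in_poly_fun[OF irr[OF that(1)] that(2-4)])
    show "\<forall>M\<in>Z k. (\<Sum>js\<in>exponents k N. c js * chain_monomial f js M) = 0" by (rule that)
  qed (use strict in auto)
  \<comment> \<open>Otherwise there are more chain monomials than coordinate monomials, and
    elimination yields a nontrivial relation on \<open>Z k\<close>, against independence.\<close>
  have count: "Suc N ^ k \<le> Suc (k * (D * N)) ^ n" for N
  proof (rule ccontr)
    assume "\<not> ?thesis"
    then have lt: "card (exponents n (k * (D * N))) < card (exponents k N)" by (simp add: card_exponents)
    let ?E = "exponents n (k * (D * N))"
    have "\<forall>js\<in>exponents k N. \<exists>c. \<forall>M. chain_monomial h js M = (\<Sum>as\<in>?E. c as * monomial_val n (x M) as)"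
    proof
      fix js assume js: "js \<in> exponents k N"
      then have "length js = k" "set js \<subseteq> {..N}" by (auto simp: exponents_def)
      then have "bounded_poly n x (k * (D * N)) (chain_monomial h js)"
        using chain_monomial_bounded_poly[of js n x D h N] h by simp
      then show "\<exists>c. \<forall>M. chain_monomial h js M = (\<Sum>as\<in>?E. c as * monomial_val n (x M) as)"
        by (rule bounded_poly_coeffs)
    qed
    from bchoice[OF this] obtain c where
      c: "\<And>js M. js \<in> exponents k N \<Longrightarrow> chain_monomial h js M = (\<Sum>as\<in>?E. c js as * monomial_val n (x M) as)"
      by blast
    have "\<exists>y. (\<exists>js\<in>exponents k N. y js \<noteq> 0) \<and> (\<forall>as\<in>?E. (\<Sum>js\<in>exponents k N. c js as * y js) = 0)"
      by (rule linear_forms_common_zero[OF finite_exponents finite_exponents lt]) (auto simp: linear_form_def)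
    then obtain y where y: "\<exists>js\<in>exponents k N. y js \<noteq> 0"
      "\<And>as. as \<in> ?E \<Longrightarrow> (\<Sum>js\<in>exponents k N. c js as * y js) = 0" by auto
    have "(\<Sum>js\<in>exponents k N. y js * chain_monomial f js M) = 0" if M: "M \<in> Z k" for M
    proof -
      have MC: "M \<in> ?C" using sub[of k] M by blast
      have "(\<Sum>js\<in>exponents k N. y js * chain_monomial f js M)
          = (\<Sum>js\<in>exponents k N. \<Sum>as\<in>?E. c js as * y js * monomial_val n (x M) as)"
      proof (rule sum.cong)
        fix js assume js: "js \<in> exponents k N"
        have "chain_monomial f js M = chain_monomial h js M"
          using js fh MC by (intro chain_monomial_cong) (auto simp: exponents_def)
        then show "y js * chain_monomial f js M = (\<Sum>as\<in>?E. c js as * y js * monomial_val n (x M) as)"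
          using c[OF js, of M] by (simp add: sum_distrib_left mult_ac)
      qed simp
      also have "\<dots> = (\<Sum>as\<in>?E. (\<Sum>js\<in>exponents k N. c js as * y js) * monomial_val n (x M) as)"
        unfolding sum_distrib_right by (rule sum.swap)
      also have "\<dots> = 0" using y(2) by simp
      finally show ?thesis .
    qed
    then have "\<forall>js\<in>exponents k N. y js = 0" using indep by blast
    then show False using y(1) by blast
  qed
  have "k \<le> n"
  proof (rule ccontr)
    assume "\<not> k \<le> n"
    then have kn: "Suc n \<le> k" by simp
    \<comment> \<open>Chosen so that the constant \<open>(k D + 1)^n\<close> in the count is below
      the one extra factor \<open>N + 1\<close> available when \<open>k\<close> exceeds
      \<open>n\<close>.\<close>
    define N where "N = Suc (k * D) ^ n"
    have "Suc N ^ Suc n \<le> Suc N ^ k" by (rule power_increasing[OF kn]) simp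
    also have "\<dots> \<le> Suc (k * (D * N)) ^ n" by (rule count)
    also have "\<dots> \<le> (Suc (k * D) * Suc N) ^ n" by (rule power_mono) (simp_all add: algebra_simps)
    also have "\<dots> = N * Suc N ^ n" by (simp only: power_mult_distrib N_def)
    finally show False by simp
  qed
  then show "d \<le> enat n" by (simp add: d)
qed

section \<open>Regular matrices are the cyclic matrices\<close>

text \<open>Over a finite field, 1 plus the product of all \<open>X - a\<close> takes only the value
  1 and has no root. Infinitude is what provides suitable points on lines.\<close>

lemma infinite_alg_closed: "infinite (UNIV :: 'a::alg_closed_field set)"
proof
  assume fin: "finite (UNIV :: 'a set)"
  let ?p = "(\<Prod>a\<in>UNIV. [:- a, 1:]) + 1 :: 'a poly"
  have "poly ?p x = 1" for x :: 'a
    using fin by (simp add: poly_prod prod_zero_iff)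
  moreover have "degree ?p = CARD('a)"
  proof -
    have "degree (\<Prod>a\<in>UNIV. [:- a, 1 :: 'a:]) = CARD('a)"
      using degree_prod_eq_sum_degree[of UNIV "\<lambda>a :: 'a. [:- a, 1:]"] by simp
    moreover have "CARD('a) > 0" using fin by (simp add: card_gt_0_iff)
    ultimately show ?thesis using degree_add_eq_left[of "1 :: 'a poly" "\<Prod>a\<in>UNIV. [:- a, 1:]"] by simp
  qed
  moreover have "CARD('a) > 0" using fin by (simp add: card_gt_0_iff)
  ultimately show False using alg_closed_imp_poly_has_root[of ?p] by simp
qed

lemma to_ac_comm_ring_hom: "comm_ring_hom (to_ac :: 'a::field \<Rightarrow> 'a alg_closure)"
  by unfold_locales simp_all

lemma map_mat_to_ac_eval_mat:
  fixes A :: "'a::field mat"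
  assumes A: "A \<in> carrier_mat n n"
  shows "map_mat to_ac (eval_mat n A p) = eval_mat n (map_mat to_ac A) (map_poly to_ac p)"
proof (induction p)
  case 0
  then show ?case by (intro eq_matI) auto
next
  case (pCons a p)
  interpret hom: comm_ring_hom "to_ac :: 'a \<Rightarrow> 'a alg_closure" by (rule to_ac_comm_ring_hom)
  have A': "map_mat to_ac A \<in> carrier_mat n n" using A by simp
  note c = eval_mat_carrier[OF A, of p]
  have "map_mat to_ac (a \<cdot>\<^sub>m 1\<^sub>m n + A * eval_mat n A p) = to_ac a \<cdot>\<^sub>m 1\<^sub>m n + map_mat to_ac (A * eval_mat n A p)"
    using A c by (intro eq_matI) (auto simp del: index_mult_mat(1))
  also have "map_mat to_ac (A * eval_mat n A p) = map_mat to_ac A * eval_mat n (map_mat to_ac A) (map_poly to_ac p)"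
    unfolding hom.mat_hom_mult[OF A c] pCons.IH ..
  finally show ?case
    using pCons.hyps by (simp add: eval_mat_pCons[OF A] eval_mat_pCons[OF A'] map_poly_pCons)
qed

text \<open>Forming the Krylov matrix and its determinant commutes with the embedding, which is
  injective, so the determinant stays nonzero.\<close>

lemma cyclic_mat_to_ac:
  fixes A :: "'a::field mat"
  assumes "cyclic_mat n A"
  shows "cyclic_mat n (map_mat to_ac A)"
proof -
  have A: "A \<in> carrier_mat n n" using assms by (simp add: cyclic_mat_def)
  then have A': "map_mat to_ac A \<in> carrier_mat n n" by simp
  obtain v where v: "cyclic_vec n A v" using assms by (auto simp: cyclic_mat_def)
  then have vc: "v \<in> carrier_vec n" by (simp add: cyclic_vec_def)
  let ?v = "map_vec to_ac v"
  have vc': "?v \<in> carrier_vec n" using vc by simp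
  have "krylov n (map_mat to_ac A) ?v = map_mat to_ac (krylov n A v)"
  proof (rule eq_matI)
    fix i j assume "i < dim_row (map_mat to_ac (krylov n A v))" "j < dim_col (map_mat to_ac (krylov n A v))"
    then have ij: "i < n" "j < n" by (auto simp: krylov_def)
    have "map_poly to_ac (monom 1 j :: 'a poly) = monom 1 j" by (simp add: map_poly_monom)
    then have "eval_mat n (map_mat to_ac A) (monom 1 j) = map_mat to_ac (eval_mat n A (monom 1 j))"
      using map_mat_to_ac_eval_mat[OF A, of "monom 1 j"] by simp
    then show "krylov n (map_mat to_ac A) ?v $$ (i, j) = map_mat to_ac (krylov n A v) $$ (i, j)"
      using ij A vc by (simp add: krylov_def scalar_prod_def to_ac_sum)
  qed (auto simp: krylov_def)
  then have "det (krylov n (map_mat to_ac A) ?v) = to_ac (det (krylov n A v))"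
    using comm_ring_hom.hom_det[OF to_ac_comm_ring_hom] by metis
  then have "cyclic_vec n (map_mat to_ac A) ?v"
    using krylov_det[OF A' vc'] krylov_det[OF A vc] v by simp
  then show ?thesis using A' by (auto simp: cyclic_mat_def)
qed

text \<open>It shows that the minimal centralizer dimension is attained by a cyclic matrix. The
  preimage of the identity under the Krylov bijection is a companion matrix; its polynomial has
  constant term 1 or, in general, a nonzero one, which gives invertibility.\<close>

lemma exists_cyclic_GL:
  assumes n: "n > 0"
  shows "\<exists>A\<in>(GL n :: 'a::field mat set). cyclic_mat n A"
proof -
  let ?f = "monom 1 n + 1 :: 'a poly"
  have f: "?f \<in> monics n"
    using bij_betw_monics[of n, where ?'a = 'a] n
    by (auto simp: bij_betw_def polys_below_def dest!: equalityD1)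
  have "1\<^sub>m n \<in> (\<lambda>(A, v). krylov n A v) ` (SIGMA A:cyclic_class n ?f. {v. cyclic_vec n A v})"
    using bij_betw_krylov[OF n f] one_mat_in_GL by (auto simp: bij_betw_def)
  then obtain A where A: "A \<in> cyclic_class n ?f" by auto
  have "poly ?f 0 = 1" using n by (simp add: poly_monom)
  then have "\<not> [:0, 1:] dvd ?f" using poly_eq_0_iff_dvd[of ?f 0] by simp
  then have "A \<in> GL n" using cyclic_class_GL[OF f A] by simp
  then show ?thesis using A by (auto simp: cyclic_class_def)
qed

text \<open>Over the closure every centralizer has dimension at least \<open>n\<close>, with
  equality for cyclic matrices. If \<open>A\<close> has no cyclic vector, a short annihilating
  polynomial over the small field maps to one over the closure, and the dimension exceeds that of a
  cyclic competitor.\<close>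

lemma regular_iff_cyclic:
  fixes A :: "'a::field mat"
  assumes n: "n > 0" and A: "A \<in> GL n"
  shows "regular n A \<longleftrightarrow> cyclic_mat n A"
proof
  have Ac: "A \<in> carrier_mat n n" using A by (simp add: GL_def)
  then have A': "map_mat to_ac A \<in> carrier_mat n n" by simp
  {
    assume c: "cyclic_mat n A"
    have "centralizer_dim n (map_mat to_ac A) \<le> centralizer_dim n B" if B: "B \<in> (GL n :: 'a alg_closure mat set)" for B
    proof -
      have Bc: "B \<in> carrier_mat n n" using B by (simp add: GL_def)
      have "centralizer_dim n (map_mat to_ac A) \<le> enat n"
        by (rule centralizer_dim_cyclic_le[OF cyclic_mat_to_ac[OF c]])
      also have "\<dots> \<le> centralizer_dim n B"
        by (rule centralizer_dim_ge[OF infinite_alg_closed Bc alg_closed_commutant_dim[OF Bc]])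
      finally show ?thesis .
    qed
    then show "regular n A" using A by (simp add: regular_def)
  }
  {
    assume r: "regular n A"
    show "cyclic_mat n A"
    proof (rule ccontr)
      assume "\<not> cyclic_mat n A"
      then obtain p where p: "p \<in> polys_below n" "eval_mat n A p = 0\<^sub>m n n" "p \<noteq> 0"
        using cyclic_mat_if_no_annihilator[OF Ac] by blast
      let ?p = "map_poly to_ac p"
      have "eval_mat n (map_mat to_ac A) ?p = map_mat to_ac (0\<^sub>m n n)"
        using map_mat_to_ac_eval_mat[OF Ac, of p] p(2) by simp
      then have p0: "eval_mat n (map_mat to_ac A) ?p = 0\<^sub>m n n" by (auto intro!: eq_matI)
      have "?p \<in> polys_below n" using p(1) by (simp add: polys_below_def coeff_map_poly)
      moreover have "?p \<noteq> 0" using p(3) by (simp add: map_poly_eq_0_iff)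
      ultimately have "mat_dim_ge n (commutant n (map_mat to_ac A)) (Suc n)"
        using alg_closed_commutant_dim_noncyclic[OF A' _ _ p0] by blast
      then have low: "enat (Suc n) \<le> centralizer_dim n (map_mat to_ac A)"
        by (rule centralizer_dim_ge[OF infinite_alg_closed A'])
      obtain B :: "'a alg_closure mat" where B: "B \<in> GL n" "cyclic_mat n B" using exists_cyclic_GL[OF n] by blast
      have "centralizer_dim n (map_mat to_ac A) \<le> centralizer_dim n B" using r B(1) by (simp add: regular_def)
      also have "\<dots> \<le> enat n" by (rule centralizer_dim_cyclic_le[OF B(2)])
      finally have "enat (Suc n) \<le> enat n" using low by (rule order_trans[rotated])
      then show False by simp
    qed
  }
qed

theorem theorem8:
  fixes q :: nat
  assumes "primepow q" and "CARD('a::{field,finite}) = q"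
  shows "(\<lambda>n. measure_pmf.prob (pmf_of_set (GL n :: 'a mat set)) {\<alpha>. regular n \<alpha>})
           \<longlonglongrightarrow> (1 - 1 / real q ^ 5) / (1 + 1 / real q ^ 3)"
proof -
  have "measure_pmf.prob (pmf_of_set (GL n :: 'a mat set)) {\<alpha>. regular n \<alpha>}
      = (\<Sum>f\<in>sieved {[:0, 1:]} n. 1 / real (totient_poly (f :: 'a poly)))" if n: "n > 0" for n
  proof -
    have "GL n \<inter> {\<alpha>. regular n \<alpha>} = {A \<in> (GL n :: 'a mat set). cyclic_mat n A}"
      using regular_iff_cyclic[OF n] by blast
    then show ?thesis
      using cyclic_proportion[OF n, where ?'a = 'a] measure_pmf_of_set[OF _ finite_GL] one_mat_in_GL
      by (metis empty_iff)
  qed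
  \<comment> \<open>The identity is available for positive \<open>n\<close>, as the Krylov bijection
    reads the vector off a first column; the limit ignores \<open>n = 0\<close>.\<close>
  then have "eventually (\<lambda>n. (\<Sum>f\<in>sieved {[:0, 1:]} n. 1 / real (totient_poly (f :: 'a poly)))
      = measure_pmf.prob (pmf_of_set (GL n :: 'a mat set)) {\<alpha>. regular n \<alpha>}) sequentially"
    by (intro eventually_mono[OF eventually_gt_at_top[of 0]]) simp
  from Lim_transform_eventually[OF sum_inverse_totient_poly_tendsto this]
  show ?thesis using assms(2) by simp
qed

end
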